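(* Let $p\in(0,\infty)$ and let $\mathfrak N_1$ and $\mathfrak N_2$ be two finite factors. If $\psi:\mathscr U(\mathfrak N_1)\to\mathscr U(\mathfrak N_2)$ is a surjective $L^p$-isometry, then there exist a unitary $W\in\mathfrak N_2$ and a $*$-isomorphism or a $*$-anti-isomorphism $\varphi:\mathfrak N_1\to\mathfrak N_2$ such that $\psi$ is of one of the following forms: (1) $\psi(U)=W\varphi(U)$ for every $U\in\mathscr U(\mathfrak N_1)$; (2) $\psi(U)=W\varphi(U^* )$ for every $U\in\mathscr U(\mathfrak N_1)$.
   Context: A finite factor is a von Neumann algebra factor admitting a (unique, faithful, normal) tracial state, i.e. $M_n(\mathbb C)$ or a $\mathrm{II}_1$ factor. For a finite factor $\mathfrak N$ with tracial state $\tau$, $\mathscr U(\mathfrak N)$ is its unitary group and $\|A\|_p:=\tau(|A|^p)^{1/p}$ for $A\in\mathfrak N$ (a norm if $p\ge1$, a quasi-norm if $0<p<1$). A map $\psi:\mathscr U(\mathfrak N_1)\to\mathscr U(\mathfrak N_2)$ is an $L^p$-isometry if $\|U-V\|_p=\|\psi(U)-\psi(V)\|_p$ for all $U,V\in\mathscr U(\mathfrak N_1)$, each side computed with the tracial state of the respective factor. A $*$-anti-isomorphism is a complex-linear bijection $\varphi$ with $\varphi(A^* )=\varphi(A)^*$ and $\varphi(AB)=\varphi(B)\varphi(A)$. *)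

theory Defs
  imports "HOL-Analysis.Analysis" "HOL-Computational_Algebra.Polynomial"
begin

section \<open>Complex Hilbert spaces\<close>

text \<open>
  The inner product is linear in its first argument and conjugate linear in the second one.
  Completeness, and the real normed structure, come from the class \<^class>\<open>banach\<close>.
\<close>

class complex_hilbert = banach +
  fixes scaleC :: "complex \<Rightarrow> 'a \<Rightarrow> 'a"  (infixr \<open>*\<^sub>C\<close> 75)
    and cinner :: "'a \<Rightarrow> 'a \<Rightarrow> complex"
  assumes scaleR_scaleC: "r *\<^sub>R x = complex_of_real r *\<^sub>C x"
    and scaleC_add_right: "c *\<^sub>C (x + y) = c *\<^sub>C x + c *\<^sub>C y"
    and scaleC_add_left: "(c + d) *\<^sub>C x = c *\<^sub>C x + d *\<^sub>C x"
    and scaleC_scaleC: "c *\<^sub>C d *\<^sub>C x = (c * d) *\<^sub>C x"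
    and scaleC_one: "1 *\<^sub>C x = x"
    and cinner_add_left: "cinner (x + y) z = cinner x z + cinner y z"
    and cinner_scaleC_left: "cinner (c *\<^sub>C x) y = c * cinner x y"
    and cinner_commute: "cinner y x = cnj (cinner x y)"
    and cinner_nonneg: "0 \<le> Re (cinner x x)"
    and cinner_eq_zero_iff: "cinner x x = 0 \<longleftrightarrow> x = 0"
    and norm_eq_sqrt_cinner: "norm x = sqrt (Re (cinner x x))"

instantiation complex :: complex_hilbert
begin

definition scaleC_complex :: "complex \<Rightarrow> complex \<Rightarrow> complex"
  where "scaleC_complex c x = c * x"

definition cinner_complex :: "complex \<Rightarrow> complex \<Rightarrow> complex"
  where "cinner_complex x y = x * cnj y"

instance
  by standard
    (auto simp: scaleC_complex_def cinner_complex_def scaleR_conv_of_real algebra_simps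
       cmod_def power2_eq_square)

end

lemma cinner_scaleC_right:
  "cinner x (c *\<^sub>C y) = cnj c * cinner x (y::'h::complex_hilbert)"
  by (metis cinner_commute cinner_scaleC_left complex_cnj_mult)

lemma norm_scaleC: "norm (c *\<^sub>C x) = cmod c * norm (x::'h::complex_hilbert)"
proof -
  have "cinner (c *\<^sub>C x) (c *\<^sub>C x) = (c * cnj c) * cinner x x"
    by (simp add: cinner_scaleC_left cinner_scaleC_right mult.assoc)
  also have "\<dots> = complex_of_real ((cmod c)\<^sup>2) * cinner x x"
    by (simp only: complex_norm_square)
  finally have "Re (cinner (c *\<^sub>C x) (c *\<^sub>C x)) = (cmod c)\<^sup>2 * Re (cinner x x)"
    by simp
  then show ?thesis
    by (simp add: norm_eq_sqrt_cinner[where 'a = 'h] real_sqrt_mult)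
qed

lemma bounded_linear_scaleC: "bounded_linear (\<lambda>x::'h::complex_hilbert. c *\<^sub>C x)"
proof (rule bounded_linear_intro[where K = "cmod c"])
  show "c *\<^sub>C (r *\<^sub>R x) = r *\<^sub>R (c *\<^sub>C x)" for r and x :: 'h
    by (simp add: scaleR_scaleC scaleC_scaleC mult.commute)
qed (simp_all add: scaleC_add_right norm_scaleC)

section \<open>Bounded operators\<close>

text \<open>
  Elements of the library type \<open>'h \<Rightarrow>\<^sub>L 'h\<close> are only real linear; the algebra of bounded operators
  on the complex Hilbert space is the subset \<open>bounded_ops\<close>.
\<close>

definition bounded_ops :: "('h::complex_hilbert \<Rightarrow>\<^sub>L 'h) set"
  where "bounded_ops = {A. \<forall>c x. blinfun_apply A (c *\<^sub>C x) = c *\<^sub>C blinfun_apply A x}"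

lift_definition op_scaleC :: "complex \<Rightarrow> ('h::complex_hilbert \<Rightarrow>\<^sub>L 'h) \<Rightarrow> ('h \<Rightarrow>\<^sub>L 'h)"
  is "\<lambda>c A x. c *\<^sub>C A x"
  by (rule bounded_linear_compose[OF bounded_linear_scaleC])

definition adj :: "('h::complex_hilbert \<Rightarrow>\<^sub>L 'h) \<Rightarrow> ('h \<Rightarrow>\<^sub>L 'h)"
  where "adj A = (THE B. \<forall>x y. cinner (blinfun_apply A x) y = cinner x (blinfun_apply B y))"

definition self_adjoint :: "('h::complex_hilbert \<Rightarrow>\<^sub>L 'h) \<Rightarrow> bool"
  where "self_adjoint A \<longleftrightarrow> adj A = A"

definition positive_op :: "('h::complex_hilbert \<Rightarrow>\<^sub>L 'h) \<Rightarrow> bool"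
  where "positive_op A \<longleftrightarrow> (\<forall>x. cinner (blinfun_apply A x) x \<in> \<real>\<^sub>\<ge>\<^sub>0)"

definition op_le :: "('h::complex_hilbert \<Rightarrow>\<^sub>L 'h) \<Rightarrow> ('h \<Rightarrow>\<^sub>L 'h) \<Rightarrow> bool"
  where "op_le A B \<longleftrightarrow> positive_op (B - A)"

definition spectrum :: "('h::complex_hilbert \<Rightarrow>\<^sub>L 'h) \<Rightarrow> complex set"
  where "spectrum A = {c. \<not> (\<exists>B\<in>bounded_ops.
    (A - op_scaleC c id_blinfun) o\<^sub>L B = id_blinfun \<and>
    B o\<^sub>L (A - op_scaleC c id_blinfun) = id_blinfun)}"

text \<open>
  Continuous functional calculus of a self-adjoint operator \<open>A\<close>: \<open>cfc f A\<close> is the norm limit of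
  \<open>q n (A)\<close> for every sequence of polynomials \<open>q n\<close> that converges to \<open>f\<close> uniformly on the
  (real) spectrum of \<open>A\<close>.
\<close>

definition poly_op :: "real poly \<Rightarrow> ('h::complex_hilbert \<Rightarrow>\<^sub>L 'h) \<Rightarrow> ('h \<Rightarrow>\<^sub>L 'h)"
  where "poly_op q A = (\<Sum>i\<le>degree q. coeff q i *\<^sub>R ((\<lambda>B. A o\<^sub>L B) ^^ i) id_blinfun)"

definition cfc :: "(real \<Rightarrow> real) \<Rightarrow> ('h::complex_hilbert \<Rightarrow>\<^sub>L 'h) \<Rightarrow> ('h \<Rightarrow>\<^sub>L 'h)"
  where "cfc f A = (THE B. \<forall>q :: nat \<Rightarrow> real poly.
    uniform_limit {t. complex_of_real t \<in> spectrum A} (\<lambda>n. poly (q n)) f sequentially \<longrightarrow>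
    (\<lambda>n. poly_op (q n) A) \<longlonglongrightarrow> B)"

definition abs_op :: "('h::complex_hilbert \<Rightarrow>\<^sub>L 'h) \<Rightarrow> ('h \<Rightarrow>\<^sub>L 'h)"
  where "abs_op A = cfc sqrt (adj A o\<^sub>L A)"

section \<open>Finite factors\<close>

definition commutant :: "('h::complex_hilbert \<Rightarrow>\<^sub>L 'h) set \<Rightarrow> ('h \<Rightarrow>\<^sub>L 'h) set"
  where "commutant S = {A \<in> bounded_ops. \<forall>B\<in>S. A o\<^sub>L B = B o\<^sub>L A}"

definition von_neumann_algebra :: "('h::complex_hilbert \<Rightarrow>\<^sub>L 'h) set \<Rightarrow> bool"
  where "von_neumann_algebra N \<longleftrightarrow>
    N \<subseteq> bounded_ops \<and> (\<forall>A\<in>N. adj A \<in> N) \<and> commutant (commutant N) = N"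

definition factor :: "('h::complex_hilbert \<Rightarrow>\<^sub>L 'h) set \<Rightarrow> bool"
  where "factor N \<longleftrightarrow>
    von_neumann_algebra N \<and> N \<inter> commutant N = range (\<lambda>c. op_scaleC c id_blinfun)"

definition tracial_state ::
    "('h::complex_hilbert \<Rightarrow>\<^sub>L 'h) set \<Rightarrow> (('h \<Rightarrow>\<^sub>L 'h) \<Rightarrow> complex) \<Rightarrow> bool"
  where "tracial_state N \<tau> \<longleftrightarrow>
    (\<forall>A\<in>N. \<forall>B\<in>N. \<tau> (A + B) = \<tau> A + \<tau> B) \<and>
    (\<forall>c. \<forall>A\<in>N. \<tau> (op_scaleC c A) = c * \<tau> A) \<and>
    (\<forall>A\<in>N. positive_op A \<longrightarrow> \<tau> A \<in> \<real>\<^sub>\<ge>\<^sub>0) \<and>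
    \<tau> id_blinfun = 1 \<and>
    (\<forall>A\<in>N. \<forall>B\<in>N. \<tau> (A o\<^sub>L B) = \<tau> (B o\<^sub>L A))"

definition faithful ::
    "('h::complex_hilbert \<Rightarrow>\<^sub>L 'h) set \<Rightarrow> (('h \<Rightarrow>\<^sub>L 'h) \<Rightarrow> complex) \<Rightarrow> bool"
  where "faithful N \<tau> \<longleftrightarrow> (\<forall>A\<in>N. positive_op A \<and> \<tau> A = 0 \<longrightarrow> A = 0)"

definition op_directed :: "('h::complex_hilbert \<Rightarrow>\<^sub>L 'h) set \<Rightarrow> bool"
  where "op_directed D \<longleftrightarrow>
    D \<noteq> {} \<and> (\<forall>A\<in>D. \<forall>B\<in>D. \<exists>C\<in>D. op_le A C \<and> op_le B C)"

definition is_op_sup ::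
    "('h::complex_hilbert \<Rightarrow>\<^sub>L 'h) set \<Rightarrow> ('h \<Rightarrow>\<^sub>L 'h) set \<Rightarrow> ('h \<Rightarrow>\<^sub>L 'h) \<Rightarrow> bool"
  where "is_op_sup N D S \<longleftrightarrow>
    S \<in> N \<and> self_adjoint S \<and> (\<forall>A\<in>D. op_le A S) \<and>
    (\<forall>T\<in>N. self_adjoint T \<and> (\<forall>A\<in>D. op_le A T) \<longrightarrow> op_le S T)"

definition normal_on ::
    "('h::complex_hilbert \<Rightarrow>\<^sub>L 'h) set \<Rightarrow> (('h \<Rightarrow>\<^sub>L 'h) \<Rightarrow> complex) \<Rightarrow> bool"
  where "normal_on N \<tau> \<longleftrightarrow>
    (\<forall>D S. D \<subseteq> {A\<in>N. positive_op A} \<and> op_directed D \<and> is_op_sup N D S \<longrightarrow>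
      Re (\<tau> S) = (SUP A\<in>D. Re (\<tau> A)))"

text \<open>
  \<open>\<tau>\<close> is unique on \<open>N\<close>, so the pair \<open>(N, \<tau>)\<close> carries no more data than \<open>N\<close>.
\<close>

definition finite_factor ::
    "('h::complex_hilbert \<Rightarrow>\<^sub>L 'h) set \<Rightarrow> (('h \<Rightarrow>\<^sub>L 'h) \<Rightarrow> complex) \<Rightarrow> bool"
  where "finite_factor N \<tau> \<longleftrightarrow>
    factor N \<and> tracial_state N \<tau> \<and> faithful N \<tau> \<and> normal_on N \<tau>"

definition unitary_group :: "('h::complex_hilbert \<Rightarrow>\<^sub>L 'h) set \<Rightarrow> ('h \<Rightarrow>\<^sub>L 'h) set"
  where "unitary_group N = {U\<in>N. adj U o\<^sub>L U = id_blinfun \<and> U o\<^sub>L adj U = id_blinfun}"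

definition Lp_norm ::
    "(('h::complex_hilbert \<Rightarrow>\<^sub>L 'h) \<Rightarrow> complex) \<Rightarrow> real \<Rightarrow> ('h \<Rightarrow>\<^sub>L 'h) \<Rightarrow> real"
  where "Lp_norm \<tau> p A = Re (\<tau> (cfc (\<lambda>t. t powr p) (abs_op A))) powr (1 / p)"

definition Lp_isometry ::
    "real \<Rightarrow> ('h::complex_hilbert \<Rightarrow>\<^sub>L 'h) set \<Rightarrow> (('h \<Rightarrow>\<^sub>L 'h) \<Rightarrow> complex) \<Rightarrow>
     ('k::complex_hilbert \<Rightarrow>\<^sub>L 'k) set \<Rightarrow> (('k \<Rightarrow>\<^sub>L 'k) \<Rightarrow> complex) \<Rightarrow>
     (('h \<Rightarrow>\<^sub>L 'h) \<Rightarrow> ('k \<Rightarrow>\<^sub>L 'k)) \<Rightarrow> bool"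
  where "Lp_isometry p N1 \<tau>1 N2 \<tau>2 \<psi> \<longleftrightarrow>
    \<psi> ` unitary_group N1 \<subseteq> unitary_group N2 \<and>
    (\<forall>U\<in>unitary_group N1. \<forall>V\<in>unitary_group N1.
      Lp_norm \<tau>1 p (U - V) = Lp_norm \<tau>2 p (\<psi> U - \<psi> V))"

section \<open>Isomorphisms and anti-isomorphisms\<close>

definition star_linear_bij ::
    "('h::complex_hilbert \<Rightarrow>\<^sub>L 'h) set \<Rightarrow> ('k::complex_hilbert \<Rightarrow>\<^sub>L 'k) set \<Rightarrow>
     (('h \<Rightarrow>\<^sub>L 'h) \<Rightarrow> ('k \<Rightarrow>\<^sub>L 'k)) \<Rightarrow> bool"
  where "star_linear_bij N1 N2 \<phi> \<longleftrightarrow>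
    bij_betw \<phi> N1 N2 \<and>
    (\<forall>A\<in>N1. \<forall>B\<in>N1. \<phi> (A + B) = \<phi> A + \<phi> B) \<and>
    (\<forall>c. \<forall>A\<in>N1. \<phi> (op_scaleC c A) = op_scaleC c (\<phi> A)) \<and>
    (\<forall>A\<in>N1. \<phi> (adj A) = adj (\<phi> A))"

definition star_isomorphism ::
    "('h::complex_hilbert \<Rightarrow>\<^sub>L 'h) set \<Rightarrow> ('k::complex_hilbert \<Rightarrow>\<^sub>L 'k) set \<Rightarrow>
     (('h \<Rightarrow>\<^sub>L 'h) \<Rightarrow> ('k \<Rightarrow>\<^sub>L 'k)) \<Rightarrow> bool"
  where "star_isomorphism N1 N2 \<phi> \<longleftrightarrow>
    star_linear_bij N1 N2 \<phi> \<and> (\<forall>A\<in>N1. \<forall>B\<in>N1. \<phi> (A o\<^sub>L B) = \<phi> A o\<^sub>L \<phi> B)"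

definition star_anti_isomorphism ::
    "('h::complex_hilbert \<Rightarrow>\<^sub>L 'h) set \<Rightarrow> ('k::complex_hilbert \<Rightarrow>\<^sub>L 'k) set \<Rightarrow>
     (('h \<Rightarrow>\<^sub>L 'h) \<Rightarrow> ('k \<Rightarrow>\<^sub>L 'k)) \<Rightarrow> bool"
  where "star_anti_isomorphism N1 N2 \<phi> \<longleftrightarrow>
    star_linear_bij N1 N2 \<phi> \<and> (\<forall>A\<in>N1. \<forall>B\<in>N1. \<phi> (A o\<^sub>L B) = \<phi> B o\<^sub>L \<phi> A)"

end

theory Submission
  imports Defs "HOL-Computational_Algebra.Fundamental_Theorem_Algebra"
begin

text \<open>
  For unitaries \<open>U\<close>, \<open>V\<close> and \<open>H = Re (U\<^sup>* V)\<close> one has \<open>\<parallel>U - V\<parallel>\<^sub>p\<^sup>p = \<tau> ((2 - 2 H)\<^bsup>p/2\<^esup>)\<close>. For \<open>p = 2\<close> an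
  isometry therefore preserves \<open>Re \<tau> (U\<^sup>* V)\<close>. For \<open>p \<noteq> 2\<close>, strict convexity or concavity of
  \<open>u \<mapsto> u\<^bsup>p/2\<^esup>\<close> and faithfulness of \<open>\<tau>\<close> turn equalities between distances into the operator relations
  \<open>V = - U\<close>, \<open>Re (U\<^sup>* V) = c\<close> and \<open>U\<^sup>* V\<close> self-adjoint, so all three are preserved. Normalize
  \<open>\<psi> 1 = 1\<close>. Then \<open>\<psi> i\<close> commutes with all symmetries, hence is \<open>\<plusminus> i\<close> because the algebra is a factor,
  and \<open>\<psi>\<close> maps scalars \<open>e\<^bsup>it\<^esup>\<close> to \<open>e\<^bsup>\<plusminus>it\<^esup>\<close>. The first Fourier coefficient of \<open>t \<mapsto> \<parallel>V - e\<^bsup>it\<^esup>\<parallel>\<^sub>p\<^sup>p\<close> is a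
  nonzero multiple of \<open>\<tau> V\<close>, so \<open>Re \<tau> (U\<^sup>* V)\<close> is preserved for every \<open>p\<close>.

  Since unitaries span and \<open>\<tau>\<close> is faithful, \<open>\<psi>\<close> extends to a real linear bijection \<open>T\<close> that preserves
  unitaries. Expanding the unitaries \<open>\<surd>(1 - t\<^sup>2 A\<^sup>2) \<plusminus> i t A\<close> at \<open>t = 0\<close>, both for \<open>T\<close> and for
  \<open>x \<mapsto> T(i)\<^sup>* T(i x)\<close>, shows that \<open>T i\<close> is central, hence \<open>\<plusminus> i\<close>, and that \<open>T\<close> is a Jordan map. Factors
  are prime rings, so by Herstein's argument a Jordan map onto a factor is multiplicative or
  antimultiplicative.
\<close>

section \<open>Hilbert spaces\<close>

text \<open>A single distance only yields the trace of one function of \<open>H\<close>, which does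
  not determine \<open>H\<close>. The antipode supplies a second number,
  \<open>\<parallel>U + V\<parallel>\<close>, and a weighted sum of the two is extremal exactly
  under the relation to be detected. No spectral measure is used: the extremal case says that a
  nonnegative function of \<open>H\<close> has trace 0, hence vanishes as an operator, and it is
  then exchanged for a polynomial such as \<open>t - c\<close> or \<open>1 - t * t\<close> with the
  same zeros. For \<open>p = 2\<close> the power is linear and strictness is lost, but then the
  distance is already affine in the trace.

  The circle integral becomes a mean over roots of unity, which is exact for polynomials of small
  degree. The Fourier coefficient of the distance function is never computed; it is only bounded
  away from 0, by testing at the identity.

  The sign in \<open>\<plusminus> i\<close> has to be settled twice. On scalars it is found from
  distances for \<open>p \<noteq> 2\<close>. The extension \<open>T\<close>, which for
  \<open>p = 2\<close> comes with no knowledge about scalars, is a priori only real linear, so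
  \<open>T i\<close> is treated afresh.\<close>

lemma cinner_add_right: "cinner x (y + z) = cinner x y + cinner x (z::'h::complex_hilbert)"
  by (metis cinner_add_left cinner_commute complex_cnj_add)

lemma cinner_self: "cinner x x = complex_of_real ((norm (x::'h::complex_hilbert))\<^sup>2)"
proof -
  have "Im (cinner x x) = 0"
    by (metis cinner_commute cnj.sel(2) equal_neg_zero)
  then show ?thesis
    by (simp add: complex_eq_iff norm_eq_sqrt_cinner[where 'a = 'h] cinner_nonneg)
qed

lemma Re_cinner_commute: "Re (cinner y x) = Re (cinner x (y::'h::complex_hilbert))"
  by (metis cinner_commute cnj.sel(1))

lemma cinner_scaleR_left: "cinner (r *\<^sub>R x) y = r *\<^sub>R cinner x (y::'h::complex_hilbert)"
  by (simp add: scaleR_scaleC[where 'a = 'h] cinner_scaleC_left scaleR_conv_of_real)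

lemma cinner_scaleR_right: "cinner x (r *\<^sub>R y) = r *\<^sub>R cinner x (y::'h::complex_hilbert)"
  by (simp add: scaleR_scaleC[where 'a = 'h] cinner_scaleC_right scaleR_conv_of_real)

lemma norm_add_sq:
  "(norm (x + y))\<^sup>2 = (norm x)\<^sup>2 + 2 * Re (cinner x y) + (norm (y::'h::complex_hilbert))\<^sup>2"
proof -
  have "Re (cinner (x + y) (x + y)) = Re (cinner x x) + 2 * Re (cinner x y) + Re (cinner y y)"
    by (simp add: cinner_add_left cinner_add_right Re_cinner_commute[of y x])
  then show ?thesis
    by (simp add: cinner_self)
qed

text \<open>The square of the norm of \<open>norm y *\<^sub>R x - norm x *\<^sub>R y\<close> is a
  positive multiple of the gap in the inequality.\<close>

lemma Re_cinner_le: "Re (cinner x y) \<le> norm x * norm (y::'h::complex_hilbert)"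
proof (cases "x = 0 \<or> y = 0")
  case True
  moreover have "cinner 0 y = 0" "cinner x 0 = 0"
    by (metis add_cancel_left_left cinner_add_left)
      (metis add_cancel_left_left cinner_add_right)
  ultimately show ?thesis
    by auto
next
  case False
  let ?a = "norm x" and ?b = "norm y"
  have "0 \<le> (norm (?b *\<^sub>R x + (- ?a) *\<^sub>R y))\<^sup>2"
    by simp
  also have "\<dots> = 2 * (?a * ?b) * (?a * ?b - Re (cinner x y))"
    unfolding norm_add_sq
    by (simp add: cinner_scaleR_left cinner_scaleR_right power2_eq_square algebra_simps del: scaleR_minus_left)
  finally have "0 \<le> 2 * (?a * ?b) * (?a * ?b - Re (cinner x y))" .
  moreover have "0 < 2 * (?a * ?b)"
    using False by simp
  ultimately have "0 \<le> ?a * ?b - Re (cinner x y)"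
    by (meson linorder_not_le mult_pos_neg)
  then show ?thesis
    by simp
qed

lemma cmod_cinner_le: "cmod (cinner x y) \<le> norm x * norm (y::'h::complex_hilbert)"
proof (cases "cinner x y = 0")
  case False
  define c where "c = cnj (cinner x y) / complex_of_real (cmod (cinner x y))"
  have c: "cmod c = 1"
    using False by (simp add: c_def norm_divide)
  have "cinner (c *\<^sub>C x) y = (cinner x y * cnj (cinner x y)) / complex_of_real (cmod (cinner x y))"
    by (simp add: c_def cinner_scaleC_left)
  also have "\<dots> = complex_of_real (cmod (cinner x y))"
    unfolding complex_norm_square[symmetric] using False by (simp add: power2_eq_square)
  finally have "Re (cinner (c *\<^sub>C x) y) = cmod (cinner x y)"
    by simp
  then have "cmod (cinner x y) \<le> norm (c *\<^sub>C x) * norm y"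
    using Re_cinner_le[of "c *\<^sub>C x" y] by linarith
  then show ?thesis
    by (simp add: norm_scaleC c)
qed simp

lemma bounded_bilinear_cinner: "bounded_bilinear (cinner :: 'h::complex_hilbert \<Rightarrow> 'h \<Rightarrow> complex)"
proof
  show "\<exists>K. \<forall>a b::'h. norm (cinner a b) \<le> norm a * norm b * K"
    by (intro exI[of _ 1]) (simp add: cmod_cinner_le)
qed (auto simp: cinner_add_left cinner_add_right cinner_scaleR_left cinner_scaleR_right)

interpretation cinner: bounded_bilinear "cinner :: 'h::complex_hilbert \<Rightarrow> 'h \<Rightarrow> complex"
  by (rule bounded_bilinear_cinner)

lemma cinner_eqI:
  assumes "\<And>x. cinner x y = cinner x (z::'h::complex_hilbert)"
  shows "y = z"
  using assms[of "y - z"] cinner_eq_zero_iff[of "y - z"] by (simp add: cinner.diff_right)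

lemma scaleC_diff_right: "c *\<^sub>C (x - y) = c *\<^sub>C x - c *\<^sub>C (y::'h::complex_hilbert)"
  using linear_diff[OF bounded_linear.linear[OF bounded_linear_scaleC]] .

lemma scaleC_zero_right: "c *\<^sub>C 0 = (0::'h::complex_hilbert)"
  using linear_0[OF bounded_linear.linear[OF bounded_linear_scaleC]] .

text \<open>The first-order condition at a minimum. At \<open>t = - a / (\<bar>b\<bar> + 1)\<close>
  the linear term outweighs the quadratic one, which makes the expression negative unless
  \<open>a = 0\<close>.\<close>

lemma quadratic_nonneg_linear_zero:
  fixes a b :: real
  assumes "\<And>t. 0 \<le> 2 * t * a + t\<^sup>2 * b"
  shows "a = 0"
proof (rule ccontr)
  assume "a \<noteq> 0"
  have "2 * (- a / c) * a + (- a / c)\<^sup>2 * b = (a / c)\<^sup>2 * (b - 2 * c)" if "c \<noteq> 0" for c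
    using that by (simp add: field_simps power2_eq_square)
  from this[of "\<bar>b\<bar> + 1"]
  have "2 * (- a / (\<bar>b\<bar> + 1)) * a + (- a / (\<bar>b\<bar> + 1))\<^sup>2 * b
      = (a / (\<bar>b\<bar> + 1))\<^sup>2 * (b - 2 * (\<bar>b\<bar> + 1))"
    by simp
  moreover have "0 < (a / (\<bar>b\<bar> + 1))\<^sup>2"
    using \<open>a \<noteq> 0\<close> by simp
  moreover have "b - 2 * (\<bar>b\<bar> + 1) < 0"
    using abs_ge_self[of b] abs_ge_zero[of b] by argo
  ultimately have "2 * (- a / (\<bar>b\<bar> + 1)) * a + (- a / (\<bar>b\<bar> + 1))\<^sup>2 * b < 0"
    by (simp add: mult_pos_neg)
  then show False
    using assms[of "- a / (\<bar>b\<bar> + 1)"] by linarith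
qed

text \<open>
  The representing vector minimizes \<open>\<parallel>x\<parallel>\<^sup>2 - 2 f x\<close>. For \<open>K = UNIV\<close> this is the Riesz
  representation theorem, and for \<open>f = Re \<langle>y, _\<rangle>\<close> the orthogonal projection of \<open>y\<close> onto \<open>K\<close>.
\<close>

lemma real_riesz_subspace:
  fixes f :: "'h::complex_hilbert \<Rightarrow> real"
  assumes K: "closed K" "subspace K" and f: "bounded_linear f"
  obtains z where "z \<in> K" "\<And>h. h \<in> K \<Longrightarrow> Re (cinner z h) = f h"
proof -
  interpret f: bounded_linear f by (rule f)
  define J where "J x = (norm x)\<^sup>2 - 2 * f x" for x
  obtain L where L: "\<And>x. norm (f x) \<le> norm x * L"
    using f.bounded by blast
  have lower: "- L\<^sup>2 \<le> J x" for x
  proof -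
    have "f x \<le> norm x * L"
      using L[of x] by simp
    moreover have "0 \<le> (norm x - L)\<^sup>2"
      by simp
    ultimately show ?thesis
      unfolding J_def by (simp add: power2_eq_square algebra_simps)
  qed
  define m where "m = Inf (J ` K)"
  have bdd: "bdd_below (J ` K)"
    using lower by (intro bdd_belowI[of _ "- L\<^sup>2"]) auto
  have mle: "m \<le> J x" if "x \<in> K" for x
    unfolding m_def using bdd that by (auto intro: cInf_lower)
  have "\<exists>x\<in>K. J x < m + inverse (real (Suc n))" for n
  proof -
    have "Inf (J ` K) < m + inverse (real (Suc n))"
      by (simp add: m_def)
    then show ?thesis
      using cInf_lessD[of "J ` K"] K(2) subspace_0 by blast
  qed
  then obtain X where X: "\<And>n. X n \<in> K" "\<And>n. J (X n) < m + inverse (real (Suc n))"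
    by metis
  \<comment> \<open>Parallelogram law; the linear part of \<open>J\<close> cancels against its value
    at the midpoint. Two points with almost minimal \<open>J\<close> are therefore close, so a
    minimizing sequence is Cauchy.\<close>
  have par: "(norm (x - y))\<^sup>2 = 2 * J x + 2 * J y - 4 * J ((1/2) *\<^sub>R (x + y))" for x y
  proof -
    have "(norm (x - y))\<^sup>2 = (norm x)\<^sup>2 - 2 * Re (cinner x y) + (norm y)\<^sup>2"
      using norm_add_sq[of x "- y"] by (simp add: cinner.minus_right)
    then show ?thesis
      unfolding J_def
      by (simp add: f.scaleR f.add power_mult_distrib norm_add_sq power_divide
          cinner.scaleR_left cinner.scaleR_right field_simps)
  qed
  have dist: "(norm (X i - X j))\<^sup>2 \<le> 2 * inverse (real (Suc i)) + 2 * inverse (real (Suc j))" for i j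
  proof -
    have "m \<le> J ((1/2) *\<^sub>R (X i + X j))"
      using X(1) K(2) by (intro mle) (simp add: subspace_add subspace_scale)
    then show ?thesis
      unfolding par using X(2)[of i] X(2)[of j] by linarith
  qed
  have "Cauchy X"
  proof (rule metric_CauchyI)
    fix e :: real assume e: "0 < e"
    obtain M where M: "inverse (real (Suc M)) < e\<^sup>2 / 4"
      using reals_Archimedean[of "e\<^sup>2 / 4"] e by auto
    show "\<exists>M. \<forall>i\<ge>M. \<forall>j\<ge>M. dist (X i) (X j) < e"
    proof (intro exI allI impI)
      fix i j assume "M \<le> i" "M \<le> j"
      then have "inverse (real (Suc i)) \<le> inverse (real (Suc M))"
        "inverse (real (Suc j)) \<le> inverse (real (Suc M))"
        by simp_all
      then have "(norm (X i - X j))\<^sup>2 < e\<^sup>2"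
        using dist[of i j] M by linarith
      then show "dist (X i) (X j) < e"
        using e by (simp add: dist_norm power2_less_imp_less)
    qed
  qed
  then obtain z where z: "X \<longlonglongrightarrow> z"
    by (meson Cauchy_convergent convergent_def)
  have "z \<in> K"
    using closed_sequentially[OF K(1) _ z] X(1) by blast
  have "(\<lambda>n. J (X n)) \<longlonglongrightarrow> J z"
    unfolding J_def using z by (intro tendsto_intros f.tendsto)
  moreover have "(\<lambda>n. m + inverse (real (Suc n))) \<longlonglongrightarrow> m + 0"
    by (intro tendsto_intros LIMSEQ_inverse_real_of_nat)
  ultimately have "J z \<le> m"
    using X(2) LIMSEQ_le[of "\<lambda>n. J (X n)" "J z" "\<lambda>n. m + inverse (real (Suc n))" m]
    by (auto intro: less_imp_le)
  have "Re (cinner z h) = f h" if h: "h \<in> K" for h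
  proof -
    have "0 \<le> 2 * t * (Re (cinner z h) - f h) + t\<^sup>2 * (norm h)\<^sup>2" for t
    proof -
      have "m \<le> J (z + t *\<^sub>R h)"
        using \<open>z \<in> K\<close> h K(2) by (intro mle) (simp add: subspace_add subspace_scale)
      with \<open>J z \<le> m\<close> show ?thesis
        unfolding J_def norm_add_sq
        by (simp add: f.add f.scaleR cinner.scaleR_right power_mult_distrib algebra_simps)
    qed
    from quadratic_nonneg_linear_zero[OF this] show ?thesis
      by simp
  qed
  with \<open>z \<in> K\<close> show thesis
    by (rule that)
qed

text \<open>Representing \<open>Re f\<close> suffices: evaluation at \<open>\<i> *\<^sub>C x\<close>
  recovers the imaginary part.\<close>

lemma riesz_representation:
  fixes f :: "'h::complex_hilbert \<Rightarrow> complex"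
  assumes f: "bounded_linear f" and fC: "\<And>c x. f (c *\<^sub>C x) = c * f x"
  shows "\<exists>z. \<forall>x. f x = cinner x z"
proof -
  have "bounded_linear (\<lambda>x. Re (f x))"
    by (rule bounded_linear_compose[OF bounded_linear_Re f])
  from real_riesz_subspace[OF closed_UNIV subspace_UNIV this]
  obtain z where z: "\<And>h. Re (cinner z h) = Re (f h)"
    by auto
  have "f x = cinner x z" for x
  proof (rule complex_eqI)
    show "Re (f x) = Re (cinner x z)" for x
      by (metis z Re_cinner_commute)
    from this[of "\<i> *\<^sub>C x"] show "Im (f x) = Im (cinner x z)"
      by (simp add: fC cinner_scaleC_left)
  qed
  then show ?thesis
    by blast
qed

lemma orthogonal_projection_exists:
  fixes K :: "'h::complex_hilbert set"
  assumes K: "closed K" "subspace K" and KC: "\<And>c x. x \<in> K \<Longrightarrow> c *\<^sub>C x \<in> K"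
  shows "\<exists>z\<in>K. \<forall>h\<in>K. cinner (y - z) h = 0"
proof -
  have "bounded_linear (\<lambda>x. Re (cinner y x))"
    by (rule bounded_linear_compose[OF bounded_linear_Re cinner.bounded_linear_right])
  from real_riesz_subspace[OF K this]
  obtain z where z: "z \<in> K" "\<And>h. h \<in> K \<Longrightarrow> Re (cinner z h) = Re (cinner y h)"
    by blast
  \<comment> \<open>Real orthogonality to both \<open>h\<close> and \<open>\<i> *\<^sub>C h\<close>
    amounts to complex orthogonality to \<open>h\<close>.\<close>
  have "cinner (y - z) h = 0" if "h \<in> K" for h
    using z(2)[OF that] z(2)[OF KC[OF that, of \<i>]]
    by (simp add: complex_eq_iff cinner.diff_left cinner_scaleC_right)
  with z(1) show ?thesis
    by blast
qed

section \<open>Bounded operators and adjoints\<close>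

interpretation oL: bounded_bilinear
    "(o\<^sub>L) :: ('b::real_normed_vector \<Rightarrow>\<^sub>L 'c::real_normed_vector) \<Rightarrow> ('a::real_normed_vector \<Rightarrow>\<^sub>L 'b) \<Rightarrow> _"
  by (rule bounded_bilinear_blinfun_compose)

lemmas oL_distribs = oL.add_left oL.add_right oL.diff_left oL.diff_right oL.minus_left oL.minus_right

lemma oL_assoc: "(A o\<^sub>L B) o\<^sub>L C = A o\<^sub>L (B o\<^sub>L C)"
  by (rule blinfun_eqI) simp

lemma oL_id [simp]: "A o\<^sub>L id_blinfun = A" "id_blinfun o\<^sub>L A = A"
  by (simp_all add: blinfun_eqI)

lemma op_scaleC_apply [simp]: "blinfun_apply (op_scaleC c A) x = c *\<^sub>C A x"
  by transfer simp

lemma op_scaleC_of_real [simp]: "op_scaleC (complex_of_real r) A = r *\<^sub>R A"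
  by (rule blinfun_eqI) (simp add: scaleR_scaleC blinfun.scaleR_left)

lemma op_scaleC_1 [simp]: "op_scaleC 1 A = A"
  using op_scaleC_of_real[of 1 A] by simp

lemma op_scaleC_0 [simp]: "op_scaleC 0 A = 0"
  using op_scaleC_of_real[of 0 A] by simp

lemma op_scaleC_minus [simp]: "op_scaleC (- c) A = - op_scaleC c A"
proof -
  have "(- c) *\<^sub>C x + c *\<^sub>C x = 0" for x :: 'a
    using op_scaleC_0[of id_blinfun] op_scaleC_apply[of 0 id_blinfun x]
    by (simp flip: scaleC_add_left)
  then show ?thesis
    by (intro blinfun_eqI) (simp add: blinfun.minus_left eq_neg_iff_add_eq_0)
qed

lemma op_scaleC_scaleC [simp]: "op_scaleC c (op_scaleC d A) = op_scaleC (c * d) A"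
  by (rule blinfun_eqI) (simp add: scaleC_scaleC)

lemma op_scaleC_add_right: "op_scaleC c (A + B) = op_scaleC c A + op_scaleC c B"
  by (rule blinfun_eqI) (simp add: scaleC_add_right blinfun.add_left)

lemma op_scaleC_diff_right: "op_scaleC c (A - B) = op_scaleC c A - op_scaleC c B"
  by (rule blinfun_eqI) (simp add: scaleC_diff_right blinfun.diff_left)

lemma op_scaleC_zero_right [simp]: "op_scaleC c 0 = 0"
  by (rule blinfun_eqI) (simp add: scaleC_zero_right)

lemma op_scaleC_minus_right [simp]: "op_scaleC c (- A) = - op_scaleC c A"
  using op_scaleC_diff_right[of c 0 A] by simp

lemma op_scaleC_add_left: "op_scaleC (c + d) A = op_scaleC c A + op_scaleC d A"
  by (rule blinfun_eqI) (simp add: scaleC_add_left blinfun.add_left)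

lemma op_scaleC_scaleR: "op_scaleC c (r *\<^sub>R A) = r *\<^sub>R op_scaleC c A"
  by (simp flip: op_scaleC_of_real add: mult.commute)

lemma op_scaleC_oL_left [simp]: "op_scaleC c A o\<^sub>L B = op_scaleC c (A o\<^sub>L B)"
  by (rule blinfun_eqI) simp

lemma oL_op_scaleC_right [simp]: "A \<in> bounded_ops \<Longrightarrow> A o\<^sub>L op_scaleC c B = op_scaleC c (A o\<^sub>L B)"
  by (rule blinfun_eqI) (simp add: bounded_ops_def)

lemma norm_op_scaleC: "norm (op_scaleC c A) \<le> cmod c * norm A"
proof (rule norm_blinfun_bound)
  show "norm (op_scaleC c A x) \<le> cmod c * norm A * norm x" for x
    using mult_left_mono[OF norm_blinfun[of A x], of "cmod c"]
    by (simp add: norm_scaleC mult.assoc)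
qed simp

lemma bounded_linear_op_scaleC: "bounded_linear (op_scaleC c)"
  by (rule bounded_linear_intro[where K = "cmod c"])
    (use norm_op_scaleC in \<open>simp_all add: op_scaleC_add_right op_scaleC_scaleR mult.commute\<close>)

lemma bounded_opsD: "A \<in> bounded_ops \<Longrightarrow> A (c *\<^sub>C x) = c *\<^sub>C A x"
  by (simp add: bounded_ops_def)

lemma bounded_ops_id [simp]: "id_blinfun \<in> bounded_ops"
  by (simp add: bounded_ops_def)

lemma bounded_ops_0 [simp]: "0 \<in> bounded_ops"
  by (simp add: bounded_ops_def scaleC_zero_right)

lemma bounded_ops_add [simp]: "A \<in> bounded_ops \<Longrightarrow> B \<in> bounded_ops \<Longrightarrow> A + B \<in> bounded_ops"
  by (simp add: bounded_ops_def blinfun.add_left scaleC_add_right)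

lemma bounded_ops_diff [simp]: "A \<in> bounded_ops \<Longrightarrow> B \<in> bounded_ops \<Longrightarrow> A - B \<in> bounded_ops"
  by (simp add: bounded_ops_def blinfun.diff_left scaleC_diff_right)

lemma bounded_ops_scaleC [simp]: "A \<in> bounded_ops \<Longrightarrow> op_scaleC c A \<in> bounded_ops"
  by (simp add: bounded_ops_def scaleC_scaleC mult.commute)

lemma bounded_ops_scaleR [simp]: "A \<in> bounded_ops \<Longrightarrow> r *\<^sub>R A \<in> bounded_ops"
  by (metis bounded_ops_scaleC op_scaleC_of_real)

lemma bounded_ops_oL [simp]: "A \<in> bounded_ops \<Longrightarrow> B \<in> bounded_ops \<Longrightarrow> A o\<^sub>L B \<in> bounded_ops"
  by (simp add: bounded_ops_def)

lemma bounded_ops_lim: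
  assumes "X \<longlonglongrightarrow> A" "\<And>n. X n \<in> bounded_ops"
  shows "A \<in> bounded_ops"
proof -
  have *: "(\<lambda>n. X n y) \<longlonglongrightarrow> A y" for y
    by (intro blinfun.tendsto assms(1) tendsto_const)
  have "A (c *\<^sub>C x) = c *\<^sub>C A x" for c x
  proof (rule LIMSEQ_unique[OF *])
    show "(\<lambda>n. X n (c *\<^sub>C x)) \<longlonglongrightarrow> c *\<^sub>C A x"
      using bounded_linear.tendsto[OF bounded_linear_scaleC *, of c x] assms(2)
      by (simp add: bounded_opsD)
  qed
  then show ?thesis
    by (simp add: bounded_ops_def)
qed

section \<open>Existence and algebra of adjoints\<close>

lemma adjoint_exists:
  assumes A: "A \<in> bounded_ops"
  shows "\<exists>B\<in>bounded_ops. \<forall>x y. cinner (A x) y = cinner x (blinfun_apply B y)"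
proof -
  have "\<exists>z. \<forall>x. cinner (A x) y = cinner x z" for y
    by (rule riesz_representation)
      (use A in \<open>auto intro: bounded_linear_compose[OF cinner.bounded_linear_left]
        blinfun.bounded_linear_right simp: bounded_opsD cinner_scaleC_left\<close>)
  then obtain b where b: "\<And>x y. cinner (A x) y = cinner x (b y)"
    by metis
  have add: "b (x + y) = b x + b y" for x y
    by (rule cinner_eqI) (simp flip: b add: cinner.add_right)
  have scaleC: "b (c *\<^sub>C x) = c *\<^sub>C b x" for c x
    by (rule cinner_eqI) (simp flip: b add: cinner_scaleC_right)
  have bound: "norm (b y) \<le> norm y * norm A" for y
  proof (cases "b y = 0")
    case False
    have "(norm (b y))\<^sup>2 = Re (cinner (A (b y)) y)"
      by (simp add: b cinner_self)
    also have "\<dots> \<le> norm (A (b y)) * norm y"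
      by (rule Re_cinner_le)
    also have "\<dots> \<le> norm A * norm (b y) * norm y"
      by (intro mult_right_mono norm_blinfun) simp
    finally have "norm (b y) * norm (b y) \<le> norm (b y) * (norm y * norm A)"
      by (simp add: power2_eq_square ac_simps)
    then show ?thesis
      using False by simp
  qed simp
  have "bounded_linear b"
    by (rule bounded_linear_intro[where K = "norm A"])
      (simp_all add: add scaleC bound scaleR_scaleC[where 'a = 'a])
  then have "blinfun_apply (Blinfun b) = b"
    by (rule bounded_linear_Blinfun_apply)
  then show ?thesis
    using b scaleC by (intro bexI[of _ "Blinfun b"]) (auto simp: bounded_ops_def)
qed

lemma adj_unique:
  assumes "\<And>x y. cinner (blinfun_apply A x) y = cinner x (blinfun_apply B y)"
  shows "adj A = B"
  unfolding adj_def
proof (rule the_equality)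
  fix C assume "\<forall>x y. cinner (A x) y = cinner x (blinfun_apply C y)"
  with assms show "C = B"
    by - (rule blinfun_eqI, rule cinner_eqI, metis)
qed (use assms in blast)

lemma assumes A: "A \<in> bounded_ops"
  shows adj_bounded_ops [simp]: "adj A \<in> bounded_ops"
    and cinner_adj_right: "cinner x (adj A y) = cinner (A x) y"
    and cinner_adj_left: "cinner (adj A x) y = cinner x (A y)"
proof -
  obtain B where B: "B \<in> bounded_ops" "\<And>x y. cinner (A x) y = cinner x (blinfun_apply B y)"
    using adjoint_exists[OF A] by blast
  moreover from B(2) have "adj A = B"
    by (rule adj_unique)
  ultimately show "adj A \<in> bounded_ops" "cinner x (adj A y) = cinner (A x) y" for x y
    by simp_all
  then show "cinner (adj A x) y = cinner x (A y)"
    by (metis cinner_commute)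
qed

lemma adj_adj [simp]: "A \<in> bounded_ops \<Longrightarrow> adj (adj A) = A"
  by (rule adj_unique) (simp add: cinner_adj_left)

lemma adj_oL [simp]:
  "A \<in> bounded_ops \<Longrightarrow> B \<in> bounded_ops \<Longrightarrow> adj (A o\<^sub>L B) = adj B o\<^sub>L adj A"
  by (rule adj_unique) (simp add: cinner_adj_right)

lemma adj_add [simp]:
  "A \<in> bounded_ops \<Longrightarrow> B \<in> bounded_ops \<Longrightarrow> adj (A + B) = adj A + adj B"
  by (rule adj_unique)
    (simp add: cinner_adj_right blinfun.add_left cinner.add_left cinner.add_right)

lemma adj_diff [simp]:
  "A \<in> bounded_ops \<Longrightarrow> B \<in> bounded_ops \<Longrightarrow> adj (A - B) = adj A - adj B"
  by (rule adj_unique)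
    (simp add: cinner_adj_right blinfun.diff_left cinner.diff_left cinner.diff_right)

lemma adj_scaleC [simp]: "A \<in> bounded_ops \<Longrightarrow> adj (op_scaleC c A) = op_scaleC (cnj c) (adj A)"
  by (rule adj_unique) (simp add: cinner_adj_right cinner_scaleC_left cinner_scaleC_right)

lemma adj_scaleR [simp]: "A \<in> bounded_ops \<Longrightarrow> adj (r *\<^sub>R A) = r *\<^sub>R adj A"
  by (metis adj_scaleC complex_cnj_complex_of_real op_scaleC_of_real)

lemma adj_id [simp]: "adj id_blinfun = id_blinfun"
  by (rule adj_unique) simp

lemma adj_0 [simp]: "adj 0 = 0"
  by (rule adj_unique) (simp add: cinner.zero_left cinner.zero_right)

lemma adj_minus [simp]: "A \<in> bounded_ops \<Longrightarrow> adj (- A) = - adj A"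
  using adj_diff[of 0 A] by simp

lemma norm_adj_le: "A \<in> bounded_ops \<Longrightarrow> norm (adj A) \<le> norm A"
proof (rule norm_blinfun_bound)
  fix y assume A: "A \<in> bounded_ops"
  show "norm (adj A y) \<le> norm A * norm y"
  proof (cases "adj A y = 0")
    case False
    have "(norm (adj A y))\<^sup>2 = Re (cinner (A (adj A y)) y)"
      by (simp add: cinner_adj_right[OF A, symmetric] cinner_self)
    also have "\<dots> \<le> norm (A (adj A y)) * norm y"
      by (rule Re_cinner_le)
    also have "\<dots> \<le> norm A * norm (adj A y) * norm y"
      by (intro mult_right_mono norm_blinfun) simp
    finally have "norm (adj A y) * norm (adj A y) \<le> norm (adj A y) * (norm A * norm y)"
      by (simp add: power2_eq_square ac_simps)
    then show ?thesis
      using False by simp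
  qed simp
qed simp

lemma tendsto_adj:
  assumes "X \<longlonglongrightarrow> A" "\<And>n. X n \<in> bounded_ops"
  shows "(\<lambda>n. adj (X n)) \<longlonglongrightarrow> adj A"
proof -
  have A: "A \<in> bounded_ops"
    using assms by (rule bounded_ops_lim)
  have "norm (adj (X n) - adj A) \<le> norm (X n - A)" for n
    using norm_adj_le[of "X n - A"] A assms(2) by simp
  moreover have "(\<lambda>n. norm (X n - A)) \<longlonglongrightarrow> 0"
    using assms(1) by (simp add: tendsto_norm_zero_iff LIM_zero_iff)
  ultimately have "(\<lambda>n. adj (X n) - adj A) \<longlonglongrightarrow> 0"
    by (intro Lim_null_comparison[of "\<lambda>n. adj (X n) - adj A"]) auto
  then show ?thesis
    by (simp add: LIM_zero_iff)
qed

lemma selfadjoint_bounded_ops_lim: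
  assumes "X \<longlonglongrightarrow> A" "\<And>n. X n \<in> bounded_ops" "\<And>n. adj (X n) = X n"
  shows "adj A = A"
  using tendsto_adj[OF assms(1,2)] assms(1) assms(3) LIMSEQ_unique by auto

lemma selfadjoint_cinner_real:
  assumes "A \<in> bounded_ops" "adj A = A"
  shows "cinner (A x) x = complex_of_real (Re (cinner (A x) x))"
proof -
  have "cinner (A x) x = cnj (cinner (A x) x)"
    by (metis assms cinner_adj_right cinner_commute)
  then show ?thesis
    by (simp add: complex_eq_iff)
qed

text \<open>
  Lax--Milgram, by Banach's fixed point theorem: for small \<open>t > 0\<close> the map \<open>x \<mapsto> x - t (D x - y)\<close>
  is a contraction, and its fixed point solves \<open>D x = y\<close>.
\<close>

lemma lax_milgram:
  fixes D :: "'h::complex_hilbert \<Rightarrow>\<^sub>L 'h"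
  assumes D: "D \<in> bounded_ops" and c: "0 < c"
    and coercive: "\<And>x. c * (norm x)\<^sup>2 \<le> Re (cinner (D x) x)"
  shows "\<exists>B\<in>bounded_ops. D o\<^sub>L B = id_blinfun \<and> B o\<^sub>L D = id_blinfun"
proof -
  have lower: "c * norm x \<le> norm (D x)" for x
  proof (cases "x = 0")
    case False
    have "c * (norm x)\<^sup>2 \<le> norm (D x) * norm x"
      using coercive[of x] Re_cinner_le[of "D x" x] by linarith
    then have "(c * norm x) * norm x \<le> norm (D x) * norm x"
      by (simp add: power2_eq_square mult.assoc)
    then show ?thesis
      using False by simp
  qed simp
  have ex: "\<exists>x. D x = y" for y
  proof -
    \<comment> \<open>The step \<open>t = c / M\<^sup>2\<close> minimizes
      \<open>1 - 2 * t * c + t\<^sup>2 * M\<^sup>2\<close>, with minimum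
      \<open>1 - (c / M)\<^sup>2\<close>. The summand \<open>c\<close> in \<open>M\<close> makes
      \<open>M\<close> positive and at least \<open>c\<close>, so this minimum lies in
      \<open>[0, 1)\<close> and its root \<open>k\<close> is a contraction factor.\<close>
    define M where "M = norm D + c"
    have M: "0 < M" "norm D \<le> M" "c \<le> M"
      using c by (auto simp: M_def add_nonneg_pos)
    define t where "t = c / M\<^sup>2"
    define k where "k = sqrt (1 - (c / M)\<^sup>2)"
    have t: "0 < t"
      using c M by (simp add: t_def)
    have cM: "0 < (c / M)\<^sup>2" "(c / M)\<^sup>2 \<le> 1"
      using c M by (auto simp: power_le_one divide_le_eq_1)
    have step: "norm (x - t *\<^sub>R D x) \<le> k * norm x" for x
    proof -
      have "norm (D x) \<le> M * norm x"
        using norm_blinfun[of D x] mult_right_mono[OF M(2) norm_ge_zero[of x]] by linarith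
      then have "(norm (D x))\<^sup>2 \<le> M\<^sup>2 * (norm x)\<^sup>2"
        by (metis norm_ge_zero power_mono power_mult_distrib)
      then have 1: "t\<^sup>2 * (norm (D x))\<^sup>2 \<le> t\<^sup>2 * (M\<^sup>2 * (norm x)\<^sup>2)"
        by (simp add: mult_left_mono)
      have 2: "t * (c * (norm x)\<^sup>2) \<le> t * Re (cinner (D x) x)"
        using coercive[of x] t by simp
      have "(norm (x - t *\<^sub>R D x))\<^sup>2
          = (norm x)\<^sup>2 - 2 * (t * Re (cinner (D x) x)) + t\<^sup>2 * (norm (D x))\<^sup>2"
        using norm_add_sq[of x "- (t *\<^sub>R D x)"]
        by (simp add: cinner.minus_right cinner.scaleR_right Re_cinner_commute[of x] power_mult_distrib)
      also have "\<dots> \<le> (norm x)\<^sup>2 - 2 * (t * (c * (norm x)\<^sup>2)) + t\<^sup>2 * (M\<^sup>2 * (norm x)\<^sup>2)"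
        using 1 2 by linarith
      also have "\<dots> = (1 - (c / M)\<^sup>2) * (norm x)\<^sup>2"
        using M(1) by (simp add: t_def field_simps power2_eq_square)
      also have "\<dots> = (k * norm x)\<^sup>2"
        using cM by (simp add: k_def power_mult_distrib)
      finally show ?thesis
        by (rule power2_le_imp_le) (use cM in \<open>simp add: k_def\<close>)
    qed
    have "\<exists>!x. x - t *\<^sub>R (D x - y) = x"
    proof (rule banach_fix_type[where c = k])
      show "0 \<le> k" "k < 1"
        using cM by (auto simp: k_def)
      show "\<forall>x z. dist (x - t *\<^sub>R (D x - y)) (z - t *\<^sub>R (D z - y)) \<le> k * dist x z"
      proof (intro allI)
        fix x z
        have "(x - t *\<^sub>R (D x - y)) - (z - t *\<^sub>R (D z - y)) = (x - z) - t *\<^sub>R D (x - z)"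
          by (simp add: blinfun.diff_right algebra_simps)
        then show "dist (x - t *\<^sub>R (D x - y)) (z - t *\<^sub>R (D z - y)) \<le> k * dist x z"
          using step[of "x - z"] by (simp only: dist_norm)
      qed
    qed
    then show ?thesis
      using t by auto
  qed
  have inj: "D x = D y \<Longrightarrow> x = y" for x y
    using lower[of "x - y"] c by (simp add: blinfun.diff_right mult_le_0_iff)
  obtain b where b: "\<And>y. D (b y) = y"
    using ex by metis
  have scaleC: "b (r *\<^sub>C x) = r *\<^sub>C b x" for r x
    by (rule inj) (simp add: b bounded_opsD[OF D])
  have "bounded_linear b"
  proof (rule bounded_linear_intro[where K = "1 / c"])
    show "b (x + y) = b x + b y" for x y
      by (rule inj) (simp add: b blinfun.add_right)
    show "b (r *\<^sub>R x) = r *\<^sub>R b x" for r x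
      by (simp add: scaleR_scaleC scaleC)
    show "norm (b x) \<le> norm x * (1 / c)" for x
      using lower[of "b x"] c by (simp add: b field_simps)
  qed
  then have Bb: "blinfun_apply (Blinfun b) = b"
    by (rule bounded_linear_Blinfun_apply)
  show ?thesis
  proof (intro bexI conjI)
    show "Blinfun b \<in> bounded_ops"
      by (simp add: bounded_ops_def Bb scaleC)
    show "D o\<^sub>L Blinfun b = id_blinfun"
      by (rule blinfun_eqI) (simp add: Bb b)
    show "Blinfun b o\<^sub>L D = id_blinfun"
      by (rule blinfun_eqI) (simp add: Bb inj b)
  qed
qed

lemma projection_operator_exists:
  fixes K :: "'h::complex_hilbert set"
  assumes K: "closed K" "subspace K" and KC: "\<And>c x. x \<in> K \<Longrightarrow> c *\<^sub>C x \<in> K"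
  shows "\<exists>P\<in>bounded_ops. adj P = P \<and> (\<forall>x. P x \<in> K) \<and> (\<forall>x\<in>K. P x = x)"
proof -
  obtain p where p: "\<And>y. p y \<in> K" "\<And>y h. h \<in> K \<Longrightarrow> cinner (y - p y) h = 0"
    using orthogonal_projection_exists[OF assms] by metis
  \<comment> \<open>Orthogonality characterizes the foot of the perpendicular, so linearity of
    \<open>p\<close> and \<open>p x = x\<close> on \<open>K\<close> follow by checking a
    candidate.\<close>
  have uniq: "p y = z" if "z \<in> K" "\<And>h. h \<in> K \<Longrightarrow> cinner (y - z) h = 0" for y z
  proof -
    have "p y - z \<in> K"
      using p(1) that(1) K(2) by (simp add: subspace_diff)
    then have "cinner (y - z) (p y - z) - cinner (y - p y) (p y - z) = 0"
      using p(2) that(2) by simp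
    then have "cinner (p y - z) (p y - z) = 0"
      by (simp flip: cinner.diff_left)
    then show ?thesis
      by (simp add: cinner_eq_zero_iff)
  qed
  have scaleC: "p (c *\<^sub>C x) = c *\<^sub>C p x" for c x
    by (rule uniq) (use p KC in \<open>simp_all flip: scaleC_diff_right add: cinner_scaleC_left\<close>)
  have "bounded_linear p"
  proof (rule bounded_linear_intro[where K = 1])
    show "p (x + y) = p x + p y" for x y
    proof (rule uniq)
      fix h assume "h \<in> K"
      then show "cinner (x + y - (p x + p y)) h = 0"
        using p(2)[of h x] p(2)[of h y]
        by (simp add: cinner.diff_left cinner.add_left)
    qed (use p K(2) in \<open>auto intro: subspace_add\<close>)
    show "p (r *\<^sub>R x) = r *\<^sub>R p x" for r x
      by (simp add: scaleR_scaleC scaleC)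
    show "norm (p x) \<le> norm x * 1" for x
    proof -
      have "cinner x (p x) = cinner (p x) (p x)"
        using p(2)[OF p(1), of x x] by (simp add: cinner.diff_left)
      then have "(norm (p x))\<^sup>2 \<le> norm x * norm (p x)"
        using Re_cinner_le[of x "p x"] by (simp add: cinner_self)
      then show ?thesis
        by (cases "p x = 0") (simp_all add: power2_eq_square)
    qed
  qed
  then have Pp: "blinfun_apply (Blinfun p) = p"
    by (rule bounded_linear_Blinfun_apply)
  have "adj (Blinfun p) = Blinfun p"
  proof (rule adj_unique, unfold Pp)
    fix x y
    have "cinner (p x) (y - p y) = 0"
      by (metis cinner_commute complex_cnj_zero p)
    then show "cinner (p x) y = cinner x (p y)"
      using p(2)[OF p(1), of x y] by (simp add: cinner.diff_left cinner.diff_right)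
  qed
  moreover have "p x = x" if "x \<in> K" for x
    by (rule uniq) (use that in \<open>auto simp: cinner.zero_left\<close>)
  ultimately show ?thesis
    using p(1) scaleC by (intro bexI[of _ "Blinfun p"]) (auto simp: bounded_ops_def Pp)
qed

section \<open>Spectrum and polynomials of self-adjoint operators\<close>

definition op_pow :: "('h::complex_hilbert \<Rightarrow>\<^sub>L 'h) \<Rightarrow> nat \<Rightarrow> ('h \<Rightarrow>\<^sub>L 'h)"
  where "op_pow A n = ((\<lambda>B. A o\<^sub>L B) ^^ n) id_blinfun"

lemma op_pow_0 [simp]: "op_pow A 0 = id_blinfun"
  and op_pow_Suc [simp]: "op_pow A (Suc n) = A o\<^sub>L op_pow A n"
  by (simp_all add: op_pow_def)

lemma op_pow_commute: "A o\<^sub>L B = B o\<^sub>L A \<Longrightarrow> op_pow A n o\<^sub>L B = B o\<^sub>L op_pow A n"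
proof (induction n)
  case (Suc n)
  then show ?case
    by (metis oL_assoc op_pow_Suc)
qed simp

lemma op_pow_Suc_right: "op_pow A (Suc n) = op_pow A n o\<^sub>L A"
  using op_pow_commute[of A A n] by simp

lemma bounded_ops_pow [simp]: "A \<in> bounded_ops \<Longrightarrow> op_pow A n \<in> bounded_ops"
  by (induction n) auto

text \<open>The functional calculus uses real polynomials, but splitting them into linear factors
  forces complex coefficients.\<close>

definition cpoly_op :: "complex poly \<Rightarrow> ('h::complex_hilbert \<Rightarrow>\<^sub>L 'h) \<Rightarrow> ('h \<Rightarrow>\<^sub>L 'h)"
  where "cpoly_op q A = (\<Sum>i\<le>degree q. op_scaleC (coeff q i) (op_pow A i))"

lemma cpoly_op_ge:
  assumes "degree q \<le> n"
  shows "cpoly_op q A = (\<Sum>i\<le>n. op_scaleC (coeff q i) (op_pow A i))"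
  unfolding cpoly_op_def
  by (rule sum.mono_neutral_left) (use assms in \<open>auto simp: coeff_eq_0\<close>)

lemma cpoly_op_0 [simp]: "cpoly_op 0 A = 0"
  by (simp add: cpoly_op_def)

lemma cpoly_op_pCons:
  assumes "A \<in> bounded_ops"
  shows "cpoly_op (pCons c q) A = op_scaleC c id_blinfun + (A o\<^sub>L cpoly_op q A)"
proof -
  have "cpoly_op (pCons c q) A
      = (\<Sum>i\<le>Suc (degree q). op_scaleC (coeff (pCons c q) i) (op_pow A i))"
    by (rule cpoly_op_ge) (simp add: degree_pCons_le)
  also have "\<dots> = op_scaleC c id_blinfun + (A o\<^sub>L cpoly_op q A)"
    using assms
    by (simp add: sum.atMost_Suc_shift cpoly_op_def[of q A] oL.sum_right del: sum.atMost_Suc)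
  finally show ?thesis .
qed

lemma cpoly_op_add: "cpoly_op (p + q) A = cpoly_op p A + cpoly_op q A"
proof -
  let ?n = "max (degree p) (degree q)"
  show ?thesis
    unfolding cpoly_op_ge[OF degree_add_le_max] cpoly_op_ge[of p ?n A, OF max.cobounded1]
      cpoly_op_ge[of q ?n A, OF max.cobounded2]
    by (simp add: op_scaleC_add_left sum.distrib)
qed

lemma op_scaleC_sum: "op_scaleC c (\<Sum>i\<in>I. f i) = (\<Sum>i\<in>I. op_scaleC c (f i))"
  by (rule linear_sum[OF bounded_linear.linear[OF bounded_linear_op_scaleC]])

lemma cpoly_op_smult: "cpoly_op (smult c q) A = op_scaleC c (cpoly_op q A)"
  using cpoly_op_ge[of "smult c q" "degree q" A] degree_smult_le[of c q]
  by (simp add: cpoly_op_def op_scaleC_sum)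

lemma cpoly_op_linear_mult:
  assumes "A \<in> bounded_ops"
  shows "cpoly_op ([:- z, 1:] * q) A = (A - op_scaleC z id_blinfun) o\<^sub>L cpoly_op q A"
proof -
  have "[:- z, 1:] * q = smult (- z) q + pCons 0 q"
    by simp
  then show ?thesis
    using assms by (simp only: cpoly_op_add cpoly_op_smult cpoly_op_pCons)
      (simp add: oL_distribs)
qed

lemma bounded_ops_sum: "(\<And>i. i \<in> I \<Longrightarrow> f i \<in> bounded_ops) \<Longrightarrow> (\<Sum>i\<in>I. f i) \<in> bounded_ops"
  by (induction I rule: infinite_finite_induct) auto

lemma poly_op_eq: "poly_op q A = (\<Sum>i\<le>degree q. coeff q i *\<^sub>R op_pow A i)"
  by (simp add: poly_op_def op_pow_def)

lemma poly_op_ge: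
  assumes "degree q \<le> n"
  shows "poly_op q A = (\<Sum>i\<le>n. coeff q i *\<^sub>R op_pow A i)"
  unfolding poly_op_eq
  by (rule sum.mono_neutral_left) (use assms in \<open>auto simp: coeff_eq_0\<close>)

lemma poly_op_0 [simp]: "poly_op 0 A = 0"
  by (simp add: poly_op_eq)

lemma poly_op_pCons: "poly_op (pCons c q) A = c *\<^sub>R id_blinfun + (A o\<^sub>L poly_op q A)"
proof -
  have "poly_op (pCons c q) A = (\<Sum>i\<le>Suc (degree q). coeff (pCons c q) i *\<^sub>R op_pow A i)"
    by (rule poly_op_ge) (simp add: degree_pCons_le)
  also have "\<dots> = c *\<^sub>R id_blinfun + (A o\<^sub>L poly_op q A)"
    by (simp add: sum.atMost_Suc_shift poly_op_eq[of q A] oL.sum_right oL.scaleR_right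
        del: sum.atMost_Suc)
  finally show ?thesis .
qed

lemma poly_op_add: "poly_op (p + q) A = poly_op p A + poly_op q A"
proof -
  let ?n = "max (degree p) (degree q)"
  show ?thesis
    unfolding poly_op_ge[OF degree_add_le_max] poly_op_ge[of p ?n A, OF max.cobounded1]
      poly_op_ge[of q ?n A, OF max.cobounded2]
    by (simp add: scaleR_add_left sum.distrib)
qed

lemma poly_op_smult: "poly_op (smult c q) A = c *\<^sub>R poly_op q A"
  using poly_op_ge[of "smult c q" "degree q" A] degree_smult_le[of c q]
  by (simp add: poly_op_eq scaleR_sum_right)

lemma poly_op_diff: "poly_op (p - q) A = poly_op p A - poly_op q A"
  using poly_op_add[of "p - q" q A] by simp

lemma poly_op_mult: "poly_op (p * q) A = poly_op p A o\<^sub>L poly_op q A"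
  by (induction p)
    (simp_all add: poly_op_pCons poly_op_add poly_op_smult oL_distribs oL.zero_left oL.scaleR_left oL_assoc)

lemma poly_op_commute: "A o\<^sub>L B = B o\<^sub>L A \<Longrightarrow> poly_op q A o\<^sub>L B = B o\<^sub>L poly_op q A"
proof (induction q)
  case (pCons c q)
  then show ?case
    by (simp add: poly_op_pCons oL_distribs oL.scaleR_left oL.scaleR_right) (metis oL_assoc)
qed (simp add: oL.zero_left oL.zero_right)

lemma bounded_ops_poly_op [simp]: "A \<in> bounded_ops \<Longrightarrow> poly_op q A \<in> bounded_ops"
  by (auto simp: poly_op_eq intro!: bounded_ops_sum)

lemma adj_poly_op:
  assumes A: "A \<in> bounded_ops" "adj A = A"
  shows "adj (poly_op q A) = poly_op q A"
  by (induction q)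
    (simp_all add: poly_op_pCons A poly_op_commute)

lemma cpoly_op_of_real:
  "A \<in> bounded_ops \<Longrightarrow> cpoly_op (map_poly complex_of_real q) A = poly_op q A"
  by (induction q) (simp_all add: map_poly_pCons cpoly_op_pCons poly_op_pCons)

section \<open>Location of the spectrum and the norm of a polynomial\<close>

definition invertible_op :: "('h::complex_hilbert \<Rightarrow>\<^sub>L 'h) \<Rightarrow> bool"
  where "invertible_op A \<longleftrightarrow> (\<exists>B\<in>bounded_ops. A o\<^sub>L B = id_blinfun \<and> B o\<^sub>L A = id_blinfun)"

lemma spectrum_iff: "c \<in> spectrum A \<longleftrightarrow> \<not> invertible_op (A - op_scaleC c id_blinfun)"
  by (simp add: spectrum_def invertible_op_def)

lemma invertible_op_oL:
  assumes "invertible_op A" "invertible_op B"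
  shows "invertible_op (A o\<^sub>L B)"
proof -
  obtain A' B' where "A' \<in> bounded_ops" "A o\<^sub>L A' = id_blinfun" "A' o\<^sub>L A = id_blinfun"
    "B' \<in> bounded_ops" "B o\<^sub>L B' = id_blinfun" "B' o\<^sub>L B = id_blinfun"
    using assms unfolding invertible_op_def by auto
  then show ?thesis
    unfolding invertible_op_def
    by (intro bexI[of _ "B' o\<^sub>L A'"]) (simp_all, metis oL_assoc oL_id)
qed

lemma invertible_op_scaleC:
  assumes "invertible_op A" "c \<noteq> 0" "A \<in> bounded_ops"
  shows "invertible_op (op_scaleC c A)"
proof -
  obtain B where "B \<in> bounded_ops" "A o\<^sub>L B = id_blinfun" "B o\<^sub>L A = id_blinfun"
    using assms unfolding invertible_op_def by auto
  then show ?thesis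
    unfolding invertible_op_def using assms
    by (intro bexI[of _ "op_scaleC (inverse c) B"]) simp_all
qed

text \<open>Half of the spectral mapping theorem: the fundamental theorem of algebra splits off one
  factor \<open>A - z\<close> at a time, invertible because the root \<open>z\<close> lies outside
  the spectrum.\<close>

lemma cpoly_op_invertible:
  assumes A: "A \<in> bounded_ops" and "q \<noteq> 0" and "\<And>z. poly q z = 0 \<Longrightarrow> z \<notin> spectrum A"
  shows "invertible_op (cpoly_op q A)"
  using assms(2,3)
proof (induction "degree q" arbitrary: q)
  case 0
  then obtain c where "q = [:c:]"
    by (metis degree_eq_zeroE)
  moreover have "invertible_op (id_blinfun :: 'a \<Rightarrow>\<^sub>L 'a)"
    unfolding invertible_op_def by (intro bexI[of _ id_blinfun]) auto
  ultimately show ?case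
    using 0 A by (simp add: cpoly_op_pCons oL.zero_right invertible_op_scaleC)
next
  case (Suc n)
  then have "\<not> constant (poly q)"
    by (metis constant_degree Zero_not_Suc)
  then obtain z where z: "poly q z = 0"
    using fundamental_theorem_of_algebra by blast
  then obtain s where s: "q = [:- z, 1:] * s"
    by (metis dvd_def poly_eq_0_iff_dvd)
  have "s \<noteq> 0"
    using Suc.prems(1) s by auto
  then have "degree q = 1 + degree s"
    unfolding s by (subst degree_mult_eq) auto
  then have "degree s = n"
    using Suc.hyps(2) by simp
  moreover have "poly s w = 0 \<Longrightarrow> w \<notin> spectrum A" for w
    using Suc.prems(2)[of w] by (simp add: s)
  ultimately have "invertible_op (cpoly_op s A)"
    using Suc.hyps(1)[of s] \<open>s \<noteq> 0\<close> by auto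
  moreover have "invertible_op (A - op_scaleC z id_blinfun)"
    using Suc.prems(2)[OF z] by (simp add: spectrum_iff)
  ultimately show ?case
    unfolding s cpoly_op_linear_mult[OF A] by (rule invertible_op_oL[rotated])
qed

text \<open>The operator inequality \<open>a \<le> A \<le> b\<close>, written with quadratic forms.
  It encloses the spectrum in an interval, so that functions have to be controlled only on
  \<open>{a..b}\<close>, and such intervals propagate easily through the functional
  calculus.\<close>

definition sa_between :: "real \<Rightarrow> real \<Rightarrow> ('h::complex_hilbert \<Rightarrow>\<^sub>L 'h) \<Rightarrow> bool"
  where "sa_between a b A \<longleftrightarrow> A \<in> bounded_ops \<and> adj A = A \<and>
    (\<forall>x. a * (norm x)\<^sup>2 \<le> Re (cinner (A x) x) \<and> Re (cinner (A x) x) \<le> b * (norm x)\<^sup>2)"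

lemma sa_betweenD:
  assumes "sa_between a b A"
  shows "A \<in> bounded_ops" "adj A = A" "a * (norm x)\<^sup>2 \<le> Re (cinner (A x) x)"
    "Re (cinner (A x) x) \<le> b * (norm x)\<^sup>2"
  using assms by (auto simp: sa_between_def)

text \<open>The factor \<open>d\<close> rotates the numerical range into the right half plane, where
  Lax--Milgram applies. If \<open>d = 0\<close>, coercivity makes the space trivial and all
  operators coincide.\<close>

lemma coercive_invertible_op:
  assumes "D \<in> bounded_ops" "0 < c" "\<And>x. c * (norm x)\<^sup>2 \<le> Re (cinner (op_scaleC d D x) x)"
  shows "invertible_op D"
proof (cases "d = 0")
  case True
  have "(norm x)\<^sup>2 \<le> 0" for x :: 'a
    using assms(3)[of x] \<open>0 < c\<close> by (simp add: True cinner.zero_left mult_le_0_iff)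
  then have "x = 0" for x :: 'a
    by simp
  then have "A = B" for A B :: "'a \<Rightarrow>\<^sub>L 'a"
    by (intro blinfun_eqI) metis
  then show ?thesis
    unfolding invertible_op_def by (meson bounded_ops_id)
next
  case False
  have "invertible_op (op_scaleC d D)"
    unfolding invertible_op_def using assms by (intro lax_milgram) auto
  then have "invertible_op (op_scaleC (inverse d) (op_scaleC d D))"
    by (rule invertible_op_scaleC) (use assms(1) False in auto)
  then show ?thesis
    using False assms(1) by (simp del: of_real_inverse)
qed

lemma spectrum_sa_between:
  assumes A: "sa_between a b A" and z: "z \<in> spectrum A"
  shows "\<exists>t\<in>{a..b}. z = complex_of_real t"
proof -
  note A' = sa_betweenD[OF A]
  define q where "q x = Re (cinner (A x) x)" for x
  have q: "cinner (A x) x = complex_of_real (q x)" for x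
    unfolding q_def by (rule selfadjoint_cinner_real[OF A'(1,2)])
  define D where "D = A - op_scaleC z id_blinfun"
  have D: "D \<in> bounded_ops" "\<not> invertible_op D"
    using A' z by (auto simp: D_def spectrum_iff)
  have cD: "cinner (D x) x = complex_of_real (q x) - z * complex_of_real ((norm x)\<^sup>2)" for x
    by (simp add: D_def blinfun.diff_left cinner.diff_left cinner_scaleC_left q cinner_self)
  have "Im z = 0"
  proof (rule ccontr)
    assume "Im z \<noteq> 0"
    \<comment> \<open>After multiplication by \<open>\<i> * Im z\<close> the self-adjoint part
      \<open>A - Re z\<close> contributes only an imaginary number; the real part left over is
      \<open>(Im z)\<^sup>2 * (norm x)\<^sup>2\<close>.\<close>
    then have "invertible_op D"
      by (intro coercive_invertible_op[of _ "(Im z)\<^sup>2" "\<i> * Im z"])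
        (simp_all add: D cinner_scaleC_left cD power2_eq_square zero_less_mult_iff
          linorder_neq_iff disj_commute)
    then show False
      using D by simp
  qed
  moreover have "a \<le> Re z"
  proof (rule ccontr)
    assume "\<not> a \<le> Re z"
    then have "invertible_op D"
      using A'(3) by (intro coercive_invertible_op[of _ "a - Re z" 1])
        (simp_all add: D cD q_def left_diff_distrib)
    then show False
      using D by simp
  qed
  moreover have "Re z \<le> b"
  proof (rule ccontr)
    assume "\<not> Re z \<le> b"
    then have "invertible_op D"
      using A'(4) by (intro coercive_invertible_op[of _ "Re z - b" "-1"])
        (simp_all add: D cD q_def left_diff_distrib blinfun.minus_left cinner.minus_left)
    then show False
      using D by simp
  qed
  ultimately show ?thesis
    by (intro bexI[of _ "Re z"]) (auto simp: complex_eq_iff)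
qed

lemma sa_between_norm:
  assumes "A \<in> bounded_ops" "adj A = A"
  shows "sa_between (- norm A) (norm A) A"
proof -
  have "\<bar>Re (cinner (A x) x)\<bar> \<le> norm A * (norm x)\<^sup>2" for x
  proof -
    have "\<bar>Re (cinner (A x) x)\<bar> \<le> norm (A x) * norm x"
      using abs_Re_le_cmod[of "cinner (A x) x"] cmod_cinner_le[of "A x" x] by linarith
    also have "\<dots> \<le> (norm A * norm x) * norm x"
      by (intro mult_right_mono norm_blinfun) simp
    finally show ?thesis
      by (simp add: power2_eq_square mult.assoc)
  qed
  then show ?thesis
    using assms by (simp add: sa_between_def abs_le_iff minus_le_iff)
qed

text \<open>Vectors that almost attain the norm are almost annihilated by
  \<open>B\<^sup>2 - b\<^sup>2\<close>. Quantitatively, an inverse \<open>C\<close> would improve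
  the bound for \<open>norm (B x)\<close> from \<open>b * norm x\<close> to
  \<open>sqrt (b\<^sup>2 - 1 / K) * norm x\<close>.\<close>

lemma norm_sq_not_invertible:
  fixes B :: "'h::complex_hilbert \<Rightarrow>\<^sub>L 'h"
  assumes B: "B \<in> bounded_ops" "adj B = B" and "B \<noteq> 0"
  shows "\<not> invertible_op ((B o\<^sub>L B) - (norm B)\<^sup>2 *\<^sub>R id_blinfun)"
proof
  define b where "b = norm B"
  assume "invertible_op ((B o\<^sub>L B) - (norm B)\<^sup>2 *\<^sub>R id_blinfun)"
  then obtain C where C: "C o\<^sub>L ((B o\<^sub>L B) - b\<^sup>2 *\<^sub>R id_blinfun) = id_blinfun"
    by (auto simp: invertible_op_def b_def)
  define K where "K = (norm C)\<^sup>2 * b\<^sup>2"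
  have key: "(norm x)\<^sup>2 \<le> K * (b\<^sup>2 * (norm x)\<^sup>2 - (norm (B x))\<^sup>2)" for x
  proof -
    let ?y = "B (B x) - b\<^sup>2 *\<^sub>R x"
    have "C ?y = x"
      using arg_cong[OF C, of "\<lambda>T. T x"] by (simp add: blinfun.diff_left blinfun.scaleR_left)
    then have "norm x \<le> norm C * norm ?y"
      using norm_blinfun[of C ?y] by simp
    then have "(norm x)\<^sup>2 \<le> (norm C)\<^sup>2 * (norm ?y)\<^sup>2"
      by (metis norm_ge_zero power_mono power_mult_distrib)
    \<comment> \<open>By self-adjointness the mixed term is \<open>(norm (B x))\<^sup>2\<close>;
      estimating the first term by the norm of \<open>B\<close> leaves a multiple of the defect
      \<open>b\<^sup>2 * (norm x)\<^sup>2 - (norm (B x))\<^sup>2\<close>.\<close>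
    also have "(norm ?y)\<^sup>2 = (norm (B (B x)))\<^sup>2 - 2 * b\<^sup>2 * (norm (B x))\<^sup>2 + b\<^sup>2 * b\<^sup>2 * (norm x)\<^sup>2"
    proof -
      have "cinner (B (B x)) x = cinner (B x) (B x)"
        using cinner_adj_left[OF B(1), of "B x" x] by (simp add: B)
      then show ?thesis
        using norm_add_sq[of "B (B x)" "- (b\<^sup>2 *\<^sub>R x)"]
        by (simp add: cinner.minus_right cinner.scaleR_right cinner_self power2_eq_square)
    qed
    also have "\<dots> \<le> b\<^sup>2 * (b\<^sup>2 * (norm x)\<^sup>2 - (norm (B x))\<^sup>2)"
    proof -
      have "norm (B (B x)) \<le> b * norm (B x)"
        unfolding b_def by (rule norm_blinfun)
      then have "(norm (B (B x)))\<^sup>2 \<le> b\<^sup>2 * (norm (B x))\<^sup>2"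
        by (metis norm_ge_zero power_mono power_mult_distrib)
      then show ?thesis
        by (simp add: algebra_simps)
    qed
    finally show ?thesis
      by (simp add: K_def mult_left_mono mult.assoc)
  qed
  have b: "0 < b"
    using \<open>B \<noteq> 0\<close> by (simp add: b_def)
  obtain v where v: "B v \<noteq> 0"
    using \<open>B \<noteq> 0\<close> by (metis blinfun_eqI zero_blinfun.rep_eq)
  then have "v \<noteq> 0"
    by (auto simp: blinfun.zero_right)
  have K: "0 < K"
  proof (rule ccontr)
    assume "\<not> 0 < K"
    then have "K = 0"
      by (simp add: K_def not_less mult_le_0_iff) (use zero_le_power2[of b] in force)
    then show False
      using key[of v] \<open>v \<noteq> 0\<close> by simp
  qed
  have le: "(norm (B x))\<^sup>2 \<le> (b\<^sup>2 - 1 / K) * (norm x)\<^sup>2" for x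
    using key[of x] K by (simp add: field_simps)
  then have pos: "0 \<le> b\<^sup>2 - 1 / K"
    using le[of v] \<open>v \<noteq> 0\<close> v
    by (smt (verit) mult_le_0_iff power2_less_0 zero_le_mult_iff zero_less_norm_iff zero_less_power)
  have "norm B \<le> sqrt (b\<^sup>2 - 1 / K)"
  proof (rule norm_blinfun_bound)
    fix x
    have "(norm (B x))\<^sup>2 \<le> (sqrt (b\<^sup>2 - 1 / K) * norm x)\<^sup>2"
      using le[of x] pos by (simp add: power_mult_distrib)
    then show "norm (B x) \<le> sqrt (b\<^sup>2 - 1 / K) * norm x"
      by (rule power2_le_imp_le) (use pos in simp)
  qed (use pos in simp)
  also have "\<dots> < sqrt (b\<^sup>2)"
    using K by (intro real_sqrt_less_mono) simp
  finally show False
    using b by (simp add: b_def)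
qed

text \<open>If \<open>q(A)\<close> has norm \<open>b > 0\<close>, then
  \<open>q(A)\<^sup>2 - b\<^sup>2\<close> is not invertible, so \<open>q\<^sup>2 - b\<^sup>2\<close>
  has a root in the spectrum of \<open>A\<close>, where \<open>\<bar>q\<bar>\<close> equals
  \<open>b\<close>.\<close>

lemma norm_poly_op_le:
  fixes A :: "'h::complex_hilbert \<Rightarrow>\<^sub>L 'h"
  assumes A: "A \<in> bounded_ops" "adj A = A" and "0 \<le> M"
    and M: "\<And>t. complex_of_real t \<in> spectrum A \<Longrightarrow> \<bar>poly q t\<bar> \<le> M"
  shows "norm (poly_op q A) \<le> M"
proof (rule ccontr)
  assume "\<not> norm (poly_op q A) \<le> M"
  define B where "B = poly_op q A"
  define b where "b = norm B"
  have b: "M < b" "0 < b"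
    using \<open>\<not> norm (poly_op q A) \<le> M\<close> \<open>0 \<le> M\<close> by (auto simp: b_def B_def)
  have B: "B \<in> bounded_ops" "adj B = B" "B \<noteq> 0"
    using A b by (auto simp: B_def adj_poly_op b_def)
  have pc: "poly_op [:c:] A = c *\<^sub>R id_blinfun" for c
    by (simp add: poly_op_pCons oL.zero_right)
  have root: "\<exists>t. complex_of_real t \<in> spectrum A \<and> poly r t = 0"
    if "\<not> invertible_op (poly_op r A)" "r \<noteq> 0" for r
  proof -
    let ?R = "map_poly complex_of_real r"
    have "?R \<noteq> 0"
      using that(2) by (simp add: map_poly_eq_0_iff)
    moreover have "\<not> invertible_op (cpoly_op ?R A)"
      using that(1) by (simp add: cpoly_op_of_real A)
    ultimately obtain z where z: "poly ?R z = 0" "z \<in> spectrum A"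
      using cpoly_op_invertible[OF A(1)] by blast
    then obtain t where t: "z = complex_of_real t"
      using spectrum_sa_between[OF sa_between_norm[OF A]] by blast
    have "poly ?R (complex_of_real t) = complex_of_real (poly r t)"
      by (induction r) (simp_all add: map_poly_pCons)
    then show ?thesis
      using z t by auto
  qed
  define r where "r = q * q - [:b\<^sup>2:]"
  have "poly_op r A = (B o\<^sub>L B) - b\<^sup>2 *\<^sub>R id_blinfun"
    by (simp add: r_def poly_op_diff poly_op_mult pc B_def)
  then have "\<not> invertible_op (poly_op r A)"
    using norm_sq_not_invertible[OF B] by (simp add: b_def)
  have "\<exists>t. complex_of_real t \<in> spectrum A \<and> poly r t = 0"
  proof (cases "r = 0")
    \<comment> \<open>Here \<open>q\<^sup>2\<close> is the constant \<open>b\<^sup>2\<close>, so any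
      spectral point will do and only nonemptiness of the spectrum is at stake.\<close>
    case True
    have "\<exists>t. complex_of_real t \<in> spectrum A"
    proof (cases "A = 0")
      case True
      have "\<not> invertible_op (poly_op [:0, 1:] A)"
      proof
        assume "invertible_op (poly_op [:0, 1:] A)"
        then have "id_blinfun = (0 :: 'h \<Rightarrow>\<^sub>L 'h)"
          by (auto simp: poly_op_pCons True invertible_op_def oL.zero_left oL.zero_right)
        then have "B = 0"
          by (metis oL_id(1) oL.zero_right)
        with B show False
          by simp
      qed
      then show ?thesis
        using root[of "[:0, 1:]"] by (metis pCons_eq_0_iff zero_neq_one)
    next
      case False
      have "poly_op [:- (norm A)\<^sup>2, 0, 1:] A = (A o\<^sub>L A) - (norm A)\<^sup>2 *\<^sub>R id_blinfun"
        by (simp add: poly_op_pCons oL.zero_right)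
      then have "\<not> invertible_op (poly_op [:- (norm A)\<^sup>2, 0, 1:] A)"
        using norm_sq_not_invertible[OF A False] by simp
      then show ?thesis
        using root[of "[:- (norm A)\<^sup>2, 0, 1:]"] by auto
    qed
    then show ?thesis
      by (simp add: True)
  next
    case False
    then show ?thesis
      using root \<open>\<not> invertible_op (poly_op r A)\<close> by blast
  qed
  then obtain t where t: "complex_of_real t \<in> spectrum A" "(poly q t)\<^sup>2 = b\<^sup>2"
    by (auto simp: r_def power2_eq_square)
  then have "\<bar>poly q t\<bar> = b"
    using b by (metis abs_of_pos power2_eq_iff abs_minus_cancel)
  with M[OF t(1)] b show False
    by simp
qed

section \<open>Continuous functional calculus\<close>

lemma real_poly_approximation:
  fixes f :: "real \<Rightarrow> real"
  assumes "compact S" "continuous_on S f"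
  obtains q where "\<forall>n. \<forall>t\<in>S. \<bar>poly (q n) t - f t\<bar> < inverse (real (Suc n))"
    "uniform_limit S (\<lambda>n. poly (q n)) f sequentially"
proof -
  have "\<exists>q. \<forall>t\<in>S. \<bar>poly q t - f t\<bar> < inverse (real (Suc n))" for n
  proof -
    have "0 < inverse (real (Suc n))"
      by simp
    then obtain g where g: "real_polynomial_function g"
      "\<And>x. x \<in> S \<Longrightarrow> \<bar>f x - g x\<bar> < inverse (real (Suc n))"
      using Stone_Weierstrass_real_polynomial_function[OF assms] by blast
    obtain a m where am: "g = (\<lambda>x. \<Sum>i\<le>m. a i * x ^ i)"
      using real_polynomial_function_imp_sum[OF g(1)] by blast
    have "poly (\<Sum>i\<le>m. monom (a i) i) x = g x" for x
      by (simp add: am poly_sum poly_monom)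
    then show ?thesis
      using g(2) by (intro exI[of _ "\<Sum>i\<le>m. monom (a i) i"]) (simp add: abs_minus_commute)
  qed
  then obtain q where q: "\<forall>n. \<forall>t\<in>S. \<bar>poly (q n) t - f t\<bar> < inverse (real (Suc n))"
    by metis
  moreover have "uniform_limit S (\<lambda>n. poly (q n)) f sequentially"
  proof (rule uniform_limitI)
    fix e :: real assume "0 < e"
    then obtain N where N: "inverse (real (Suc N)) < e"
      using reals_Archimedean by blast
    show "\<forall>\<^sub>F n in sequentially. \<forall>x\<in>S. dist (poly (q n) x) (f x) < e"
      unfolding eventually_sequentially
    proof (intro exI allI impI ballI)
      fix n x assume "N \<le> n" "x \<in> S"
      then have "inverse (real (Suc n)) \<le> inverse (real (Suc N))"
        by simp
      with bspec[OF spec[OF q, of n] \<open>x \<in> S\<close>] N show "dist (poly (q n) x) (f x) < e"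
        unfolding dist_real_def by linarith
    qed
  qed
  ultimately show thesis
    by (rule that)
qed

text \<open>Well-definedness of the calculus: the norm bound makes approximating sequences Cauchy
  and any two of them asymptotic. The given sequence \<open>q\<close> also excludes the degenerate
  case in which the description in \<open>cfc_def\<close> holds vacuously for every
  operator.\<close>

lemma poly_op_tendsto_cfc:
  fixes A :: "'h::complex_hilbert \<Rightarrow>\<^sub>L 'h"
  assumes A: "A \<in> bounded_ops" "adj A = A"
    and q: "uniform_limit {t. complex_of_real t \<in> spectrum A} (\<lambda>n. poly (q n)) f sequentially"
  shows "(\<lambda>n. poly_op (q n) A) \<longlonglongrightarrow> cfc f A"
proof -
  let ?S = "{t. complex_of_real t \<in> spectrum A}"
  have close: "\<exists>N. \<forall>m\<ge>N. \<forall>n\<ge>N. norm (poly_op (p m) A - poly_op (r n) A) \<le> e"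
    if p: "uniform_limit ?S (\<lambda>n. poly (p n)) f sequentially"
      and r: "uniform_limit ?S (\<lambda>n. poly (r n)) f sequentially" and "0 < e" for p r e
  proof -
    obtain N1 where N1: "\<And>n x. N1 \<le> n \<Longrightarrow> x \<in> ?S \<Longrightarrow> dist (poly (p n) x) (f x) < e / 2"
      using uniform_limitD[OF p, of "e / 2"] \<open>0 < e\<close> unfolding eventually_sequentially by auto
    obtain N2 where N2: "\<And>n x. N2 \<le> n \<Longrightarrow> x \<in> ?S \<Longrightarrow> dist (poly (r n) x) (f x) < e / 2"
      using uniform_limitD[OF r, of "e / 2"] \<open>0 < e\<close> unfolding eventually_sequentially by auto
    have "norm (poly_op (p m) A - poly_op (r n) A) \<le> e" if "max N1 N2 \<le> m" "max N1 N2 \<le> n" for m n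
      unfolding poly_op_diff[symmetric]
    proof (rule norm_poly_op_le[OF A])
      fix t assume "complex_of_real t \<in> spectrum A"
      then have "dist (poly (p m) t) (f t) < e / 2" "dist (poly (r n) t) (f t) < e / 2"
        using N1 N2 that by auto
      then show "\<bar>poly (p m - r n) t\<bar> \<le> e"
        unfolding dist_real_def poly_diff by linarith
    qed (use \<open>0 < e\<close> in simp)
    then show ?thesis
      by blast
  qed
  have "Cauchy (\<lambda>n. poly_op (q n) A)"
  proof (rule metric_CauchyI)
    fix e :: real assume "0 < e"
    then show "\<exists>M. \<forall>m\<ge>M. \<forall>n\<ge>M. dist (poly_op (q m) A) (poly_op (q n) A) < e"
      using close[OF q q, of "e / 2"] by (force simp: dist_norm)
  qed
  then obtain B where B: "(\<lambda>n. poly_op (q n) A) \<longlonglongrightarrow> B"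
    by (meson Cauchy_convergent convergent_def)
  have lim: "(\<lambda>n. poly_op (p n) A) \<longlonglongrightarrow> B"
    if "uniform_limit ?S (\<lambda>n. poly (p n)) f sequentially" for p
  proof -
    have "(\<lambda>n. poly_op (p n) A - poly_op (q n) A) \<longlonglongrightarrow> 0"
    proof (rule LIMSEQ_I)
      fix e :: real assume "0 < e"
      then show "\<exists>N. \<forall>n\<ge>N. norm (poly_op (p n) A - poly_op (q n) A - 0) < e"
        using close[OF that q, of "e / 2"] by force
    qed
    from tendsto_add[OF this B] show ?thesis
      by simp
  qed
  have "cfc f A = B"
    unfolding cfc_def
  proof (rule the_equality)
    fix C assume "\<forall>q. uniform_limit ?S (\<lambda>n. poly (q n)) f sequentially \<longrightarrow>
      (\<lambda>n. poly_op (q n) A) \<longlonglongrightarrow> C"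
    with q B show "C = B"
      using LIMSEQ_unique by blast
  qed (use lim in blast)
  with B show ?thesis
    by simp
qed

lemma poly_op_tendsto_cfc_between:
  assumes A: "sa_between a b A"
    and "uniform_limit {a..b} (\<lambda>n. poly (q n)) f sequentially"
  shows "(\<lambda>n. poly_op (q n) A) \<longlonglongrightarrow> cfc f A"
proof (rule poly_op_tendsto_cfc[OF sa_betweenD(1,2)[OF A]])
  have "{t. complex_of_real t \<in> spectrum A} \<subseteq> {a..b}"
    using spectrum_sa_between[OF A] by fastforce
  then show "uniform_limit {t. complex_of_real t \<in> spectrum A} (\<lambda>n. poly (q n)) f sequentially"
    by (rule uniform_limit_on_subset[OF assms(2)])
qed

lemma cfc_approximation:
  assumes "sa_between a b A" "continuous_on {a..b} f"
  obtains q where "\<forall>n. \<forall>t\<in>{a..b}. \<bar>poly (q n) t - f t\<bar> < inverse (real (Suc n))"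
    "uniform_limit {a..b} (\<lambda>n. poly (q n)) f sequentially"
    "(\<lambda>n. poly_op (q n) A) \<longlonglongrightarrow> cfc f A"
proof -
  obtain q where "\<forall>n. \<forall>t\<in>{a..b}. \<bar>poly (q n) t - f t\<bar> < inverse (real (Suc n))"
    "uniform_limit {a..b} (\<lambda>n. poly (q n)) f sequentially"
    using real_poly_approximation[OF compact_Icc assms(2)] by blast
  then show thesis
    by (intro that[of q] poly_op_tendsto_cfc_between[OF assms(1)])
qed

lemma cfc_cong:
  assumes A: "sa_between a b A" and f: "continuous_on {a..b} f"
    and "\<And>t. t \<in> {a..b} \<Longrightarrow> f t = g t"
  shows "cfc f A = cfc g A"
proof -
  obtain q where q: "\<forall>n. \<forall>t\<in>{a..b}. \<bar>poly (q n) t - f t\<bar> < inverse (real (Suc n))"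
    "uniform_limit {a..b} (\<lambda>n. poly (q n)) f sequentially"
    "(\<lambda>n. poly_op (q n) A) \<longlonglongrightarrow> cfc f A"
    using cfc_approximation[OF A f] by blast
  have "uniform_limit {a..b} (\<lambda>n. poly (q n)) g sequentially"
    using uniform_limit_cong'[of "{a..b}" "\<lambda>n. poly (q n)" "\<lambda>n. poly (q n)" f g sequentially]
      q(2) assms(3) by simp
  from poly_op_tendsto_cfc_between[OF A this] q(3) show ?thesis
    by (rule LIMSEQ_unique[rotated])
qed

lemma poly_fun_simps:
  "poly (p + q) = (\<lambda>t. poly p t + poly q t)" "poly (p * q) = (\<lambda>t. poly p t * poly q t)"
  "poly [:c:] = (\<lambda>t. c)" "poly [:0, 1:] = (\<lambda>t::'a. t)"
  for p q :: "'a::comm_semiring_1 poly"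
  by (auto simp: fun_eq_iff)

lemma cfc_poly: "sa_between a b A \<Longrightarrow> cfc (poly q) A = poly_op q A"
  using poly_op_tendsto_cfc_between[of a b A "\<lambda>n. q" "poly q"]
  by (simp add: LIMSEQ_const_iff uniform_limit_const)

lemma cfc_const: "sa_between a b A \<Longrightarrow> cfc (\<lambda>t. c) A = c *\<^sub>R id_blinfun"
  using cfc_poly[of a b A "[:c:]"] by (simp add: poly_op_pCons oL.zero_right poly_fun_simps)

lemma cfc_ident: "sa_between a b A \<Longrightarrow> cfc (\<lambda>t. t) A = A"
  using cfc_poly[of a b A "[:0, 1:]"] by (simp add: poly_op_pCons oL.zero_right poly_fun_simps)

lemma cfc_add:
  assumes A: "sa_between a b A" and f: "continuous_on {a..b} f" and g: "continuous_on {a..b} g"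
  shows "cfc (\<lambda>t. f t + g t) A = cfc f A + cfc g A"
proof -
  obtain q where q: "\<forall>n. \<forall>t\<in>{a..b}. \<bar>poly (q n) t - f t\<bar> < inverse (real (Suc n))"
    "uniform_limit {a..b} (\<lambda>n. poly (q n)) f sequentially"
    "(\<lambda>n. poly_op (q n) A) \<longlonglongrightarrow> cfc f A"
    using cfc_approximation[OF A f] by blast
  obtain r where r: "\<forall>n. \<forall>t\<in>{a..b}. \<bar>poly (r n) t - g t\<bar> < inverse (real (Suc n))"
    "uniform_limit {a..b} (\<lambda>n. poly (r n)) g sequentially"
    "(\<lambda>n. poly_op (r n) A) \<longlonglongrightarrow> cfc g A"
    using cfc_approximation[OF A g] by blast
  have "uniform_limit {a..b} (\<lambda>n. poly (q n + r n)) (\<lambda>t. f t + g t) sequentially"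
    using uniform_limit_add[OF q(2) r(2)] by (simp add: poly_fun_simps)
  from poly_op_tendsto_cfc_between[OF A this] tendsto_add[OF q(3) r(3)]
  show ?thesis
    unfolding poly_op_add by (rule LIMSEQ_unique)
qed

lemma cfc_mult:
  assumes A: "sa_between a b A" and f: "continuous_on {a..b} f" and g: "continuous_on {a..b} g"
  shows "cfc (\<lambda>t. f t * g t) A = cfc f A o\<^sub>L cfc g A"
proof -
  obtain q where q: "\<forall>n. \<forall>t\<in>{a..b}. \<bar>poly (q n) t - f t\<bar> < inverse (real (Suc n))"
    "uniform_limit {a..b} (\<lambda>n. poly (q n)) f sequentially"
    "(\<lambda>n. poly_op (q n) A) \<longlonglongrightarrow> cfc f A"
    using cfc_approximation[OF A f] by blast
  obtain r where r: "\<forall>n. \<forall>t\<in>{a..b}. \<bar>poly (r n) t - g t\<bar> < inverse (real (Suc n))"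
    "uniform_limit {a..b} (\<lambda>n. poly (r n)) g sequentially"
    "(\<lambda>n. poly_op (r n) A) \<longlonglongrightarrow> cfc g A"
    using cfc_approximation[OF A g] by blast
  \<comment> \<open>Uniform convergence passes to products because both limits are bounded on the
    compact interval.\<close>
  have "bounded (f ` {a..b})" "bounded (g ` {a..b})"
    using f g by (auto intro: compact_imp_bounded compact_continuous_image)
  then have "uniform_limit {a..b} (\<lambda>n. poly (q n * r n)) (\<lambda>t. f t * g t) sequentially"
    using uniform_lim_mult[OF q(2) r(2)] by (simp add: poly_fun_simps)
  from poly_op_tendsto_cfc_between[OF A this] oL.tendsto[OF q(3) r(3)]
  show ?thesis
    unfolding poly_op_mult by (rule LIMSEQ_unique)
qed

lemma cfc_cmult:
  assumes "sa_between a b A" "continuous_on {a..b} f"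
  shows "cfc (\<lambda>t. c * f t) A = c *\<^sub>R cfc f A"
  using cfc_mult[OF assms(1) continuous_on_const assms(2), of c] assms(1)
  by (simp add: cfc_const oL.scaleR_left)

lemma cfc_diff:
  assumes "sa_between a b A" "continuous_on {a..b} f" "continuous_on {a..b} g"
  shows "cfc (\<lambda>t. f t - g t) A = cfc f A - cfc g A"
  using cfc_add[OF assms(1) continuous_on_diff[OF assms(2,3)] assms(3)]
  by (simp add: algebra_simps)

lemma cfc_commute:
  assumes A: "sa_between a b A" and f: "continuous_on {a..b} f" and "A o\<^sub>L B = B o\<^sub>L A"
  shows "cfc f A o\<^sub>L B = B o\<^sub>L cfc f A"
proof -
  obtain q where q: "\<forall>n. \<forall>t\<in>{a..b}. \<bar>poly (q n) t - f t\<bar> < inverse (real (Suc n))"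
    "uniform_limit {a..b} (\<lambda>n. poly (q n)) f sequentially"
    "(\<lambda>n. poly_op (q n) A) \<longlonglongrightarrow> cfc f A"
    using cfc_approximation[OF A f] by blast
  from oL.tendsto[OF q(3) tendsto_const, of B] oL.tendsto[OF tendsto_const q(3), of B]
  show ?thesis
    unfolding poly_op_commute[OF assms(3)] by (rule LIMSEQ_unique)
qed

lemma cfc_bounded_ops [simp]:
  assumes A: "sa_between a b A" and f: "continuous_on {a..b} f"
  shows "cfc f A \<in> bounded_ops"
proof -
  obtain q where q: "\<forall>n. \<forall>t\<in>{a..b}. \<bar>poly (q n) t - f t\<bar> < inverse (real (Suc n))"
    "uniform_limit {a..b} (\<lambda>n. poly (q n)) f sequentially"
    "(\<lambda>n. poly_op (q n) A) \<longlonglongrightarrow> cfc f A"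
    using cfc_approximation[OF A f] by blast
  from q(3) show ?thesis
    by (rule bounded_ops_lim) (simp add: sa_betweenD[OF A])
qed

lemma adj_cfc:
  assumes A: "sa_between a b A" and f: "continuous_on {a..b} f"
  shows "adj (cfc f A) = cfc f A"
proof -
  obtain q where q: "\<forall>n. \<forall>t\<in>{a..b}. \<bar>poly (q n) t - f t\<bar> < inverse (real (Suc n))"
    "uniform_limit {a..b} (\<lambda>n. poly (q n)) f sequentially"
    "(\<lambda>n. poly_op (q n) A) \<longlonglongrightarrow> cfc f A"
    using cfc_approximation[OF A f] by blast
  from q(3) show ?thesis
    by (rule selfadjoint_bounded_ops_lim) (simp_all add: sa_betweenD[OF A] adj_poly_op)
qed

lemma norm_cfc_le:
  assumes A: "sa_between a b A" and f: "continuous_on {a..b} f" and "0 \<le> M"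
    and M: "\<And>t. t \<in> {a..b} \<Longrightarrow> \<bar>f t\<bar> \<le> M"
  shows "norm (cfc f A) \<le> M"
proof -
  obtain q where q: "\<forall>n. \<forall>t\<in>{a..b}. \<bar>poly (q n) t - f t\<bar> < inverse (real (Suc n))"
    "uniform_limit {a..b} (\<lambda>n. poly (q n)) f sequentially"
    "(\<lambda>n. poly_op (q n) A) \<longlonglongrightarrow> cfc f A"
    using cfc_approximation[OF A f] by blast
  have "norm (poly_op (q n) A) \<le> M + inverse (real (Suc n))" for n
  proof (rule norm_poly_op_le)
    fix t assume "complex_of_real t \<in> spectrum A"
    then have "t \<in> {a..b}"
      using spectrum_sa_between[OF A] by fastforce
    then show "\<bar>poly (q n) t\<bar> \<le> M + inverse (real (Suc n))"
      using bspec[OF spec[OF q(1), of n], of t] M[of t] by linarith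
  qed (use \<open>0 \<le> M\<close> sa_betweenD[OF A] in auto)
  moreover have "(\<lambda>n. M + inverse (real (Suc n))) \<longlonglongrightarrow> M + 0"
    by (intro tendsto_intros LIMSEQ_inverse_real_of_nat)
  ultimately show ?thesis
    using LIMSEQ_le[OF tendsto_norm[OF q(3)]] by auto
qed

text \<open>With \<open>f\<close> also its square root is continuous, so \<open>cfc f A\<close> is
  the square of a self-adjoint operator and its quadratic form is a squared norm.\<close>

lemma cfc_nonneg:
  assumes A: "sa_between a b A" and f: "continuous_on {a..b} f"
    and "\<And>t. t \<in> {a..b} \<Longrightarrow> 0 \<le> f t"
  shows "0 \<le> Re (cinner (cfc f A x) x)"
proof -
  have g: "continuous_on {a..b} (\<lambda>t. sqrt (f t))"
    using f by (intro continuous_intros)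
  have "cfc f A = cfc (\<lambda>t. sqrt (f t) * sqrt (f t)) A"
    by (rule cfc_cong[OF A f]) (simp add: assms(3))
  also have "\<dots> = cfc (\<lambda>t. sqrt (f t)) A o\<^sub>L cfc (\<lambda>t. sqrt (f t)) A"
    by (rule cfc_mult[OF A g g])
  finally have "cinner (cfc f A x) x
      = cinner (cfc (\<lambda>t. sqrt (f t)) A x) (cfc (\<lambda>t. sqrt (f t)) A x)"
    using cinner_adj_left[OF cfc_bounded_ops[OF A g]] adj_cfc[OF A g] by simp
  then show ?thesis
    by (simp add: cinner_nonneg)
qed

lemma sa_between_cfc:
  assumes A: "sa_between a b A" and f: "continuous_on {a..b} f"
    and "\<And>t. t \<in> {a..b} \<Longrightarrow> c \<le> f t \<and> f t \<le> d"
  shows "sa_between c d (cfc f A)"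
proof -
  have "0 \<le> Re (cinner (cfc (\<lambda>t. f t - c) A x) x)" "0 \<le> Re (cinner (cfc (\<lambda>t. d - f t) A x) x)" for x
    using assms(3) by (auto intro!: cfc_nonneg[OF A] continuous_intros f)
  moreover have "cfc (\<lambda>t. f t - c) A = cfc f A - c *\<^sub>R id_blinfun"
    "cfc (\<lambda>t. d - f t) A = d *\<^sub>R id_blinfun - cfc f A"
    using A f by (simp_all add: cfc_diff cfc_const)
  ultimately show ?thesis
    unfolding sa_between_def using A f
    by (auto simp: adj_cfc blinfun.diff_left cinner.diff_left blinfun.scaleR_left
        cinner.scaleR_left cinner_self)
qed

lemma poly_op_cfc:
  assumes A: "sa_between a b A" and f: "continuous_on {a..b} f"
  shows "poly_op q (cfc f A) = cfc (\<lambda>t. poly q (f t)) A"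
proof (induction q)
  case 0
  then show ?case
    using cfc_const[OF A, of 0] by simp
next
  case (pCons c q)
  have "continuous_on {a..b} (\<lambda>t. poly q (f t))"
    by (intro continuous_intros f)
  moreover from this have "continuous_on {a..b} (\<lambda>t. f t * poly q (f t))"
    by (intro continuous_intros f)
  ultimately show ?case
    using f by (simp add: poly_op_pCons pCons.IH cfc_add[OF A] cfc_mult[OF A] cfc_const[OF A])
qed

text \<open>Only the outer function is approximated. Polynomials in \<open>cfc f A\<close> are
  already functions of \<open>A\<close>, and the uniform error on \<open>{c..d}\<close> bounds the
  error after composition with \<open>f\<close>.\<close>

lemma cfc_cfc:
  assumes A: "sa_between a b A" and f: "continuous_on {a..b} f"
    and fcd: "\<And>t. t \<in> {a..b} \<Longrightarrow> c \<le> f t \<and> f t \<le> d" and g: "continuous_on {c..d} g"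
  shows "cfc g (cfc f A) = cfc (\<lambda>t. g (f t)) A"
proof -
  have B: "sa_between c d (cfc f A)"
    by (rule sa_between_cfc[OF A f fcd])
  obtain q where q: "\<forall>n. \<forall>t\<in>{c..d}. \<bar>poly (q n) t - g t\<bar> < inverse (real (Suc n))"
    "uniform_limit {c..d} (\<lambda>n. poly (q n)) g sequentially"
    "(\<lambda>n. poly_op (q n) (cfc f A)) \<longlonglongrightarrow> cfc g (cfc f A)"
    using cfc_approximation[OF B g] by blast
  have gf: "continuous_on {a..b} (\<lambda>t. g (f t))"
    by (rule continuous_on_compose2[OF g f]) (use fcd in auto)
  have qf: "continuous_on {a..b} (\<lambda>t. poly (q n) (f t))" for n
    by (intro continuous_intros f)
  have "norm (poly_op (q n) (cfc f A) - cfc (\<lambda>t. g (f t)) A) \<le> inverse (real (Suc n))" for n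
  proof -
    have "norm (cfc (\<lambda>t. poly (q n) (f t) - g (f t)) A) \<le> inverse (real (Suc n))"
      using q(1) fcd by (intro norm_cfc_le[OF A] continuous_intros f gf) (auto intro: less_imp_le)
    then show ?thesis
      by (simp add: poly_op_cfc[OF A f] cfc_diff[OF A qf gf])
  qed
  then have "(\<lambda>n. poly_op (q n) (cfc f A) - cfc (\<lambda>t. g (f t)) A) \<longlonglongrightarrow> 0"
    by (intro Lim_null_comparison[OF always_eventually LIMSEQ_inverse_real_of_nat]) auto
  then have "(\<lambda>n. poly_op (q n) (cfc f A)) \<longlonglongrightarrow> cfc (\<lambda>t. g (f t)) A"
    by (simp add: LIM_zero_iff)
  with q(3) show ?thesis
    by (rule LIMSEQ_unique)
qed

text \<open>By compactness, vanishing of \<open>g\<close> on the zeros of \<open>f\<close> improves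
  to \<open>g\<^sup>2 \<le> e + C * f\<close> for every \<open>e > 0\<close>. With
  \<open>f(A) = 0\<close> this reads \<open>g(A)\<^sup>2 \<le> e\<close>. The lemma turns equality
  cases of scalar inequalities into operator equations.\<close>

lemma cfc_eq_0_transfer:
  assumes A: "sa_between a b A" and f: "continuous_on {a..b} f" and g: "continuous_on {a..b} g"
    and f0: "\<And>t. t \<in> {a..b} \<Longrightarrow> 0 \<le> f t"
    and fg: "\<And>t. t \<in> {a..b} \<Longrightarrow> f t = 0 \<Longrightarrow> g t = 0"
    and "cfc f A = 0"
  shows "cfc g A = 0"
proof -
  have bound: "\<exists>C\<ge>0. \<forall>t\<in>{a..b}. (g t)\<^sup>2 \<le> e + C * f t" if "0 < e" for e
  proof -
    \<comment> \<open>Off \<open>S\<close> the summand \<open>e\<close> alone suffices. On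
      \<open>S\<close> the function \<open>g\<close> has no zero, hence neither has
      \<open>f\<close>, which therefore has a positive minimum there.\<close>
    define S where "S = {t\<in>{a..b}. e \<le> (g t)\<^sup>2}"
    have "compact S"
    proof -
      have "continuous_on {a..b} (\<lambda>t. (g t)\<^sup>2)"
        by (intro continuous_intros g)
      then have "closed ({a..b} \<inter> (\<lambda>t. (g t)\<^sup>2) -` {e..})"
        by (rule continuous_closed_preimage) auto
      moreover have "S = {a..b} \<inter> (\<lambda>t. (g t)\<^sup>2) -` {e..}"
        by (auto simp: S_def)
      ultimately show ?thesis
        by (metis bounded_closed_interval bounded_Int compact_eq_bounded_closed)
    qed
    show ?thesis
    proof (cases "S = {}")
      case True
      then have "(g t)\<^sup>2 \<le> e" if "t \<in> {a..b}" for t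
        using that by (force simp: S_def)
      then show ?thesis
        by (intro exI[of _ 0]) simp
    next
      case False
      have Sf: "continuous_on S f" "continuous_on S (\<lambda>t. (g t)\<^sup>2)"
        using f g by (auto simp: S_def intro!: continuous_intros intro: continuous_on_subset)
      obtain s where s: "s \<in> S" "\<And>t. t \<in> S \<Longrightarrow> f s \<le> f t"
        using continuous_attains_inf[OF \<open>compact S\<close> False Sf(1)] by blast
      obtain m where m: "m \<in> S" "\<And>t. t \<in> S \<Longrightarrow> (g t)\<^sup>2 \<le> (g m)\<^sup>2"
        using continuous_attains_sup[OF \<open>compact S\<close> False Sf(2)] by blast
      have "f s \<noteq> 0"
        using s(1) fg[of s] \<open>0 < e\<close> by (auto simp: S_def)
      then have "0 < f s"
        using s(1) f0[of s] by (auto simp: S_def)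
      have "(g t)\<^sup>2 \<le> e + (g m)\<^sup>2 / f s * f t" if "t \<in> {a..b}" for t
      proof (cases "t \<in> S")
        case True
        have "(g m)\<^sup>2 * f s \<le> (g m)\<^sup>2 * f t"
          using s(2)[OF True] by (simp add: mult_left_mono)
        then have "(g m)\<^sup>2 \<le> (g m)\<^sup>2 / f s * f t"
          using \<open>0 < f s\<close> by (simp add: field_simps)
        with m(2)[OF True] \<open>0 < e\<close> show ?thesis
          by linarith
      next
        case False
        moreover have "0 \<le> (g m)\<^sup>2 / f s * f t"
          using \<open>0 < f s\<close> f0[OF that] by simp
        ultimately show ?thesis
          using that by (auto simp: S_def)
      qed
      then show ?thesis
        using \<open>0 < f s\<close> by (intro exI[of _ "(g m)\<^sup>2 / f s"]) auto
    qed
  qed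
  have "cfc g A x = 0" for x
  proof -
    have "(norm (cfc g A x))\<^sup>2 \<le> 0 + e" if "0 < e" for e
    proof -
      \<comment> \<open>Scaled so that \<open>d * (norm x)\<^sup>2 \<le> e\<close>; the
        \<open>+ 1\<close> keeps the quotient meaningful at \<open>x = 0\<close>.\<close>
      define d where "d = e / ((norm x)\<^sup>2 + 1)"
      have "0 < d"
        using \<open>0 < e\<close> by (simp add: d_def add_nonneg_pos)
      then obtain C where C: "\<And>t. t \<in> {a..b} \<Longrightarrow> (g t)\<^sup>2 \<le> d + C * f t"
        using bound[of d] by blast
      have c1: "continuous_on {a..b} (\<lambda>t. C * f t)" and c2: "continuous_on {a..b} (\<lambda>t. g t * g t)"
        by (intro continuous_intros f g)+
      have c3: "continuous_on {a..b} (\<lambda>t. d + C * f t)"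
        by (intro continuous_intros f)
      have "0 \<le> Re (cinner (cfc (\<lambda>t. d + C * f t - g t * g t) A x) x)"
        using C by (intro cfc_nonneg[OF A] continuous_intros f g) (simp add: power2_eq_square)
      also have "cfc (\<lambda>t. d + C * f t - g t * g t) A = d *\<^sub>R id_blinfun - (cfc g A o\<^sub>L cfc g A)"
        using \<open>cfc f A = 0\<close>
        by (simp add: cfc_diff[OF A c3 c2] cfc_add[OF A continuous_on_const c1] cfc_cmult[OF A f]
            cfc_const[OF A] cfc_mult[OF A g g])
      finally have "0 \<le> d * (norm x)\<^sup>2 - Re (cinner (cfc g A (cfc g A x)) x)"
        by (simp add: blinfun.diff_left cinner.diff_left blinfun.scaleR_left cinner.scaleR_left
            cinner_self)
      moreover have "cinner (cfc g A (cfc g A x)) x = cinner (cfc g A x) (cfc g A x)"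
        using cinner_adj_left[OF cfc_bounded_ops[OF A g]] adj_cfc[OF A g] by simp
      ultimately have "(norm (cfc g A x))\<^sup>2 \<le> d * (norm x)\<^sup>2"
        by (simp add: cinner_self)
      also have "\<dots> \<le> d * ((norm x)\<^sup>2 + 1)"
        using \<open>0 < d\<close> by simp
      also have "\<dots> = e"
        by (simp add: d_def add_nonneg_eq_0_iff)
      finally show ?thesis
        by simp
    qed
    then have "(norm (cfc g A x))\<^sup>2 \<le> 0"
      by (rule field_le_epsilon)
    then show ?thesis
      by simp
  qed
  then show ?thesis
    by (intro blinfun_eqI) simp
qed

section \<open>Von Neumann algebras and traces\<close>

lemma commutantI:
  "A \<in> bounded_ops \<Longrightarrow> (\<And>B. B \<in> S \<Longrightarrow> A o\<^sub>L B = B o\<^sub>L A) \<Longrightarrow> A \<in> commutant S"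
  by (simp add: commutant_def)

lemma commutantD:
  assumes "A \<in> commutant S"
  shows "A \<in> bounded_ops" "B \<in> S \<Longrightarrow> A o\<^sub>L B = B o\<^sub>L A"
  using assms by (auto simp: commutant_def)

locale finite_factor_pair =
  fixes N :: "('h::complex_hilbert \<Rightarrow>\<^sub>L 'h) set" and \<tau> :: "('h \<Rightarrow>\<^sub>L 'h) \<Rightarrow> complex"
  assumes finite_factor: "finite_factor N \<tau>"
begin

lemma vna: "von_neumann_algebra N" and factor: "factor N" and tracial: "tracial_state N \<tau>"
  and faithful: "faithful N \<tau>"
  using finite_factor by (auto simp: finite_factor_def factor_def)

lemma bops [simp, intro]: "A \<in> N \<Longrightarrow> A \<in> bounded_ops"
  using vna by (auto simp: von_neumann_algebra_def)

lemma adj_mem [simp, intro]: "A \<in> N \<Longrightarrow> adj A \<in> N"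
  using vna by (auto simp: von_neumann_algebra_def)

text \<open>The bicommutant property as an introduction rule: closure of \<open>N\<close> under
  algebraic operations, functional calculus and suitable projections all reduces to commuting with
  the commutant.\<close>

lemma memI:
  "A \<in> bounded_ops \<Longrightarrow> (\<And>B. B \<in> commutant N \<Longrightarrow> A o\<^sub>L B = B o\<^sub>L A) \<Longrightarrow> A \<in> N"
  using vna commutantI[of A "commutant N"] by (auto simp: von_neumann_algebra_def)

lemma commute: "A \<in> N \<Longrightarrow> B \<in> commutant N \<Longrightarrow> A o\<^sub>L B = B o\<^sub>L A"
  using commutantD(2)[of B N A] by simp

lemma id_mem [simp, intro]: "id_blinfun \<in> N"
  by (rule memI) auto

lemma zero_mem [simp, intro]: "0 \<in> N"
  by (rule memI) (auto simp: oL.zero_left oL.zero_right)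

lemma add_mem [simp, intro]: "A \<in> N \<Longrightarrow> B \<in> N \<Longrightarrow> A + B \<in> N"
  by (rule memI) (auto simp: oL_distribs commute)

lemma diff_mem [simp, intro]: "A \<in> N \<Longrightarrow> B \<in> N \<Longrightarrow> A - B \<in> N"
  by (rule memI) (auto simp: oL_distribs commute)

lemma scaleC_mem [simp, intro]: "A \<in> N \<Longrightarrow> op_scaleC c A \<in> N"
  by (rule memI) (auto simp: commute dest: commutantD)

lemma scaleR_mem [simp, intro]: "A \<in> N \<Longrightarrow> r *\<^sub>R A \<in> N"
  by (metis op_scaleC_of_real scaleC_mem)

lemma minus_mem [simp, intro]: "A \<in> N \<Longrightarrow> - A \<in> N"
  using diff_mem[of 0 A] by simp

lemma oL_mem [simp, intro]: "A \<in> N \<Longrightarrow> B \<in> N \<Longrightarrow> A o\<^sub>L B \<in> N"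
  by (rule memI, simp) (metis oL_assoc commute)

lemma sum_mem [intro]: "(\<And>i. i \<in> I \<Longrightarrow> f i \<in> N) \<Longrightarrow> (\<Sum>i\<in>I. f i) \<in> N"
  by (induction I rule: infinite_finite_induct) auto

lemma cfc_mem: "A \<in> N \<Longrightarrow> sa_between a b A \<Longrightarrow> continuous_on {a..b} f \<Longrightarrow> cfc f A \<in> N"
  by (rule memI) (auto simp: commute intro!: cfc_commute cfc_bounded_ops)

lemma poly_op_mem [simp, intro]: "A \<in> N \<Longrightarrow> poly_op q A \<in> N"
  by (rule memI) (auto simp: commute intro!: poly_op_commute)

lemma commutant_adj:
  assumes B: "B \<in> commutant N"
  shows "adj B \<in> commutant N"
proof (rule commutantI)
  fix A assume A: "A \<in> N"
  have "adj (adj A o\<^sub>L B) = adj (B o\<^sub>L adj A)"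
    using commute[OF adj_mem[OF A] B] by simp
  then show "adj B o\<^sub>L A = A o\<^sub>L adj B"
    using A commutantD(1)[OF B] by simp
qed (simp add: commutantD(1)[OF B])

text \<open>Invariance of \<open>K\<close> under \<open>B\<close> says \<open>P B P = B P\<close>;
  invariance under \<open>adj B\<close> says, after taking adjoints,
  \<open>P B P = P B\<close>.\<close>

lemma projection_commute:
  assumes P: "P \<in> bounded_ops" "adj P = P" "\<And>x. P x \<in> K" "\<And>x. x \<in> K \<Longrightarrow> P x = x"
    and B: "B \<in> bounded_ops" "\<And>x. x \<in> K \<Longrightarrow> B x \<in> K" "\<And>x. x \<in> K \<Longrightarrow> adj B x \<in> K"
  shows "P o\<^sub>L B = B o\<^sub>L P"
proof -
  have 1: "P o\<^sub>L (B o\<^sub>L P) = B o\<^sub>L P" and 2: "P o\<^sub>L (adj B o\<^sub>L P) = adj B o\<^sub>L P"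
    by (rule blinfun_eqI, simp add: P B)+
  from arg_cong[OF 2, of adj] have "P o\<^sub>L (B o\<^sub>L P) = P o\<^sub>L B"
    using P(1,2) B(1) by (simp add: oL_assoc)
  with 1 show ?thesis
    by simp
qed

text \<open>The source of projections in \<open>N\<close>. Invariance under the commutant includes
  invariance under adjoints, because the commutant is closed under them.\<close>

lemma projection_mem:
  assumes K: "closed K" "subspace K" "\<And>c x. x \<in> K \<Longrightarrow> c *\<^sub>C x \<in> K"
    and inv: "\<And>B x. B \<in> commutant N \<Longrightarrow> x \<in> K \<Longrightarrow> blinfun_apply B x \<in> K"
  shows "\<exists>P\<in>N. adj P = P \<and> (\<forall>x. P x \<in> K) \<and> (\<forall>x\<in>K. P x = x)"
proof -
  obtain P where P: "P \<in> bounded_ops" "adj P = P" "\<forall>x. P x \<in> K" "\<forall>x\<in>K. P x = x"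
    using projection_operator_exists[OF K] by blast
  moreover have "P \<in> N"
    using P inv commutant_adj commutantD(1)
    by (intro memI projection_commute[of P K]) auto
  ultimately show ?thesis
    by blast
qed

lemma center_scalar:
  assumes "A \<in> N" "\<And>B. B \<in> N \<Longrightarrow> A o\<^sub>L B = B o\<^sub>L A"
  shows "\<exists>c. A = op_scaleC c id_blinfun"
proof -
  have "A \<in> N \<inter> commutant N"
    using assms by (auto intro: commutantI)
  then show ?thesis
    using factor by (auto simp: factor_def)
qed

section \<open>The trace: order bounds, adjoints, faithfulness\<close>

lemma tr_add [simp]: "A \<in> N \<Longrightarrow> B \<in> N \<Longrightarrow> \<tau> (A + B) = \<tau> A + \<tau> B"
  and tr_scaleC [simp]: "A \<in> N \<Longrightarrow> \<tau> (op_scaleC c A) = c * \<tau> A"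
  and tr_id [simp]: "\<tau> id_blinfun = 1"
  using tracial by (auto simp: tracial_state_def)

lemma tr_nonneg: "A \<in> N \<Longrightarrow> positive_op A \<Longrightarrow> \<tau> A \<in> \<real>\<^sub>\<ge>\<^sub>0"
  using tracial by (auto simp: tracial_state_def)

lemma tr_scaleR [simp]: "A \<in> N \<Longrightarrow> \<tau> (r *\<^sub>R A) = r * \<tau> A"
  using tr_scaleC[of A "complex_of_real r"] by simp

lemma tr_0 [simp]: "\<tau> 0 = 0"
  using tr_scaleR[of 0 0] by simp

lemma tr_minus [simp]: "A \<in> N \<Longrightarrow> \<tau> (- A) = - \<tau> A"
  using tr_scaleR[of A "-1"] by simp

lemma tr_diff [simp]: "A \<in> N \<Longrightarrow> B \<in> N \<Longrightarrow> \<tau> (A - B) = \<tau> A - \<tau> B"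
  using tr_add[of A "- B"] by simp

lemma tr_sum: "(\<And>i. i \<in> I \<Longrightarrow> f i \<in> N) \<Longrightarrow> \<tau> (\<Sum>i\<in>I. f i) = (\<Sum>i\<in>I. \<tau> (f i))"
  by (induction I rule: infinite_finite_induct) (auto simp: sum_mem)

lemma positive_opI:
  assumes "A \<in> bounded_ops" "adj A = A" "\<And>x. 0 \<le> Re (cinner (A x) x)"
  shows "positive_op A"
  unfolding positive_op_def
  by (subst selfadjoint_cinner_real[OF assms(1,2)]) (simp add: assms(3) complex_nonneg_Reals_iff)

lemma
  assumes A: "A \<in> N" "sa_between a b A"
  shows tr_sa_real: "Im (\<tau> A) = 0" and tr_sa_ge: "a \<le> Re (\<tau> A)" and tr_sa_le: "Re (\<tau> A) \<le> b"
proof -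
  have "positive_op (A - a *\<^sub>R id_blinfun)" "positive_op (b *\<^sub>R id_blinfun - A)"
    using A sa_betweenD[OF A(2)]
    by (auto intro!: positive_opI simp: blinfun.diff_left cinner.diff_left blinfun.scaleR_left
        cinner.scaleR_left cinner_self)
  from this[THEN tr_nonneg[rotated]]
  show "Im (\<tau> A) = 0" "a \<le> Re (\<tau> A)" "Re (\<tau> A) \<le> b"
    using A(1) by (simp_all add: complex_nonneg_Reals_iff)
qed

lemma tr_sa_abs_le: "A \<in> N \<Longrightarrow> adj A = A \<Longrightarrow> \<bar>Re (\<tau> A)\<bar> \<le> norm A"
  using tr_sa_ge[OF _ sa_between_norm, of A] tr_sa_le[OF _ sa_between_norm, of A]
  by (simp add: abs_le_iff minus_le_iff)

lemma tr_adj: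
  assumes A: "A \<in> N"
  shows "\<tau> (adj A) = cnj (\<tau> A)"
proof -
  have "Im (\<tau> (A + adj A)) = 0"
    using A by (intro tr_sa_real[OF _ sa_between_norm]) (auto simp: add.commute)
  moreover have "Im (\<tau> (op_scaleC \<i> (A - adj A))) = 0"
    using A by (intro tr_sa_real[OF _ sa_between_norm]) (auto simp: op_scaleC_diff_right)
  ultimately show ?thesis
    using A by (simp add: complex_eq_iff)
qed

lemma tr_faithful:
  assumes "A \<in> N" "adj A = A" "\<And>x. 0 \<le> Re (cinner (A x) x)" "Re (\<tau> A) = 0"
  shows "A = 0"
proof -
  have "Im (\<tau> A) = 0"
    by (rule tr_sa_real[OF assms(1) sa_between_norm]) (use assms in auto)
  moreover have "positive_op A"
    by (rule positive_opI) (use assms in auto)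
  ultimately show ?thesis
    using faithful assms by (auto simp: faithful_def complex_eq_iff)
qed

lemma tr_adj_mult_eq_0:
  assumes "A \<in> N" "Re (\<tau> (adj A o\<^sub>L A)) = 0"
  shows "A = 0"
proof -
  have form: "cinner ((adj A o\<^sub>L A) x) x = (norm (A x))\<^sup>2" for x
    using assms(1) by (simp add: cinner_adj_left cinner_self)
  have "adj A o\<^sub>L A = 0"
    by (rule tr_faithful) (use assms form in auto)
  then have "norm (A x) = 0" for x
    using form[of x] by (simp add: cinner.zero_left)
  then show ?thesis
    by (intro blinfun_eqI) simp
qed

text \<open>\<open>K\<close> is the largest \<open>N\<close>-invariant subspace of the kernel of
  \<open>a\<close>, and it contains the range of \<open>b\<close>. Invariance under the commutant
  puts its projection into \<open>N\<close>; invariance under \<open>N\<close> makes the projection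
  central, hence scalar. If the scalar is 0 then \<open>b = 0\<close>, otherwise \<open>K\<close> is
  the whole space and \<open>a = 0\<close>.\<close>

lemma factor_prime:
  assumes a: "a \<in> N" and b: "b \<in> N" and ab: "\<And>r. r \<in> N \<Longrightarrow> a o\<^sub>L r o\<^sub>L b = 0"
  shows "a = 0 \<or> b = 0"
proof -
  define K where "K = {x. \<forall>r\<in>N. a (r x) = 0}"
  have "K = (\<Inter>r\<in>N. {x. a (blinfun_apply r x) = 0})"
    by (auto simp: K_def)
  then have "closed K"
    by (auto intro!: closed_INT closed_Collect_eq continuous_intros)
  moreover have "subspace K"
    by (auto simp: K_def subspace_def blinfun.zero_right blinfun.add_right blinfun.scaleR_right)
  moreover have KC: "c *\<^sub>C x \<in> K" if "x \<in> K" for c x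
    using that a by (auto simp: K_def bounded_opsD scaleC_zero_right)
  moreover have "blinfun_apply B x \<in> K" if B: "B \<in> commutant N" and "x \<in> K" for B x
  proof -
    have "a (r (B x)) = 0" if "r \<in> N" for r
    proof -
      have "(a o\<^sub>L r) o\<^sub>L B = B o\<^sub>L (a o\<^sub>L r)"
        using a \<open>r \<in> N\<close> B by (intro commute) auto
      then have "a (r (B x)) = B (a (r x))"
        by (metis blinfun_apply_blinfun_compose)
      also have "\<dots> = 0"
        using \<open>x \<in> K\<close> \<open>r \<in> N\<close> by (simp add: K_def blinfun.zero_right)
      finally show ?thesis .
    qed
    then show ?thesis
      by (simp add: K_def)
  qed
  ultimately have "\<exists>P\<in>N. adj P = P \<and> (\<forall>x. P x \<in> K) \<and> (\<forall>x\<in>K. P x = x)"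
    by (rule projection_mem)
  then obtain P where P: "P \<in> N" "adj P = P" "\<And>x. P x \<in> K" "\<And>x. x \<in> K \<Longrightarrow> P x = x"
    by metis
  have inv: "s x \<in> K" if "s \<in> N" "x \<in> K" for s x
  proof -
    have "a (r (s x)) = 0" if "r \<in> N" for r
    proof -
      have "r o\<^sub>L s \<in> N"
        using that \<open>s \<in> N\<close> by simp
      then have "a ((r o\<^sub>L s) x) = 0"
        using \<open>x \<in> K\<close> unfolding K_def by blast
      then show ?thesis
        by simp
    qed
    then show ?thesis
      by (simp add: K_def)
  qed
  have "P o\<^sub>L s = s o\<^sub>L P" if "s \<in> N" for s
    using that P inv by (intro projection_commute[of P K]) auto
  then obtain c where c: "P = op_scaleC c id_blinfun"
    using center_scalar P(1) by blast
  have bK: "b x \<in> K" for x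
  proof -
    have "a (r (b x)) = 0" if "r \<in> N" for r
      using arg_cong[OF ab[OF that], of "\<lambda>T. T x"] by simp
    then show ?thesis
      by (simp add: K_def)
  qed
  show ?thesis
  proof (cases "c = 0")
    case True
    then have "b x = 0" for x
      using P(4)[OF bK[of x]] c by simp
    then have "b = 0"
      by (intro blinfun_eqI) simp
    then show ?thesis
      by simp
  next
    case False
    have "a x = 0" for x
    proof -
      have "inverse c *\<^sub>C (P x) \<in> K"
        by (intro KC P(3))
      also have "inverse c *\<^sub>C (P x) = x"
        using False by (simp add: c scaleC_scaleC scaleC_one)
      finally have "a (id_blinfun x) = 0"
        unfolding K_def by blast
      then show ?thesis
        by simp
    qed
    then have "a = 0"
      by (intro blinfun_eqI) simp
    then show ?thesis
      by simp
  qed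
qed

end

section \<open>Unitaries and the distance function\<close>

definition re_op :: "('h::complex_hilbert \<Rightarrow>\<^sub>L 'h) \<Rightarrow> ('h \<Rightarrow>\<^sub>L 'h)"
  where "re_op W = (1 / 2) *\<^sub>R (W + adj W)"

lemma adj_re_op [simp]: "W \<in> bounded_ops \<Longrightarrow> adj (re_op W) = re_op W"
  and bounded_ops_re_op [simp]: "W \<in> bounded_ops \<Longrightarrow> re_op W \<in> bounded_ops"
  by (simp_all add: re_op_def add.commute)

lemma sa_between_re_op:
  assumes W: "W \<in> bounded_ops" and "adj W o\<^sub>L W = id_blinfun"
  shows "sa_between (- 1) 1 (re_op W)"
proof -
  have "norm (W x) = norm x" for x
  proof -
    have "cinner (W x) (W x) = cinner ((adj W o\<^sub>L W) x) x"
      using W by (simp add: cinner_adj_left)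
    then have "(norm (W x))\<^sup>2 = (norm x)\<^sup>2"
      unfolding assms(2) cinner_self of_real_eq_iff id_blinfun.rep_eq .
    then show ?thesis
      by simp
  qed
  then have "\<bar>Re (cinner (W x) x)\<bar> \<le> (norm x)\<^sup>2" for x
    using abs_Re_le_cmod[of "cinner (W x) x"] cmod_cinner_le[of "W x" x]
    by (simp add: power2_eq_square)
  moreover have "Re (cinner (re_op W x) x) = Re (cinner (W x) x)" for x
    using W by (simp add: re_op_def blinfun.add_left cinner.add_left blinfun.scaleR_left
        cinner.scaleR_left cinner_adj_left Re_cinner_commute)
  ultimately show ?thesis
    using W by (simp add: sa_between_def abs_le_iff minus_le_iff)
qed

definition re_tr :: "(('h::complex_hilbert \<Rightarrow>\<^sub>L 'h) \<Rightarrow> complex) \<Rightarrow> (real \<Rightarrow> real) \<Rightarrow> ('h \<Rightarrow>\<^sub>L 'h) \<Rightarrow> real"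
  where "re_tr \<tau> f W = Re (\<tau> (cfc f (re_op W)))"

text \<open>\<open>\<parallel>U - V\<parallel>\<^sub>p\<^sup>p = \<tau> (f (Re (U\<^sup>* V)))\<close> for \<open>f = dist_fun p\<close>.\<close>

definition dist_fun :: "real \<Rightarrow> real \<Rightarrow> real"
  where "dist_fun p t = (2 - 2 * t) powr (p / 2)"

lemma continuous_on_dist_fun: "0 < p \<Longrightarrow> S \<subseteq> {- 1..1} \<Longrightarrow> continuous_on S (dist_fun p)"
  unfolding dist_fun_def by (intro continuous_on_powr' continuous_intros) auto

context finite_factor_pair
begin

lemma unitaryD:
  assumes "U \<in> unitary_group N"
  shows "U \<in> N" "adj U o\<^sub>L U = id_blinfun" "U o\<^sub>L adj U = id_blinfun"
  using assms by (auto simp: unitary_group_def)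

lemma unitary_id [simp]: "id_blinfun \<in> unitary_group N"
  by (simp add: unitary_group_def)

lemma unitary_oL [simp]:
  assumes "U \<in> unitary_group N" "V \<in> unitary_group N"
  shows "U o\<^sub>L V \<in> unitary_group N"
proof -
  note U = unitaryD[OF assms(1)] and V = unitaryD[OF assms(2)]
  have "adj U o\<^sub>L (U o\<^sub>L V) = V" "V o\<^sub>L (adj V o\<^sub>L adj U) = adj U"
    by (simp_all add: U V flip: oL_assoc)
  then show ?thesis
    using U V by (simp add: unitary_group_def oL_assoc)
qed

lemma unitary_adj [simp]: "U \<in> unitary_group N \<Longrightarrow> adj U \<in> unitary_group N"
  by (simp add: unitary_group_def)

lemma unitary_scaleC [simp]:
  "U \<in> unitary_group N \<Longrightarrow> cmod c = 1 \<Longrightarrow> op_scaleC c U \<in> unitary_group N"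
  by (auto simp: unitary_group_def mult.commute[of "cnj c"] simp flip: complex_norm_square)

lemma unitary_minus [simp]: "U \<in> unitary_group N \<Longrightarrow> - U \<in> unitary_group N"
  using unitary_scaleC[of U "-1"] by simp

lemma re_op_mem [simp]: "W \<in> N \<Longrightarrow> re_op W \<in> N"
  by (simp add: re_op_def)

lemma sa_between_re_op_unitary: "W \<in> unitary_group N \<Longrightarrow> sa_between (- 1) 1 (re_op W)"
  by (intro sa_between_re_op) (auto dest: unitaryD)

lemma re_tr_nonneg:
  assumes "W \<in> unitary_group N" "continuous_on {- 1..1} f" "\<And>t. t \<in> {- 1..1} \<Longrightarrow> 0 \<le> f t"
  shows "0 \<le> re_tr \<tau> f W"
proof -
  have "f ` {- 1..1} \<noteq> {}" "bdd_above (f ` {- 1..1})"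
    using compact_continuous_image[OF assms(2)]
    by (auto intro: bounded_imp_bdd_above compact_imp_bounded)
  then have "sa_between 0 (Sup (f ` {- 1..1})) (cfc f (re_op W))"
    using assms by (intro sa_between_cfc[OF sa_between_re_op_unitary]) (auto intro: cSup_upper)
  then show ?thesis
    unfolding re_tr_def
    by (intro tr_sa_ge cfc_mem[OF _ sa_between_re_op_unitary] assms) (use assms(1) unitaryD in auto)
qed

text \<open>Unitarity gives \<open>\<bar>U - V\<bar>\<^sup>2 = 2 - 2 * H\<close>, and both the
  square root and the \<open>p\<close>-th power are then functions of \<open>H\<close>, so
  \<open>cfc_cfc\<close> merges them into one.\<close>

lemma Lp_norm_diff:
  assumes U: "U \<in> unitary_group N" and V: "V \<in> unitary_group N" and "0 < p"
  shows "Lp_norm \<tau> p (U - V) = re_tr \<tau> (dist_fun p) (adj U o\<^sub>L V) powr (1 / p)"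
proof -
  note U' = unitaryD[OF U] and V' = unitaryD[OF V]
  define H where "H = re_op (adj U o\<^sub>L V)"
  have H: "sa_between (- 1) 1 H"
    unfolding H_def using U V by (intro sa_between_re_op_unitary) simp
  have c1: "continuous_on {- 1..1} (\<lambda>t::real. 2 - 2 * t)"
    by (intro continuous_intros)
  have "adj (U - V) o\<^sub>L (U - V) = 2 *\<^sub>R id_blinfun - 2 *\<^sub>R H"
    using U' V' by (simp add: H_def re_op_def oL_distribs scaleR_2 algebra_simps)
  also have "\<dots> = cfc (\<lambda>t. 2 - 2 * t) H"
    using cfc_diff[OF H continuous_on_const, of "\<lambda>t. 2 * t" 2] cfc_cmult[OF H, of "\<lambda>t. t" 2]
    by (simp add: cfc_const[OF H] cfc_ident[OF H] continuous_on_id continuous_on_mult_left)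
  finally have "abs_op (U - V) = cfc sqrt (cfc (\<lambda>t. 2 - 2 * t) H)"
    by (simp add: abs_op_def)
  also have "\<dots> = cfc (\<lambda>t. sqrt (2 - 2 * t)) H"
    by (rule cfc_cfc[OF H c1, of 0 4]) (auto intro!: continuous_intros)
  finally have 1: "abs_op (U - V) = cfc (\<lambda>t. sqrt (2 - 2 * t)) H" .
  have c2: "continuous_on {- 1..1} (\<lambda>t::real. sqrt (2 - 2 * t))"
    by (intro continuous_intros)
  have "cfc (\<lambda>t. t powr p) (abs_op (U - V)) = cfc (\<lambda>t. sqrt (2 - 2 * t) powr p) H"
    unfolding 1
  proof (rule cfc_cfc[OF H c2])
    show "0 \<le> sqrt (2 - 2 * t) \<and> sqrt (2 - 2 * t) \<le> sqrt 4" if "t \<in> {- 1..1}" for t :: real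
      using that by (intro conjI real_sqrt_le_mono real_sqrt_ge_zero) auto
    show "continuous_on {0..sqrt 4} (\<lambda>t. t powr p)"
      using \<open>0 < p\<close> by (intro continuous_on_powr' continuous_intros) auto
  qed
  also have "\<dots> = cfc (dist_fun p) H"
  proof (rule cfc_cong[OF H])
    show "continuous_on {- 1..1} (\<lambda>t::real. sqrt (2 - 2 * t) powr p)"
      using \<open>0 < p\<close> by (intro continuous_on_powr' continuous_intros) auto
    show "sqrt (2 - 2 * t) powr p = dist_fun p t" if "t \<in> {- 1..1}" for t
      using that by (simp add: dist_fun_def powr_half_sqrt[symmetric] powr_powr)
  qed
  finally show ?thesis
    by (simp add: Lp_norm_def re_tr_def H_def)
qed

end

section \<open>Inequalities for powers\<close>

text \<open>\<open>m\<close> is the mean of \<open>x\<close> and 1 with weights \<open>r\<close> and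
  \<open>1 - r\<close>; the bound \<open>ln y \<le> y - 1\<close> at \<open>x / m\<close> and
  \<open>1 / m\<close>, with these weights, gives the inequality. Equality forces equality in the
  logarithmic bound at \<open>1 / m\<close>, hence \<open>m = 1\<close>.\<close>

lemma bernoulli_powr_less_1:
  fixes x r :: real
  assumes "0 < r" "r < 1" "0 \<le> x"
  shows "x powr r \<le> 1 + r * (x - 1)" "x powr r = 1 + r * (x - 1) \<Longrightarrow> x = 1"
proof -
  have "x powr r \<le> 1 + r * (x - 1) \<and> (x powr r = 1 + r * (x - 1) \<longrightarrow> x = 1)"
  proof (cases "x = 0")
    case True
    then show ?thesis
      using assms by simp
  next
    case False
    then have x: "0 < x"
      using assms by simp
    define m where "m = 1 + r * (x - 1)"
    have m: "0 < m"
    proof -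
      have "m = (1 - r) + r * x"
        by (simp add: m_def algebra_simps)
      then show ?thesis
        using assms x by (simp add: add_pos_pos)
    qed
    have 1: "ln (x / m) \<le> x / m - 1" and 2: "ln (1 / m) \<le> 1 / m - 1"
      using x m by (intro ln_le_minus_one; simp)+
    have sum: "r * (x / m - 1) + (1 - r) * (1 / m - 1) = 0"
      using m by (simp add: m_def field_simps)
    have lns: "r * ln (x / m) + (1 - r) * ln (1 / m) = r * ln x - ln m"
      using x m by (simp add: ln_div algebra_simps)
    have le1: "r * ln (x / m) \<le> r * (x / m - 1)" and le2: "(1 - r) * ln (1 / m) \<le> (1 - r) * (1 / m - 1)"
      using 1 2 assms by (simp_all add: mult_left_mono)
    then have le: "r * ln x \<le> ln m"
      using sum lns by linarith
    have eq: "x = 1" if "r * ln x = ln m"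
    proof -
      have "(1 - r) * ln (1 / m) = (1 - r) * (1 / m - 1)"
        using that le1 le2 sum lns by linarith
      then have "1 / m = 1"
        using assms m by (intro ln_eq_minus_one) auto
      then have "r * (x - 1) = 0"
        by (simp add: m_def)
      then show ?thesis
        using assms by simp
    qed
    have "x powr r = exp (r * ln x)"
      using x by (simp add: powr_def)
    moreover have "m = exp (ln m)"
      using m by simp
    ultimately show ?thesis
      using le eq by (metis exp_le_cancel_iff exp_inj_iff m_def)
  qed
  then show "x powr r \<le> 1 + r * (x - 1)" "x powr r = 1 + r * (x - 1) \<Longrightarrow> x = 1"
    by auto
qed

text \<open>The concave case for the inverse exponent: \<open>x\<close> is the value at
  \<open>m\<close> of the tangent line of \<open>y \<mapsto> y powr (1 / r)\<close> at 1. Raising to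
  the power \<open>r\<close> gives the claim when \<open>m > 0\<close>.\<close>

lemma bernoulli_powr_greater_1:
  fixes x r :: real
  assumes "1 < r" "0 \<le> x"
  shows "1 + r * (x - 1) \<le> x powr r" "x powr r = 1 + r * (x - 1) \<Longrightarrow> x = 1"
proof -
  define m where "m = 1 + r * (x - 1)"
  have "m \<le> x powr r \<and> (x powr r = m \<longrightarrow> x = 1)"
  proof (cases "m \<le> 0")
    case True
    have "x powr r \<noteq> m"
    proof
      assume "x powr r = m"
      then have "m = 0"
        using True powr_ge_zero[of x r] by linarith
      then have "x = 0"
        using \<open>x powr r = m\<close> by simp
      then show False
        using \<open>m = 0\<close> assms by (simp add: m_def)
    qed
    then show ?thesis
      using True powr_ge_zero[of x r] by linarith
  next
    case False
    have x: "x = 1 + (1 / r) * (m - 1)"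
      using assms by (simp add: m_def field_simps)
    have r: "0 < 1 / r" "1 / r < 1"
      using assms by auto
    have m: "m = (m powr (1 / r)) powr r"
      using False assms by (simp add: powr_powr)
    have "m powr (1 / r) \<le> x"
      unfolding x using False by (intro bernoulli_powr_less_1 r) simp
    then have "m \<le> x powr r"
      by (subst m, intro powr_mono2) (use assms in auto)
    moreover have "x = 1" if "x powr r = m"
    proof -
      have "x = (x powr r) powr (1 / r)"
        using assms by (simp add: powr_powr)
      then have "m powr (1 / r) = 1 + (1 / r) * (m - 1)"
        using that x by simp
      then have "m = 1"
        using False by (intro bernoulli_powr_less_1(2)[OF r]) auto
      then show ?thesis
        using x by simp
    qed
    ultimately show ?thesis
      by blast
  qed
  then show "1 + r * (x - 1) \<le> x powr r" "x powr r = 1 + r * (x - 1) \<Longrightarrow> x = 1"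
    by (auto simp: m_def)
qed

text \<open>Jensen's inequality for the points \<open>u / a\<close> and
  \<open>(1 - u) / (1 - a)\<close> with weights \<open>a\<close> and \<open>1 - a\<close>, whose
  mean is 1; \<open>h\<close> is the deviation of the power from its tangent at 1. The sign
  \<open>s\<close> treats concave and convex exponents together.\<close>

lemma powr_mean_strict:
  fixes r a :: real
  assumes r: "0 < r" "r \<noteq> 1" and a: "0 < a" "a < 1"
  shows "\<exists>s. s \<noteq> 0 \<and> (\<forall>u\<in>{0..1}.
    0 \<le> s * (1 - (a powr (1 - r) * u powr r + (1 - a) powr (1 - r) * (1 - u) powr r)) \<and>
    (a powr (1 - r) * u powr r + (1 - a) powr (1 - r) * (1 - u) powr r = 1 \<longrightarrow> u = a))"
proof -
  define h where "h x = x powr r - (1 + r * (x - 1))" for x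
  define s :: real where "s = (if r < 1 then 1 else - 1)"
  have h: "s * h x \<le> 0 \<and> (h x = 0 \<longrightarrow> x = 1)" if "0 \<le> x" for x
  proof (cases "r < 1")
    case True
    from bernoulli_powr_less_1[OF r(1) this that] show ?thesis
      using True by (auto simp: h_def s_def)
  next
    case False
    with r have "1 < r"
      by simp
    from bernoulli_powr_greater_1[OF this that] show ?thesis
      using False by (auto simp: h_def s_def)
  qed
  have scale: "b powr (1 - r) * v powr r = b * (v / b) powr r" if "0 < b" "0 \<le> v" for b v :: real
    using that by (simp add: powr_divide powr_diff)
  have k: "a powr (1 - r) * u powr r + (1 - a) powr (1 - r) * (1 - u) powr r - 1
      = a * h (u / a) + (1 - a) * h ((1 - u) / (1 - a))" if "u \<in> {0..1}" for u
  proof -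
    have gen: "a * (X - (1 + r * (y - 1))) + (1 - a) * (Z - (1 + r * (z - 1)))
        = a * X + (1 - a) * Z - 1 - r * (a * y + (1 - a) * z - 1)" for X Z y z
      by (simp add: algebra_simps)
    have "a * (u / a) + (1 - a) * ((1 - u) / (1 - a)) - 1 = 0"
      using a by simp
    moreover have "a powr (1 - r) * u powr r = a * (u / a) powr r"
      "(1 - a) powr (1 - r) * (1 - u) powr r = (1 - a) * ((1 - u) / (1 - a)) powr r"
      using that a by (auto intro: scale)
    ultimately show ?thesis
      unfolding h_def gen by simp
  qed
  show ?thesis
  proof (intro exI[of _ s] conjI ballI impI)
    fix u :: real assume u: "u \<in> {0..1}"
    then have nn: "0 \<le> u / a" "0 \<le> (1 - u) / (1 - a)"
      using a by auto
    have 1: "a * (s * h (u / a)) \<le> 0" "(1 - a) * (s * h ((1 - u) / (1 - a))) \<le> 0"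
      using h[OF nn(1)] h[OF nn(2)] a by (auto intro: mult_nonneg_nonpos)
    moreover have "s * (1 - (a powr (1 - r) * u powr r + (1 - a) powr (1 - r) * (1 - u) powr r))
        = - (a * (s * h (u / a)) + (1 - a) * (s * h ((1 - u) / (1 - a))))"
    proof -
      have "s * (1 - K) = - (a * (s * x) + (1 - a) * (s * y))" if "K - 1 = a * x + (1 - a) * y" for K x y
      proof -
        have "s * (1 - K) = - (s * (K - 1))"
          by (simp add: algebra_simps)
        then show ?thesis
          unfolding that by (simp add: algebra_simps)
      qed
      from this[OF k[OF u]] show ?thesis .
    qed
    ultimately show
      "0 \<le> s * (1 - (a powr (1 - r) * u powr r + (1 - a) powr (1 - r) * (1 - u) powr r))"
      by linarith
    assume "a powr (1 - r) * u powr r + (1 - a) powr (1 - r) * (1 - u) powr r = 1"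
    then have "a * h (u / a) + (1 - a) * h ((1 - u) / (1 - a)) = 0"
      using k[OF u] by simp
    then have "s * (a * h (u / a) + (1 - a) * h ((1 - u) / (1 - a))) = 0"
      by simp
    then have "a * (s * h (u / a)) + (1 - a) * (s * h ((1 - u) / (1 - a))) = 0"
      by (simp only: distrib_left mult.left_commute)
    then have "a * (s * h (u / a)) = 0"
      using 1 by linarith
    then have "h (u / a) = 0"
      using a by (auto simp: s_def split: if_splits)
    then show "u = a"
      using h[OF nn(1)] a by simp
  qed (simp add: s_def)
qed

text \<open>Strictly inside the interval \<open>u powr r\<close> lies on one side of
  \<open>u\<close>, and \<open>(1 - u) powr r\<close> on the same side of \<open>1 - u\<close>; the
  side depends on whether \<open>r < 1\<close> and is recorded in \<open>s\<close>.\<close>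

lemma powr_add_complement_strict:
  fixes r :: real
  assumes r: "0 < r" "r \<noteq> 1"
  shows "\<exists>s. s \<noteq> 0 \<and> (\<forall>u\<in>{0..1}. 0 \<le> s * (1 - (u powr r + (1 - u) powr r)) \<and>
    (u powr r + (1 - u) powr r = 1 \<longleftrightarrow> u = 0 \<or> u = 1))"
proof -
  define s :: real where "s = (if r < 1 then - 1 else 1)"
  have lt: "0 < s * (u - u powr r)" if "0 < u" "u < 1" for u
  proof (cases "r < 1")
    case True
    then have "u powr 1 < u powr r"
      using that by (intro powr_less_mono') auto
    then show ?thesis
      using True that by (simp add: s_def)
  next
    case False
    then have "u powr r < u powr 1"
      using that r by (intro powr_less_mono') auto
    then show ?thesis
      using False that by (simp add: s_def)
  qed
  show ?thesis
  proof (intro exI[of _ s] conjI ballI)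
    fix u :: real assume u: "u \<in> {0..1}"
    show "0 \<le> s * (1 - (u powr r + (1 - u) powr r))"
      "u powr r + (1 - u) powr r = 1 \<longleftrightarrow> u = 0 \<or> u = 1"
    proof -
      consider "u = 0" | "u = 1" | "0 < u" "u < 1"
        using u by force
      then have "0 \<le> s * (1 - (u powr r + (1 - u) powr r)) \<and>
        (u powr r + (1 - u) powr r = 1 \<longleftrightarrow> u = 0 \<or> u = 1)"
      proof cases
        case 3
        have "s * (1 - (u powr r + (1 - u) powr r))
            = s * (u - u powr r) + s * ((1 - u) - (1 - u) powr r)"
          by (simp add: algebra_simps)
        then have "0 < s * (1 - (u powr r + (1 - u) powr r))"
          using lt[of u] lt[of "1 - u"] 3 by simp
        then show ?thesis
          using 3 by auto
      qed simp_all
      then show "0 \<le> s * (1 - (u powr r + (1 - u) powr r))"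
        "u powr r + (1 - u) powr r = 1 \<longleftrightarrow> u = 0 \<or> u = 1"
        by auto
    qed
  qed (simp add: s_def)
qed

text \<open>In the coordinate \<open>u = (1 - t) / 2\<close> passing to the antipode is
  \<open>u \<mapsto> 1 - u\<close>. The factor \<open>4 powr (p / 2)\<close> is the
  \<open>p\<close>-th power of 2, the distance between antipodes.\<close>

lemma dist_fun_eq:
  assumes "t \<in> {- 1..1}"
  shows "dist_fun p t = 4 powr (p / 2) * ((1 - t) / 2) powr (p / 2)"
    "dist_fun p (- t) = 4 powr (p / 2) * (1 - (1 - t) / 2) powr (p / 2)"
proof -
  have "dist_fun p t = (4 * ((1 - t) / 2)) powr (p / 2)"
    unfolding dist_fun_def by (rule arg_cong[where f = "\<lambda>x. x powr (p / 2)"]) (simp add: field_simps)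
  then show "dist_fun p t = 4 powr (p / 2) * ((1 - t) / 2) powr (p / 2)"
    by (simp only: powr_mult)
  have "dist_fun p (- t) = (4 * (1 - (1 - t) / 2)) powr (p / 2)"
    unfolding dist_fun_def by (rule arg_cong[where f = "\<lambda>x. x powr (p / 2)"]) (simp add: field_simps)
  then show "dist_fun p (- t) = 4 powr (p / 2) * (1 - (1 - t) / 2) powr (p / 2)"
    by (simp only: powr_mult)
qed

text \<open>A quantitative form of monotonicity. Summed over points of the circle with
  \<open>x\<close> the cosine, it keeps the first Fourier coefficient of the distance function away
  from 0.\<close>

lemma dist_fun_decrease:
  assumes "0 < p"
  shows "\<exists>\<kappa>>0. \<forall>x\<in>{- 1..1}. x * dist_fun p x \<le> x * dist_fun p 0 - \<kappa> * x\<^sup>2"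
proof -
  define r where "r = p / 2"
  \<comment> \<open>For \<open>r < 1\<close> and \<open>y > 0\<close> the tangent slope
    \<open>r\<close> at 1 is too large for a lower bound on \<open>(1 + y) powr r\<close>; half of
    it works on \<open>[0, 1]\<close>. For \<open>r \<ge> 1\<close> the comparison is with exponent
    1, hence the cap 1.\<close>
  define k where "k = min (r / 2) 1"
  have r: "0 < r" and k: "0 < k" "k \<le> r / 2" "k \<le> 1"
    using assms by (auto simp: r_def k_def)
  have down: "(1 - x) powr r \<le> 1 - k * x" if "0 \<le> x" "x \<le> 1" for x
  proof (cases "r < 1")
    case True
    then have "(1 - x) powr r \<le> 1 + r * ((1 - x) - 1)"
      using that r by (intro bernoulli_powr_less_1) auto
    moreover have "k * x \<le> r * x"
      using that k r by (intro mult_right_mono) auto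
    ultimately show ?thesis
      by simp
  next
    case False
    then have "(1 - x) powr r \<le> (1 - x) powr 1"
      using that by (intro powr_mono') auto
    also have "\<dots> = 1 - x"
      using that by simp
    also have "\<dots> \<le> 1 - k * x"
      using that k mult_right_mono[of k 1 x] by simp
    finally show ?thesis .
  qed
  have up: "1 + k * y \<le> (1 + y) powr r" if "0 \<le> y" "y \<le> 1" for y
  proof (cases "r < 1")
    case True
    \<comment> \<open>Multiplying by the complementary power reduces the lower bound for exponent
      \<open>r\<close> to an upper bound for exponent \<open>1 - r\<close>, which Bernoulli's
      inequality supplies.\<close>
    have "(1 + k * y) * (1 + y) powr (1 - r) \<le> (1 + (r / 2) * y) * (1 + (1 - r) * ((1 + y) - 1))"
      using that k r True
      by (intro mult_mono bernoulli_powr_less_1 add_left_mono mult_right_mono) auto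
    also have "\<dots> = 1 + y - (r / 2) * y * (1 - (1 - r) * y)"
      by (simp add: field_simps power2_eq_square)
    also have "\<dots> \<le> 1 + y"
    proof -
      have "(1 - r) * y \<le> 1 * 1"
        using that True r by (intro mult_mono) auto
      then show ?thesis
        using that r by simp
    qed
    also have "\<dots> = (1 + y) powr r * (1 + y) powr (1 - r)"
      using that by (simp flip: powr_add)
    finally show ?thesis
      using that by (simp add: mult_le_cancel_right)
  next
    case False
    have "1 + k * y \<le> 1 + y"
      using that k mult_right_mono[of k 1 y] by simp
    also have "\<dots> = (1 + y) powr 1"
      using that by simp
    also have "\<dots> \<le> (1 + y) powr r"
      using that False by (intro powr_mono) auto
    finally show ?thesis .
  qed
  have F: "dist_fun p x = 2 powr r * (1 - x) powr r" if "x \<in> {- 1..1}" for x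
  proof -
    have "dist_fun p x = (2 * (1 - x)) powr r"
      by (simp add: dist_fun_def r_def)
    also have "\<dots> = 2 powr r * (1 - x) powr r"
      using that by (intro powr_mult)
    finally show ?thesis .
  qed
  have main: "x * (1 - x) powr r \<le> x - k * x\<^sup>2" if "x \<in> {- 1..1}" for x
  proof (cases "0 \<le> x")
    case True
    then have "x * (1 - x) powr r \<le> x * (1 - k * x)"
      using that by (intro mult_left_mono down) auto
    then show ?thesis
      by (simp add: algebra_simps power2_eq_square)
  next
    case False
    then have "(- x) * (1 + k * (- x)) \<le> (- x) * (1 + (- x)) powr r"
      using that by (intro mult_left_mono up) auto
    then show ?thesis
      by (simp add: algebra_simps power2_eq_square)
  qed
  show ?thesis
  proof (intro exI[of _ "2 powr r * k"] conjI ballI)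
    fix x :: real assume x: "x \<in> {- 1..1}"
    have "2 powr r * (x * (1 - x) powr r) \<le> 2 powr r * (x - k * x\<^sup>2)"
      using main[OF x] by (intro mult_left_mono) auto
    then show "x * dist_fun p x \<le> x * dist_fun p 0 - 2 powr r * k * x\<^sup>2"
      using x by (simp add: F algebra_simps)
  qed (use k in simp)
qed

section \<open>Relations between unitaries that the distance detects\<close>

lemma re_op_minus [simp]: "W \<in> bounded_ops \<Longrightarrow> re_op (- W) = - re_op W"
  by (simp add: re_op_def scaleR_right_distrib scaleR_diff_right)

lemma re_op_adj [simp]: "W \<in> bounded_ops \<Longrightarrow> re_op (adj W) = re_op W"
  by (simp add: re_op_def add.commute)

lemma adj_mult_eq_0:
  assumes "A \<in> bounded_ops" "adj A o\<^sub>L A = 0"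
  shows "A = 0"
proof -
  have "cinner (A x) (A x) = cinner ((adj A o\<^sub>L A) x) x" for x
    using assms(1) by (simp add: cinner_adj_left)
  then have "A x = 0" for x
    by (simp add: assms(2) cinner.zero_left cinner_eq_zero_iff)
  then show ?thesis
    by (intro blinfun_eqI) simp
qed

lemma sa_between_scalar: "sa_between c c (c *\<^sub>R id_blinfun)"
  by (simp add: sa_between_def blinfun.scaleR_left cinner.scaleR_left cinner_self)

text \<open>The enclosing interval is a single point, on which every \<open>f\<close> is
  continuous.\<close>

lemma cfc_scalar: "cfc f (c *\<^sub>R id_blinfun) = f c *\<^sub>R id_blinfun"
  using cfc_cong[OF sa_between_scalar, of c f "\<lambda>t. f c"]
  by (simp add: continuous_on_sing cfc_const[OF sa_between_scalar])

context finite_factor_pair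
begin

lemma scalar_eq_iff [simp]: "op_scaleC c (id_blinfun :: 'h \<Rightarrow>\<^sub>L 'h) = op_scaleC d id_blinfun \<longleftrightarrow> c = d"
proof
  assume "op_scaleC c (id_blinfun :: 'h \<Rightarrow>\<^sub>L 'h) = op_scaleC d id_blinfun"
  from arg_cong[OF this, of \<tau>] show "c = d"
    by simp
qed simp

lemma re_tr_scalar: "re_op W = c *\<^sub>R id_blinfun \<Longrightarrow> re_tr \<tau> f W = f c"
  by (simp add: re_tr_def cfc_scalar)

lemma re_tr_uminus:
  assumes W: "W \<in> unitary_group N" and f: "continuous_on {- 1..1} f"
  shows "re_tr \<tau> f (- W) = re_tr \<tau> (\<lambda>t. f (- t)) W"
proof -
  note H = sa_between_re_op_unitary[OF W]
  have c: "continuous_on {- 1..1} (\<lambda>t::real. - t)"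
    by (intro continuous_intros)
  have "cfc (\<lambda>t. - t) (re_op W) = - re_op W"
    using cfc_cmult[OF H continuous_on_id, of "- 1"] cfc_ident[OF H] by simp
  then have "cfc f (re_op (- W)) = cfc f (cfc (\<lambda>t. - t) (re_op W))"
    using unitaryD(1)[OF W] by simp
  also have "\<dots> = cfc (\<lambda>t. f (- t)) (re_op W)"
    by (rule cfc_cfc[OF H c _ f]) auto
  finally show ?thesis
    by (simp add: re_tr_def)
qed

text \<open>The common shape of the test functions below: a weighted sum of two distance functions,
  normalized by \<open>d\<close>, compared with 1 and multiplied by a sign.\<close>

lemma re_tr_combination:
  assumes W: "W \<in> unitary_group N" and f: "continuous_on {- 1..1} f" and g: "continuous_on {- 1..1} g"
  shows "re_tr \<tau> (\<lambda>t. s * (1 - (a * f t + b * g t) / d)) W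
    = s * (1 - (a * re_tr \<tau> f W + b * re_tr \<tau> g W) / d)"
proof -
  note H = sa_between_re_op_unitary[OF W] and W' = unitaryD(1)[OF W]
  define \<alpha> \<beta> where "\<alpha> = - (s * a / d)" and "\<beta> = - (s * b / d)"
  have c: "continuous_on {- 1..1} (\<lambda>t. \<alpha> * f t)" "continuous_on {- 1..1} (\<lambda>t. \<beta> * g t)"
    by (intro continuous_intros f g)+
  have c2: "continuous_on {- 1..1} (\<lambda>t. \<alpha> * f t + \<beta> * g t)"
    by (intro continuous_intros f g)
  have eq: "s * (1 - (a * x + b * y) / d) = s + (\<alpha> * x + \<beta> * y)" for x y
    by (simp add: \<alpha>_def \<beta>_def algebra_simps add_divide_distrib)
  have "cfc (\<lambda>t. s + (\<alpha> * f t + \<beta> * g t)) (re_op W)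
      = s *\<^sub>R id_blinfun + (\<alpha> *\<^sub>R cfc f (re_op W) + \<beta> *\<^sub>R cfc g (re_op W))"
    by (simp add: cfc_add[OF H continuous_on_const c2] cfc_add[OF H c] cfc_const[OF H]
        cfc_cmult[OF H f] cfc_cmult[OF H g])
  then show ?thesis
    using cfc_mem[OF re_op_mem[OF W'] H f] cfc_mem[OF re_op_mem[OF W'] H g]
    unfolding re_tr_def eq by simp
qed

lemma re_tr_eq_0D:
  assumes W: "W \<in> unitary_group N" and f: "continuous_on {- 1..1} f"
    and "\<And>t. t \<in> {- 1..1} \<Longrightarrow> 0 \<le> f t" and "re_tr \<tau> f W = 0"
  shows "cfc f (re_op W) = 0"
proof (rule tr_faithful)
  note H = sa_between_re_op_unitary[OF W]
  show "cfc f (re_op W) \<in> N" "adj (cfc f (re_op W)) = cfc f (re_op W)"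
    using unitaryD(1)[OF W] by (auto intro: cfc_mem[OF _ H f] adj_cfc[OF H f])
  show "0 \<le> Re (cinner (cfc f (re_op W) x) x)" for x
    by (rule cfc_nonneg[OF H f assms(3)])
qed (use assms(4) in \<open>simp add: re_tr_def\<close>)

lemma continuous_on_dist_fun_uminus: "0 < p \<Longrightarrow> continuous_on {- 1..1} (\<lambda>t. dist_fun p (- t))"
  by (rule continuous_on_compose2[OF continuous_on_dist_fun[of p "{- 1..1}"]])
    (auto intro!: continuous_intros)

text \<open>\<open>dist_fun p\<close> attains its maximum \<open>4 powr (p / 2)\<close> on
  \<open>[-1, 1]\<close> only at \<open>t = - 1\<close>, so equality of the traces forces
  \<open>H = - 1\<close>. Then \<open>adj (W + 1) o\<^sub>L (W + 1) = 2 + 2 * H\<close>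
  vanishes.\<close>

lemma dist_eq_diameter_iff:
  assumes W: "W \<in> unitary_group N" and p: "0 < p"
  shows "re_tr \<tau> (dist_fun p) W = 4 powr (p / 2) \<longleftrightarrow> W = - id_blinfun"
proof
  note H = sa_between_re_op_unitary[OF W] and W' = unitaryD[OF W]
  note F = continuous_on_dist_fun[OF p order_refl]
  \<comment> \<open>The copy with weight 0 brings the test function into the form of
    \<open>re_tr_combination\<close>.\<close>
  let ?f = "\<lambda>t. 1 * (1 - (1 * dist_fun p t + 0 * dist_fun p t) / 4 powr (p / 2))"
  assume "re_tr \<tau> (dist_fun p) W = 4 powr (p / 2)"
  then have 0: "re_tr \<tau> ?f W = 0"
    by (subst re_tr_combination[OF W F F]) simp
  have f: "continuous_on {- 1..1} ?f"
    by (intro continuous_intros F) simp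
  have key: "0 \<le> ?f t" "?f t = 0 \<Longrightarrow> t - (- 1) = 0" if t: "t \<in> {- 1..1}" for t
  proof -
    have feq: "?f t = 1 - ((1 - t) / 2) powr (p / 2)"
      using dist_fun_eq(1)[OF t, of p] by simp
    have "((1 - t) / 2) powr (p / 2) \<le> 1"
      using t p by (intro powr_le1) auto
    then show "0 \<le> ?f t"
      unfolding feq by simp
    show "t - (- 1) = 0" if "?f t = 0"
    proof (rule ccontr)
      assume "t - (- 1) \<noteq> 0"
      then have "((1 - t) / 2) powr (p / 2) < 1 powr (p / 2)"
        using t p by (intro powr_less_mono2) auto
      with that show False
        unfolding feq by simp
    qed
  qed
  have "cfc ?f (re_op W) = 0"
    using 0 key(1) by (intro re_tr_eq_0D[OF W f])
  with key have "cfc (\<lambda>t. t - (- 1)) (re_op W) = 0"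
    by (rule cfc_eq_0_transfer[OF H f, rotated]) (assumption | intro continuous_intros)+
  then have "re_op W - (- 1) *\<^sub>R id_blinfun = 0"
    using cfc_diff[OF H continuous_on_id continuous_on_const, of "- 1"]
    by (simp add: cfc_const[OF H] cfc_ident[OF H])
  then have "re_op W = - id_blinfun"
    by (simp add: eq_neg_iff_add_eq_0)
  then have "2 *\<^sub>R re_op W = 2 *\<^sub>R (- id_blinfun)"
    by (rule arg_cong)
  moreover have "2 *\<^sub>R re_op W = W + adj W"
    by (simp add: re_op_def)
  moreover have "adj (W + id_blinfun) o\<^sub>L (W + id_blinfun) = (W + adj W) + 2 *\<^sub>R id_blinfun"
    using W' by (simp add: oL_distribs scaleR_2)
  ultimately have "adj (W + id_blinfun) o\<^sub>L (W + id_blinfun) = 0"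
    by (simp only: scaleR_minus_right add.left_inverse)
  then have "W + id_blinfun = 0"
    by (rule adj_mult_eq_0[rotated]) (use W' in simp)
  then show "W = - id_blinfun"
    by (simp add: eq_neg_iff_add_eq_0)
next
  assume "W = - id_blinfun"
  then have "re_op W = (- 1) *\<^sub>R id_blinfun"
    by (simp add: re_op_def flip: scaleR_2)
  then show "re_tr \<tau> (dist_fun p) W = 4 powr (p / 2)"
    by (subst re_tr_scalar[of W "- 1"]) (auto simp: dist_fun_eq)
qed

text \<open>The weights are those of \<open>powr_mean_strict\<close> at
  \<open>a = (1 - c) / 2\<close>, so that \<open>t = c\<close> is the only point of
  \<open>[-1, 1]\<close> where the weighted sum of the two distance functions is extremal. Strict
  bounds on \<open>c\<close> keep \<open>a\<close> inside \<open>(0, 1)\<close>.\<close>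

lemma re_op_scalar_iff:
  assumes W: "W \<in> unitary_group N" and p: "0 < p" "p \<noteq> 2" and c: "- 1 < c" "c < 1"
  shows "re_op W = c *\<^sub>R id_blinfun \<longleftrightarrow>
    ((1 - c) / 2) powr (1 - p / 2) * re_tr \<tau> (dist_fun p) W +
    (1 - (1 - c) / 2) powr (1 - p / 2) * re_tr \<tau> (dist_fun p) (- W) = 4 powr (p / 2)"
proof
  note H = sa_between_re_op_unitary[OF W] and W' = unitaryD[OF W]
  note F = continuous_on_dist_fun[OF p(1) order_refl] and F' = continuous_on_dist_fun_uminus[OF p(1)]
  define a where "a = (1 - c) / 2"
  define r where "r = p / 2"
  have a: "0 < a" "a < 1" and r: "0 < r" "r \<noteq> 1"
    using c p by (auto simp: a_def r_def)
  obtain s where s: "s \<noteq> 0" "\<And>u. u \<in> {0..1} \<Longrightarrow>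
    0 \<le> s * (1 - (a powr (1 - r) * u powr r + (1 - a) powr (1 - r) * (1 - u) powr r)) \<and>
    (a powr (1 - r) * u powr r + (1 - a) powr (1 - r) * (1 - u) powr r = 1 \<longrightarrow> u = a)"
    using powr_mean_strict[OF r a] by metis
  let ?f = "\<lambda>t. s * (1 - (a powr (1 - r) * dist_fun p t
    + (1 - a) powr (1 - r) * dist_fun p (- t)) / 4 powr r)"
  have f: "continuous_on {- 1..1} ?f"
    by (intro continuous_intros F F') simp
  have feq: "?f t = s * (1 - (a powr (1 - r) * ((1 - t) / 2) powr r
      + (1 - a) powr (1 - r) * (1 - (1 - t) / 2) powr r))" if "t \<in> {- 1..1}" for t
  proof -
    have "dist_fun p t / 4 powr r = ((1 - t) / 2) powr r"
      "dist_fun p (- t) / 4 powr r = (1 - (1 - t) / 2) powr r"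
      unfolding r_def dist_fun_eq[OF that] by (rule nonzero_mult_div_cancel_left, simp)+
    then show ?thesis
      by (simp only: add_divide_distrib times_divide_eq_right[symmetric])
  qed
  have key: "0 \<le> ?f t" "?f t = 0 \<Longrightarrow> t - c = 0" if t: "t \<in> {- 1..1}" for t
  proof -
    have "(1 - t) / 2 \<in> {0..1}"
      using t by auto
    note su = s(2)[OF this]
    show "0 \<le> ?f t"
      unfolding feq[OF t] using su by blast
    show "t - c = 0" if "?f t = 0"
    proof -
      have "(1 - t) / 2 = a"
        using su that s(1) unfolding feq[OF t] by simp
      then show ?thesis
        by (simp add: a_def)
    qed
  qed
  {
    assume "a powr (1 - r) * re_tr \<tau> (dist_fun p) W
      + (1 - a) powr (1 - r) * re_tr \<tau> (dist_fun p) (- W) = 4 powr r"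
    then have "re_tr \<tau> ?f W = 0"
      by (subst re_tr_combination[OF W F F']) (simp add: re_tr_uminus[OF W F])
    then have "cfc ?f (re_op W) = 0"
      using key(1) by (intro re_tr_eq_0D[OF W f])
    with key have "cfc (\<lambda>t. t - c) (re_op W) = 0"
      by (rule cfc_eq_0_transfer[OF H f, rotated]) (assumption | intro continuous_intros)+
    then have "re_op W - c *\<^sub>R id_blinfun = 0"
      using cfc_diff[OF H continuous_on_id continuous_on_const, of c]
      by (simp add: cfc_const[OF H] cfc_ident[OF H])
    then show "re_op W = c *\<^sub>R id_blinfun"
      by simp
  next
    assume W_c: "re_op W = c *\<^sub>R id_blinfun"
    then have W_c': "re_op (- W) = (- c) *\<^sub>R id_blinfun"
      using W' by simp
    have c': "c \<in> {- 1..1}"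
      using c by simp
    have "re_tr \<tau> (dist_fun p) W = 4 powr r * a powr r"
      "re_tr \<tau> (dist_fun p) (- W) = 4 powr r * (1 - a) powr r"
      unfolding re_tr_scalar[OF W_c] re_tr_scalar[OF W_c'] a_def r_def
      by (rule dist_fun_eq[OF c'])+
    then have "a powr (1 - r) * re_tr \<tau> (dist_fun p) W + (1 - a) powr (1 - r) * re_tr \<tau> (dist_fun p) (- W)
        = 4 powr r * (a powr (1 - r) * a powr r + (1 - a) powr (1 - r) * (1 - a) powr r)"
      by (simp add: algebra_simps)
    also have "\<dots> = 4 powr r"
      using a by (simp flip: powr_add)
    finally show "a powr (1 - r) * re_tr \<tau> (dist_fun p) W
      + (1 - a) powr (1 - r) * re_tr \<tau> (dist_fun p) (- W) = 4 powr r" .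
  }
qed

text \<open>With equal weights the extremum sits at \<open>t = 1\<close> and \<open>t = - 1\<close>,
  that is, \<open>H\<^sup>2 = 1\<close>. The test function and \<open>1 - t * t\<close> have the
  same zeros and are both nonnegative, so the transfer works in both directions.\<close>

lemma symmetry_iff:
  assumes W: "W \<in> unitary_group N" and p: "0 < p" "p \<noteq> 2"
  shows "adj W = W \<longleftrightarrow>
    re_tr \<tau> (dist_fun p) W + re_tr \<tau> (dist_fun p) (- W) = 4 powr (p / 2)"
proof -
  note H = sa_between_re_op_unitary[OF W] and W' = unitaryD[OF W]
  note F = continuous_on_dist_fun[OF p(1) order_refl] and F' = continuous_on_dist_fun_uminus[OF p(1)]
  define r where "r = p / 2"
  have r: "0 < r" "r \<noteq> 1"
    using p by (auto simp: r_def)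
  obtain s where s: "s \<noteq> 0" "\<And>u. u \<in> {0..1} \<Longrightarrow> 0 \<le> s * (1 - (u powr r + (1 - u) powr r)) \<and>
    (u powr r + (1 - u) powr r = 1 \<longleftrightarrow> u = 0 \<or> u = 1)"
    using powr_add_complement_strict[OF r] by metis
  let ?f = "\<lambda>t. s * (1 - (1 * dist_fun p t + 1 * dist_fun p (- t)) / 4 powr r)"
  have f: "continuous_on {- 1..1} ?f"
    by (intro continuous_intros F F') simp
  have feq: "?f t = s * (1 - (((1 - t) / 2) powr r + (1 - (1 - t) / 2) powr r))"
    if "t \<in> {- 1..1}" for t
  proof -
    have "dist_fun p t / 4 powr r = ((1 - t) / 2) powr r"
      "dist_fun p (- t) / 4 powr r = (1 - (1 - t) / 2) powr r"
      unfolding r_def dist_fun_eq[OF that] by (rule nonzero_mult_div_cancel_left, simp)+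
    then show ?thesis
      by (simp only: add_divide_distrib mult_1_left)
  qed
  have key: "0 \<le> ?f t" "?f t = 0 \<longleftrightarrow> 1 - t * t = 0" if t: "t \<in> {- 1..1}" for t
  proof -
    have "(1 - t) / 2 \<in> {0..1}"
      using t by auto
    note su = s(2)[OF this]
    show "0 \<le> ?f t"
      unfolding feq[OF t] using su by blast
    have "?f t = 0 \<longleftrightarrow> t = 1 \<or> t = - 1"
    proof -
      have "?f t = 0 \<longleftrightarrow> ((1 - t) / 2) powr r + (1 - (1 - t) / 2) powr r = 1"
        unfolding feq[OF t] using s(1) by (simp only: mult_eq_0_iff simp_thms) linarith
      also have "\<dots> \<longleftrightarrow> (1 - t) / 2 = 0 \<or> (1 - t) / 2 = 1"
        using su by blast
      finally show ?thesis
        by auto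
    qed
    also have "\<dots> \<longleftrightarrow> 1 - t * t = 0"
      using power2_eq_1_iff[of t] by (auto simp: power2_eq_square)
    finally show "?f t = 0 \<longleftrightarrow> 1 - t * t = 0" .
  qed
  have g: "continuous_on {- 1..1} (\<lambda>t::real. 1 - t * t)"
    by (intro continuous_intros)
  have g0: "0 \<le> 1 - t * t" if "t \<in> {- 1..1}" for t :: real
    using that abs_le_square_iff[of t 1] by (simp add: power2_eq_square abs_le_iff)
  have c2: "continuous_on {- 1..1} (\<lambda>t::real. t * t)"
    by (intro continuous_intros)
  have cg: "cfc (\<lambda>t. 1 - t * t) (re_op W) = id_blinfun - (re_op W o\<^sub>L re_op W)"
    using cfc_diff[OF H continuous_on_const c2, of 1] cfc_mult[OF H continuous_on_id continuous_on_id]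
    by (simp add: cfc_const[OF H] cfc_ident[OF H])
  have comb: "re_tr \<tau> ?f W
      = s * (1 - (re_tr \<tau> (dist_fun p) W + re_tr \<tau> (dist_fun p) (- W)) / 4 powr r)"
    by (subst re_tr_combination[OF W F F']) (simp add: re_tr_uminus[OF W F])
  show ?thesis
    unfolding r_def[symmetric]
  proof
    assume "re_tr \<tau> (dist_fun p) W + re_tr \<tau> (dist_fun p) (- W) = 4 powr r"
    then have "re_tr \<tau> ?f W = 0"
      by (simp only: comb) simp
    then have "cfc ?f (re_op W) = 0"
      using key(1) by (intro re_tr_eq_0D[OF W f])
    then have "cfc (\<lambda>t. 1 - t * t) (re_op W) = 0"
      using key by (intro cfc_eq_0_transfer[OF H f g]) auto
    then have "id_blinfun = re_op W o\<^sub>L re_op W"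
      by (simp add: cg)
    \<comment> \<open>The coefficient 4 is spelled as a sum so that two copies of the identity can
      be cancelled below.\<close>
    moreover have "(W + adj W) o\<^sub>L (W + adj W) = (1 + 1 + 1 + 1) *\<^sub>R (re_op W o\<^sub>L re_op W)"
      by (simp add: re_op_def oL.scaleR_left oL.scaleR_right)
    ultimately have "(W + adj W) o\<^sub>L (W + adj W) = (1 + 1 + 1 + 1) *\<^sub>R id_blinfun"
      by simp
    moreover have "(W + adj W) o\<^sub>L (W + adj W)
        = (W o\<^sub>L W) + (adj W o\<^sub>L adj W) + (id_blinfun + id_blinfun)"
      using W' by (simp add: oL_distribs)
    ultimately have "(W o\<^sub>L W) + (adj W o\<^sub>L adj W) = id_blinfun + id_blinfun"
      by (simp only: scaleR_add_left scaleR_one add.assoc) (simp flip: add.assoc)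
    moreover have "adj (W - adj W) o\<^sub>L (W - adj W)
        = (id_blinfun + id_blinfun) - ((W o\<^sub>L W) + (adj W o\<^sub>L adj W))"
      using W' by (simp add: oL_distribs)
    ultimately have "adj (W - adj W) o\<^sub>L (W - adj W) = 0"
      by simp
    then have "W - adj W = 0"
      by (rule adj_mult_eq_0[rotated]) (use W' in simp)
    then show "adj W = W"
      by simp
  next
    assume "adj W = W"
    then have "re_op W = W" "W o\<^sub>L W = id_blinfun"
      using W' by (simp_all add: re_op_def flip: scaleR_2)
    then have "cfc (\<lambda>t. 1 - t * t) (re_op W) = 0"
      using cg by simp
    then have "cfc ?f (re_op W) = 0"
      using key g0 by (intro cfc_eq_0_transfer[OF H g f]) auto
    then have "re_tr \<tau> ?f W = 0"
      by (simp add: re_tr_def)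
    then show "re_tr \<tau> (dist_fun p) W + re_tr \<tau> (dist_fun p) (- W) = 4 powr r"
      unfolding comb using s(1) by simp
  qed
qed

text \<open>
  With \<open>e\<close> the spectral projection of \<open>J\<close>, the operator \<open>e + (1 - e) x e\<close> is idempotent. Its range
  projection commutes with \<open>e\<close>, which forces \<open>(1 - e) x e = 0\<close>.
\<close>

lemma skew_unitary_commuting_with_symmetries:
  assumes J: "J \<in> unitary_group N" "adj J = - J"
    and comm: "\<And>S. S \<in> unitary_group N \<Longrightarrow> adj S = S \<Longrightarrow> J o\<^sub>L S = S o\<^sub>L J"
  shows "J = op_scaleC \<i> id_blinfun \<or> J = op_scaleC (- \<i>) id_blinfun"
proof -
  note J' = unitaryD[OF J(1)]
  have JJ: "J o\<^sub>L J = - id_blinfun"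
    using J'(2) J(2) by (simp add: oL_distribs minus_equation_iff)
  define S0 where "S0 = op_scaleC (- \<i>) J"
  have S0: "S0 \<in> N" "adj S0 = S0" "S0 o\<^sub>L S0 = id_blinfun"
    using J' J(2) JJ by (simp_all add: S0_def oL_distribs)
  define e where "e = (1 / 2) *\<^sub>R (id_blinfun + S0)"
  have e: "e \<in> N" and e_adj: "adj e = e"
    using S0 by (simp_all add: e_def)
  have "(id_blinfun + S0) o\<^sub>L (id_blinfun + S0) = 2 *\<^sub>R (id_blinfun + S0)"
    by (simp add: oL_distribs S0 scaleR_2 algebra_simps)
  then have ee: "e o\<^sub>L e = e"
    by (simp add: e_def oL.scaleR_left oL.scaleR_right)
  have commP: "e o\<^sub>L P = P o\<^sub>L e" if P: "P \<in> N" "adj P = P" "P o\<^sub>L P = P" for P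
  proof -
    \<comment> \<open>A projection \<open>P\<close> of \<open>N\<close> yields the symmetry
      \<open>1 - 2 P\<close>, so \<open>J\<close>, and with it \<open>e\<close>, commutes with every
      projection of \<open>N\<close>.\<close>
    define S where "S = id_blinfun - (P + P)"
    have "adj S = S"
      using P by (simp add: S_def)
    moreover have "S o\<^sub>L S = id_blinfun"
      using P by (simp add: S_def oL_distribs)
    ultimately have "S \<in> unitary_group N"
      using P by (simp add: unitary_group_def S_def)
    from comm[OF this \<open>adj S = S\<close>] have "J o\<^sub>L P = P o\<^sub>L J"
      by (simp add: S_def oL_distribs oL.scaleR_left oL.scaleR_right flip: scaleR_2)
    then show ?thesis
      using P J' by (simp add: e_def S0_def oL_distribs oL.scaleR_left oL.scaleR_right)
  qed
  have corner: "x o\<^sub>L e = e o\<^sub>L x o\<^sub>L e" if x: "x \<in> N" for x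
  proof -
    \<comment> \<open>\<open>y = (1 - e) x e\<close> maps the range of \<open>e\<close> into its
      complement and squares to 0, so \<open>e + y\<close> is idempotent; \<open>K\<close> below is
      its range, described as a set of fixed points.\<close>
    define y where "y = (x o\<^sub>L e) - (e o\<^sub>L x o\<^sub>L e)"
    have y: "y \<in> N"
      using x e by (simp add: y_def)
    have ye: "y o\<^sub>L e = y"
      by (simp add: y_def oL_distribs oL_assoc ee)
    have ey: "e o\<^sub>L y = 0"
      using ee by (simp add: y_def oL_distribs flip: oL_assoc)
    have yy: "y o\<^sub>L y = 0"
      by (metis ye ey oL_assoc oL.zero_right)
    have ee_x: "e (e \<zeta>) = e \<zeta>" and ye_x: "y (e \<zeta>) = y \<zeta>" and ey_x: "e (y \<zeta>) = 0"
      and yy_x: "y (y \<zeta>) = 0" for \<zeta>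
      using arg_cong[OF ee, of "\<lambda>T. T \<zeta>"] arg_cong[OF ye, of "\<lambda>T. T \<zeta>"]
        arg_cong[OF ey, of "\<lambda>T. T \<zeta>"] arg_cong[OF yy, of "\<lambda>T. T \<zeta>"] by simp_all
    define K where "K = {\<xi>. e \<xi> + y \<xi> = \<xi>}"
    have "closed K"
      unfolding K_def by (intro closed_Collect_eq continuous_intros)
    moreover have "subspace K"
      by (auto simp: K_def subspace_def blinfun.zero_right blinfun.add_right blinfun.scaleR_right
          algebra_simps simp flip: scaleR_add_right)
    moreover have "c *\<^sub>C \<xi> \<in> K" if "\<xi> \<in> K" for c \<xi>
      using that e y by (simp add: K_def bounded_opsD flip: scaleC_add_right)
    moreover have "blinfun_apply B \<xi> \<in> K" if B: "B \<in> commutant N" and "\<xi> \<in> K" for B \<xi>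
    proof -
      have "e (B \<xi>) = B (e \<xi>)" "y (B \<xi>) = B (y \<xi>)"
        by (metis blinfun_apply_blinfun_compose commute B e y)+
      then show ?thesis
        using \<open>\<xi> \<in> K\<close> by (simp add: K_def flip: blinfun.add_right)
    qed
    ultimately have "\<exists>P\<in>N. adj P = P \<and> (\<forall>x. P x \<in> K) \<and> (\<forall>x\<in>K. P x = x)"
      by (rule projection_mem)
    then obtain P where P: "P \<in> N" "adj P = P" "\<And>x. P x \<in> K" "\<And>x. x \<in> K \<Longrightarrow> P x = x"
      by metis
    have "P o\<^sub>L P = P"
      by (rule blinfun_eqI) (simp add: P)
    from commP[OF P(1,2) this] have eP: "e (P \<zeta>) = P (e \<zeta>)" for \<zeta>
      by (metis blinfun_apply_blinfun_compose)
    have "y \<zeta> = 0" for \<zeta>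
    proof -
      have "e \<zeta> + y \<zeta> \<in> K"
        by (simp add: K_def blinfun.add_right ee_x ye_x ey_x yy_x)
      then have "P (e \<zeta> + y \<zeta>) = e \<zeta> + y \<zeta>"
        by (rule P(4))
      then have "e (e \<zeta> + y \<zeta>) = P (e (e \<zeta> + y \<zeta>))"
        by (metis eP)
      then have "e \<zeta> = P (e \<zeta>)"
        by (simp add: blinfun.add_right ee_x ey_x)
      then have "e \<zeta> \<in> K"
        using P(3)[of "e \<zeta>"] by simp
      then show ?thesis
        by (simp add: K_def ee_x ye_x)
    qed
    then have "y = 0"
      by (intro blinfun_eqI) simp
    then show ?thesis
      by (simp add: y_def)
  qed
  have "e o\<^sub>L x = x o\<^sub>L e" if x: "x \<in> N" for x
  proof -
    \<comment> \<open>The corner identity for \<open>adj x\<close>, after taking adjoints, is the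
      missing half \<open>e x = e x e\<close>.\<close>
    have "adj (adj x o\<^sub>L e) = adj (e o\<^sub>L adj x o\<^sub>L e)"
      using corner[OF adj_mem[OF x]] by simp
    then have "e o\<^sub>L x = e o\<^sub>L (x o\<^sub>L e)"
      using x e e_adj by simp
    also have "\<dots> = x o\<^sub>L e"
      by (rule corner[OF x, unfolded oL_assoc, symmetric])
    finally show ?thesis .
  qed
  then obtain c where c: "e = op_scaleC c id_blinfun"
    using center_scalar[OF e] by blast
  have "op_scaleC \<i> (2 *\<^sub>R e - id_blinfun) = J"
    by (simp add: e_def S0_def)
  moreover have "c = 0 \<or> c = 1"
    using ee unfolding c by simp
  ultimately show ?thesis
    unfolding c by (auto simp: scaleR_2)
qed

end

section \<open>Averaging over roots of unity\<close>

text \<open>The value of the character with frequency \<open>s\<close> at the \<open>k\<close>-th of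
  \<open>n\<close> equally spaced points. Frequencies are integers so that conjugation becomes
  negation.\<close>

definition root_unity :: "nat \<Rightarrow> int \<Rightarrow> nat \<Rightarrow> complex"
  where "root_unity n s k = cis (2 * pi * real_of_int s * real k / real n)"

lemma cmod_root_unity [simp]: "cmod (root_unity n s k) = 1"
  by (simp add: root_unity_def)

lemma cnj_root_unity [simp]: "cnj (root_unity n s k) = root_unity n (- s) k"
  by (simp add: root_unity_def cis_cnj)

lemma root_unity_mult: "root_unity n s k * root_unity n t k = root_unity n (s + t) k"
  by (simp add: root_unity_def cis_mult add_divide_distrib ring_distribs)

text \<open>A geometric sum. The bound on \<open>s\<close> excludes aliasing: a nonzero multiple of
  \<open>n\<close> would also give the sum \<open>n\<close>.\<close>

lemma sum_root_unity:
  assumes "\<bar>s\<bar> < int n"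
  shows "(\<Sum>k<n. root_unity n s k) = (if s = 0 then of_nat n else 0)"
proof (cases "s = 0")
  case False
  have n: "0 < n"
    using assms by auto
  define z where "z = cis (2 * pi * real_of_int s / real n)"
  have pow: "root_unity n s k = z ^ k" for k
    by (simp add: root_unity_def z_def Complex.DeMoivre mult_ac)
  have "z ^ n = cis (2 * pi * real_of_int s)"
    using n by (simp add: z_def Complex.DeMoivre)
  then have "z ^ n = 1"
    by simp
  moreover have "z \<noteq> 1"
  proof
    assume "z = 1"
    then have "cos (2 * pi * real_of_int s / real n) = 1"
      by (simp add: z_def complex_eq_iff)
    then obtain m :: int where "2 * pi * real_of_int s / real n = real_of_int m * 2 * pi"
      using cos_one_2pi_int by blast
    then have "real_of_int s = real_of_int (m * int n)"
      using n by (simp add: field_simps)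
    then have "s = m * int n"
      by (simp only: of_int_eq_iff)
    moreover from this False have "m \<noteq> 0"
      by auto
    then have "1 * int n \<le> \<bar>m\<bar> * int n"
      by (intro mult_right_mono) auto
    ultimately show False
      using assms by (simp add: abs_mult)
  qed
  ultimately show ?thesis
    using False by (simp add: pow sum_gp_strict)
qed (simp add: root_unity_def)

text \<open>
  The Fourier coefficients of powers of the cosine:
  \<open>cos\<^sup>j \<theta> = (\<Sum>s. cos_moment j s * e\<^bsup>is\<theta>\<^esup>)\<close>.
\<close>

fun cos_moment :: "nat \<Rightarrow> int \<Rightarrow> real"
  where "cos_moment 0 s = (if s = 0 then 1 else 0)"
  | "cos_moment (Suc j) s = (cos_moment j (s - 1) + cos_moment j (s + 1)) / 2"

definition unitary_pow :: "('h::complex_hilbert \<Rightarrow>\<^sub>L 'h) \<Rightarrow> int \<Rightarrow> ('h \<Rightarrow>\<^sub>L 'h)"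
  where "unitary_pow W s = (if 0 \<le> s then op_pow W (nat s) else op_pow (adj W) (nat (- s)))"

lemma unitary_pow_simps [simp]: "unitary_pow W 0 = id_blinfun" "unitary_pow W 1 = W"
  using op_pow_Suc[of W 0] by (simp_all add: unitary_pow_def)

lemma
  assumes W: "adj W o\<^sub>L W = id_blinfun" "W o\<^sub>L adj W = id_blinfun"
  shows unitary_pow_oL: "unitary_pow W (s - 1) o\<^sub>L W = unitary_pow W s"
    and unitary_pow_oL_adj: "unitary_pow W (s + 1) o\<^sub>L adj W = unitary_pow W s"
proof -
  show "unitary_pow W (s - 1) o\<^sub>L W = unitary_pow W s"
  proof (cases "0 < s")
    case True
    then have "nat s = Suc (nat (s - 1))"
      by simp
    then show ?thesis
      using True by (simp add: unitary_pow_def op_pow_Suc_right del: op_pow_Suc)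
  next
    case False
    then have "nat (- (s - 1)) = Suc (nat (- s))"
      by simp
    then show ?thesis
      using False by (auto simp: unitary_pow_def op_pow_Suc_right oL_assoc W simp del: op_pow_Suc)
  qed
  show "unitary_pow W (s + 1) o\<^sub>L adj W = unitary_pow W s"
  proof (cases "0 \<le> s")
    case True
    then have "nat (s + 1) = Suc (nat s)"
      by simp
    then show ?thesis
      using True by (simp add: unitary_pow_def op_pow_Suc_right oL_assoc W del: op_pow_Suc)
  next
    case False
    then have "nat (- s) = Suc (nat (- (s + 1)))"
      by simp
    moreover have "unitary_pow W (s + 1) = op_pow (adj W) (nat (- (s + 1)))"
      using False by (cases "s + 1 = 0") (auto simp: unitary_pow_def)
    ultimately show ?thesis
      using False by (simp add: unitary_pow_def op_pow_Suc_right del: op_pow_Suc)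
  qed
qed

lemma op_scaleC_sum_left: "op_scaleC (\<Sum>i\<in>I. c i) A = (\<Sum>i\<in>I. op_scaleC (c i) A)"
  by (induction I rule: infinite_finite_induct) (simp_all add: op_scaleC_add_left)

text \<open>With \<open>w\<close> the root of unity, the \<open>j\<close>-th power of
  \<open>Re (cnj w * W)\<close> is the sum over \<open>s\<close> of \<open>cos_moment j s\<close>
  times \<open>cnj w ^ s * W ^ s\<close>; averaging against \<open>w ^ s\<close> selects one term.
  Each induction step moves \<open>s\<close> by one, which explains the margin \<open>j\<close> in
  the side condition.\<close>

lemma sum_rotated_pow:
  fixes W :: "'h::complex_hilbert \<Rightarrow>\<^sub>L 'h"
  assumes W: "W \<in> bounded_ops" "adj W o\<^sub>L W = id_blinfun" "W o\<^sub>L adj W = id_blinfun"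
    and "\<bar>s\<bar> + int j < int n"
  shows "(\<Sum>k<n. op_scaleC (root_unity n s k) (op_pow (re_op (op_scaleC (root_unity n (- 1) k) W)) j))
    = (real n * cos_moment j s) *\<^sub>R unitary_pow W s"
  using assms(4)
proof (induction j arbitrary: s)
  case 0
  then have "(\<Sum>k<n. op_scaleC (root_unity n s k) (id_blinfun :: 'h \<Rightarrow>\<^sub>L 'h))
      = op_scaleC (if s = 0 then of_nat n else 0) id_blinfun"
    by (simp flip: op_scaleC_sum_left add: sum_root_unity)
  then show ?case
    using op_scaleC_of_real[of "real n" "id_blinfun :: 'h \<Rightarrow>\<^sub>L 'h"] by simp
next
  case (Suc j)
  let ?H = "\<lambda>k. re_op (op_scaleC (root_unity n (- 1) k) W)"
  let ?S = "\<lambda>s. \<Sum>k<n. op_scaleC (root_unity n s k) (op_pow (?H k) j)"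
  \<comment> \<open>Splitting off one factor on the right multiplies by \<open>W\<close> or
    \<open>adj W\<close> and shifts the frequency, as in the recursion of
    \<open>cos_moment\<close>.\<close>
  have step: "op_scaleC (root_unity n s k) (op_pow (?H k) (Suc j))
      = (1 / 2) *\<^sub>R ((op_scaleC (root_unity n (s - 1) k) (op_pow (?H k) j) o\<^sub>L W)
        + (op_scaleC (root_unity n (s + 1) k) (op_pow (?H k) j) o\<^sub>L adj W))" for k
  proof -
    have H: "?H k = (1 / 2) *\<^sub>R (op_scaleC (root_unity n (- 1) k) W + op_scaleC (root_unity n 1 k) (adj W))"
      using W(1) by (simp add: re_op_def)
    have "op_pow (?H k) j \<in> bounded_ops"
      using W(1) by simp
    then have "op_pow (?H k) j o\<^sub>L ?H k = (1 / 2) *\<^sub>R (op_scaleC (root_unity n (- 1) k) (op_pow (?H k) j o\<^sub>L W)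
        + op_scaleC (root_unity n 1 k) (op_pow (?H k) j o\<^sub>L adj W))"
      by (subst (2) H) (simp add: oL.scaleR_right oL_distribs)
    then show ?thesis
      by (simp add: op_pow_Suc_right op_scaleC_scaleR op_scaleC_add_right root_unity_mult del: op_pow_Suc)
  qed
  have "?S (s - 1) = (real n * cos_moment j (s - 1)) *\<^sub>R unitary_pow W (s - 1)"
    "?S (s + 1) = (real n * cos_moment j (s + 1)) *\<^sub>R unitary_pow W (s + 1)"
    using Suc.prems by (intro Suc.IH; linarith)+
  then have "(1 / 2) *\<^sub>R ((?S (s - 1) o\<^sub>L W) + (?S (s + 1) o\<^sub>L adj W))
      = (real n * cos_moment (Suc j) s) *\<^sub>R unitary_pow W s"
    by (simp add: oL.scaleR_left unitary_pow_oL[OF W(2,3)] unitary_pow_oL_adj[OF W(2,3)]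
        unitary_pow_oL_adj[OF W(2,3), unfolded add.commute[of _ 1]] algebra_simps add_divide_distrib
        flip: scaleR_add_left)
  then show ?case
    by (simp only: step oL.sum_left sum.distrib[symmetric] scaleR_sum_right[symmetric])
qed

text \<open>The first Fourier coefficient of
  \<open>\<theta> \<mapsto> q (cos \<theta>)\<close>.\<close>

definition first_moment :: "real poly \<Rightarrow> real"
  where "first_moment q = (\<Sum>j\<le>degree q. coeff q j * cos_moment j 1)"

text \<open>A discrete first Fourier coefficient in the rotation angle of \<open>W\<close>. For
  \<open>f = dist_fun p\<close> it depends only on distances from \<open>W\<close> to
  scalars.\<close>

definition average :: "(('h::complex_hilbert \<Rightarrow>\<^sub>L 'h) \<Rightarrow> complex) \<Rightarrow> (real \<Rightarrow> real) \<Rightarrow> nat \<Rightarrow> ('h \<Rightarrow>\<^sub>L 'h) \<Rightarrow> complex"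
  where "average \<tau> f n W
    = (\<Sum>k<n. root_unity n 1 k * re_tr \<tau> f (op_scaleC (root_unity n (- 1) k) W)) / n"

context finite_factor_pair
begin

lemma sum_rotated_poly_op:
  assumes W: "W \<in> unitary_group N" and n: "degree q + 1 < n"
  shows "(\<Sum>k<n. root_unity n 1 k * \<tau> (poly_op q (re_op (op_scaleC (root_unity n (- 1) k) W))))
    = real n * first_moment q * \<tau> W"
proof -
  note W' = unitaryD[OF W]
  let ?H = "\<lambda>k. re_op (op_scaleC (root_unity n (- 1) k) W)"
  have Hm: "?H k \<in> N" for k
    using W' by simp
  have pm: "op_pow A j \<in> N" if "A \<in> N" for A j
    using that by (induction j) auto
  have "(\<Sum>k<n. op_scaleC (root_unity n 1 k) (poly_op q (?H k)))
      = (\<Sum>k<n. \<Sum>j\<le>degree q. coeff q j *\<^sub>R op_scaleC (root_unity n 1 k) (op_pow (?H k) j))"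
    by (simp add: poly_op_eq op_scaleC_sum op_scaleC_scaleR)
  also have "\<dots> = (\<Sum>j\<le>degree q. coeff q j *\<^sub>R (\<Sum>k<n. op_scaleC (root_unity n 1 k) (op_pow (?H k) j)))"
    by (subst sum.swap) (simp add: scaleR_sum_right)
  also have "\<dots> = (\<Sum>j\<le>degree q. (real n * (coeff q j * cos_moment j 1)) *\<^sub>R W)"
  proof (rule sum.cong[OF refl])
    fix j assume "j \<in> {..degree q}"
    then have "\<bar>1\<bar> + int j < int n"
      using n by simp
    from sum_rotated_pow[OF _ W'(2,3) this]
    show "coeff q j *\<^sub>R (\<Sum>k<n. op_scaleC (root_unity n 1 k) (op_pow (?H k) j))
        = (real n * (coeff q j * cos_moment j 1)) *\<^sub>R W"
      using W'(1) by (simp add: mult_ac)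
  qed
  also have "\<dots> = (real n * first_moment q) *\<^sub>R W"
    by (simp add: first_moment_def scaleR_sum_left sum_distrib_left)
  finally have "\<tau> (\<Sum>k<n. op_scaleC (root_unity n 1 k) (poly_op q (?H k)))
      = \<tau> ((real n * first_moment q) *\<^sub>R W)"
    by simp
  then show ?thesis
    using W' Hm by (subst (asm) tr_sum) auto
qed

text \<open>The averaging identity is exact for polynomials of degree below \<open>n - 1\<close>; a
  continuous \<open>f\<close> is reached by uniform approximation, and a mean with unimodular
  coefficients does not enlarge the error.\<close>

lemma average_approx:
  assumes W: "W \<in> unitary_group N" and n: "degree q + 1 < n" and f: "continuous_on {- 1..1} f"
    and "0 \<le> e" and fq: "\<And>t. t \<in> {- 1..1} \<Longrightarrow> \<bar>f t - poly q t\<bar> \<le> e"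
  shows "cmod (average \<tau> f n W - first_moment q * \<tau> W) \<le> e"
proof -
  let ?V = "\<lambda>k. op_scaleC (root_unity n (- 1) k) W"
  have V: "?V k \<in> unitary_group N" for k
    using W by simp
  have bound: "cmod (re_tr \<tau> f (?V k) - \<tau> (poly_op q (re_op (?V k)))) \<le> e" for k
  proof -
    note H = sa_between_re_op_unitary[OF V] and Hm = re_op_mem[OF unitaryD(1)[OF V]]
    have q: "continuous_on {- 1..1} (poly q)"
      by (intro continuous_intros)
    then have fq': "continuous_on {- 1..1} (\<lambda>t. f t - poly q t)"
      by (intro continuous_intros f)
    let ?D = "cfc (\<lambda>t. f t - poly q t) (re_op (?V k))"
    have "?D \<in> N" "adj ?D = ?D"
      using cfc_mem[OF Hm H fq'] adj_cfc[OF H fq'] by auto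
    then have "\<bar>Re (\<tau> ?D)\<bar> \<le> norm ?D"
      by (rule tr_sa_abs_le)
    also have "\<dots> \<le> e"
      by (rule norm_cfc_le[OF H fq' \<open>0 \<le> e\<close> fq])
    finally have 1: "\<bar>Re (\<tau> ?D)\<bar> \<le> e" .
    have "\<tau> ?D = \<tau> (cfc f (re_op (?V k))) - \<tau> (poly_op q (re_op (?V k)))"
      using cfc_mem[OF Hm H f] Hm by (simp add: cfc_diff[OF H f q] cfc_poly[OF H])
    moreover have "Im (\<tau> (poly_op q (re_op (?V k)))) = 0"
    proof (rule tr_sa_real[OF _ sa_between_norm])
      show "adj (poly_op q (re_op (?V k))) = poly_op q (re_op (?V k))"
        by (rule adj_poly_op[OF sa_betweenD(1,2)[OF H]])
    qed (use Hm in auto)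
    ultimately show ?thesis
      using 1 by (simp add: re_tr_def cmod_eq_Re)
  qed
  have "average \<tau> f n W - first_moment q * \<tau> W
      = (\<Sum>k<n. root_unity n 1 k * (re_tr \<tau> f (?V k) - \<tau> (poly_op q (re_op (?V k))))) / n"
    using sum_rotated_poly_op[OF W n] n
    by (simp add: average_def right_diff_distrib sum_subtractf diff_divide_distrib)
  also have "cmod \<dots> \<le> (\<Sum>k<n. e) / n"
    unfolding norm_divide norm_of_nat
    by (intro divide_right_mono order_trans[OF norm_sum] sum_mono) (simp_all add: norm_mult bound)
  also have "\<dots> = e"
    using n by simp
  finally show ?thesis .
qed

lemma re_op_scalar:
  "re_op (op_scaleC c id_blinfun) = Re c *\<^sub>R (id_blinfun :: 'h \<Rightarrow>\<^sub>L 'h)"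
proof -
  have "op_scaleC c id_blinfun + op_scaleC (cnj c) id_blinfun
      = op_scaleC (complex_of_real (2 * Re c)) (id_blinfun :: 'h \<Rightarrow>\<^sub>L 'h)"
    by (simp only: op_scaleC_add_left[symmetric] complex_add_cnj)
  then show ?thesis
    unfolding op_scaleC_of_real by (simp add: re_op_def)
qed

text \<open>At the identity the average is the mean of \<open>x * f x\<close> over cosines
  \<open>x\<close>. The means of \<open>x\<close> and \<open>x\<^sup>2\<close> are 0 and 1/2; the
  latter uses frequency 2, hence \<open>2 < n\<close>.\<close>

lemma average_id_le:
  assumes n: "2 < n" and f: "\<And>x. x \<in> {- 1..1} \<Longrightarrow> x * f x \<le> x * f 0 - \<kappa> * x\<^sup>2"
  shows "Re (average \<tau> f n id_blinfun) \<le> - \<kappa> / 2"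
proof -
  define x where "x k = Re (root_unity n 1 k)" for k
  have x: "x k \<in> {- 1..1}" for k
    using abs_Re_le_cmod[of "root_unity n 1 k"] by (simp add: x_def abs_le_iff)
  have "Re (root_unity n (- 1) k) = x k" for k
    unfolding x_def by (metis cnj.sel(1) cnj_root_unity)
  then have "re_tr \<tau> f (op_scaleC (root_unity n (- 1) k) id_blinfun) = f (x k)" for k
    by (intro re_tr_scalar) (simp add: re_op_scalar)
  then have "Re (average \<tau> f n id_blinfun) = (\<Sum>k<n. x k * f (x k)) / n"
    by (simp add: average_def x_def)
  also have "\<dots> \<le> (\<Sum>k<n. x k * f 0 - \<kappa> * (x k)\<^sup>2) / n"
    by (intro divide_right_mono sum_mono f x) simp
  also have "\<dots> = ((\<Sum>k<n. x k) * f 0 - \<kappa> * (\<Sum>k<n. (x k)\<^sup>2)) / n"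
    by (simp add: sum_subtractf sum_distrib_left sum_distrib_right)
  also have "(\<Sum>k<n. x k) = 0"
    using n arg_cong[OF sum_root_unity[of 1 n], of Re] by (simp add: x_def)
  also have "(\<Sum>k<n. (x k)\<^sup>2) = n / 2"
  proof -
    have "(x k)\<^sup>2 = (1 + Re (root_unity n 2 k)) / 2" for k
    proof -
      have "Re (root_unity n 2 k) = cos (2 * (2 * pi * real k / real n))"
        by (simp add: root_unity_def mult_ac)
      also have "\<dots> = 2 * (x k)\<^sup>2 - 1"
        unfolding cos_double_cos by (simp add: x_def root_unity_def)
      finally show ?thesis
        by simp
    qed
    then have "(\<Sum>k<n. (x k)\<^sup>2) = (n + Re (\<Sum>k<n. root_unity n 2 k)) / 2"
      by (simp only: sum.distrib sum_divide_distrib[symmetric]) simp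
    then show ?thesis
      using n by (simp add: sum_root_unity)
  qed
  finally show ?thesis
    using n by simp
qed

end

section \<open>Isometries preserve the real part of the trace inner product\<close>

lemma isometry_preserves_Re_tr:
  fixes N1 :: "('h::complex_hilbert \<Rightarrow>\<^sub>L 'h) set" and N2 :: "('k::complex_hilbert \<Rightarrow>\<^sub>L 'k) set"
  assumes "finite_factor N1 \<tau>1" and "finite_factor N2 \<tau>2" and p: "0 < p" "p \<noteq> 2"
    and onto: "\<psi> ` unitary_group N1 = unitary_group N2"
    and iso: "\<And>U V. U \<in> unitary_group N1 \<Longrightarrow> V \<in> unitary_group N1 \<Longrightarrow>
      re_tr \<tau>1 (dist_fun p) (adj U o\<^sub>L V) = re_tr \<tau>2 (dist_fun p) (adj (\<psi> U) o\<^sub>L \<psi> V)"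
    and one: "\<psi> id_blinfun = id_blinfun"
    and V: "V \<in> unitary_group N1"
  shows "Re (\<tau>2 (\<psi> V)) = Re (\<tau>1 V)"
proof -
  interpret A: finite_factor_pair N1 \<tau>1
    by standard fact
  interpret B: finite_factor_pair N2 \<tau>2
    by standard fact
  let ?F = "dist_fun p"
  have \<psi>: "\<psi> U \<in> unitary_group N2" if "U \<in> unitary_group N1" for U
    using onto that by blast
  \<comment> \<open>\<open>- U\<close> is the only unitary at maximal distance from
    \<open>U\<close>. Once antipodes are preserved, distances to antipodes may be used on both
    sides.\<close>
  have neg: "\<psi> (- U) = - \<psi> U" if U: "U \<in> unitary_group N1" for U
  proof -
    have "adj U o\<^sub>L (- U) = - id_blinfun"
      using A.unitaryD[OF U] by (simp add: oL_distribs)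
    then have "re_tr \<tau>1 ?F (adj U o\<^sub>L (- U)) = 4 powr (p / 2)"
      using A.dist_eq_diameter_iff[OF _ p(1), of "- id_blinfun"] by simp
    then have "re_tr \<tau>2 ?F (adj (\<psi> U) o\<^sub>L \<psi> (- U)) = 4 powr (p / 2)"
      using iso[OF U A.unitary_minus[OF U]] by simp
    then have "adj (\<psi> U) o\<^sub>L \<psi> (- U) = - id_blinfun"
      using B.dist_eq_diameter_iff[OF _ p(1)] \<psi> U by simp
    then have "\<psi> U o\<^sub>L (adj (\<psi> U) o\<^sub>L \<psi> (- U)) = \<psi> U o\<^sub>L - id_blinfun"
      by simp
    then show ?thesis
      using B.unitaryD[OF \<psi>[OF U]] by (simp add: oL_distribs flip: oL_assoc)
  qed
  have minus: "adj U o\<^sub>L (- W) = - (adj U o\<^sub>L W)" for U W :: "'h \<Rightarrow>\<^sub>L 'h"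
    by (simp add: oL_distribs)
  have minus2: "adj U o\<^sub>L (- W) = - (adj U o\<^sub>L W)" for U W :: "'k \<Rightarrow>\<^sub>L 'k"
    by (simp add: oL_distribs)
  have iso_neg: "re_tr \<tau>1 ?F (- (adj U o\<^sub>L W)) = re_tr \<tau>2 ?F (- (adj (\<psi> U) o\<^sub>L \<psi> W))"
    if "U \<in> unitary_group N1" "W \<in> unitary_group N1" for U W
    using iso[OF that(1) A.unitary_minus[OF that(2)]] neg[OF that(2)] by (simp add: minus minus2)
  have scalar: "re_op (adj U o\<^sub>L W) = c *\<^sub>R id_blinfun \<longleftrightarrow> re_op (adj (\<psi> U) o\<^sub>L \<psi> W) = c *\<^sub>R id_blinfun"
    if "U \<in> unitary_group N1" "W \<in> unitary_group N1" "- 1 < c" "c < 1" for U W c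
    using that \<psi>
    by (simp add: A.re_op_scalar_iff[OF _ p] B.re_op_scalar_iff[OF _ p] iso iso_neg)
  have symm: "adj W = W \<longleftrightarrow> adj (\<psi> W) = \<psi> W" if "W \<in> unitary_group N1" for W
    using that \<psi> iso[of id_blinfun W] iso_neg[of id_blinfun W]
    by (simp add: A.symmetry_iff[OF _ p] B.symmetry_iff[OF _ p] one)
  define I :: "'h \<Rightarrow>\<^sub>L 'h" where "I = op_scaleC \<i> id_blinfun"
  have I: "I \<in> unitary_group N1"
    by (simp add: I_def)
  define J where "J = \<psi> I"
  have J: "J \<in> unitary_group N2"
    using \<psi>[OF I] by (simp add: J_def)
  have "re_op (adj (\<psi> id_blinfun) o\<^sub>L J) = 0 *\<^sub>R id_blinfun"
    unfolding J_def by (subst scalar[symmetric]) (auto simp: I A.re_op_scalar, simp add: I_def A.re_op_scalar)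
  then have Jskew: "adj J = - J"
    by (simp add: one re_op_def eq_neg_iff_add_eq_0 add.commute)
  \<comment> \<open>Every symmetry \<open>S\<close> satisfies
    \<open>Re (adj I o\<^sub>L S) = 0\<close>. This relation is carried over by
    \<open>scalar\<close> with \<open>c = 0\<close>, and for the skew \<open>J\<close> and
    self-adjoint \<open>S2\<close> it says exactly that they commute.\<close>
  have "J o\<^sub>L S2 = S2 o\<^sub>L J" if S2: "S2 \<in> unitary_group N2" "adj S2 = S2" for S2
  proof -
    obtain S where S: "S \<in> unitary_group N1" "S2 = \<psi> S"
      using onto S2(1) by (metis imageE)
    then have "adj S = S"
      using symm S2(2) by simp
    then have "re_op (adj I o\<^sub>L S) = 0 *\<^sub>R id_blinfun"
      using A.unitaryD(1)[OF S(1)] by (simp add: re_op_def I_def oL_distribs)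
    then have "re_op (adj J o\<^sub>L S2) = 0 *\<^sub>R id_blinfun"
      using scalar[OF I S(1), of 0] by (simp add: S J_def)
    then have "(adj J o\<^sub>L S2) + adj (adj J o\<^sub>L S2) = 0"
      by (simp add: re_op_def)
    then show ?thesis
      using B.unitaryD(1)[OF J] B.unitaryD(1)[OF S2(1)] S2(2) by (simp add: Jskew oL_distribs)
  qed
  then have "J = op_scaleC \<i> id_blinfun \<or> J = op_scaleC (- \<i>) id_blinfun"
    using B.skew_unitary_commuting_with_symmetries[OF J Jskew] by blast
  then obtain \<sigma> :: real where \<sigma>: "\<sigma> = 1 \<or> \<sigma> = - 1" and J\<sigma>: "J = op_scaleC (\<i> * \<sigma>) id_blinfun"
    by (metis mult.right_neutral mult_minus_right of_real_1 of_real_minus)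
  \<comment> \<open>The relations of \<open>E\<close> to 1 and to \<open>J\<close> fix
    \<open>re_op E\<close> and \<open>re_op (adj J o\<^sub>L E)\<close>, and these determine
    \<open>E\<close>. Since \<open>scalar\<close> applies only strictly between -1 and 1, the four
    points on the axes are treated separately.\<close>
  have circle: "\<psi> (op_scaleC w id_blinfun) = op_scaleC (Complex (Re w) (\<sigma> * Im w)) id_blinfun"
    if w: "cmod w = 1" for w
  proof -
    have sq: "(Re w)\<^sup>2 + (Im w)\<^sup>2 = 1"
      using w by (simp add: cmod_def)
    define U :: "'h \<Rightarrow>\<^sub>L 'h" where "U = op_scaleC w id_blinfun"
    have U: "U \<in> unitary_group N1"
      using w by (simp add: U_def)
    consider "w = 1" | "w = - 1" | "w = \<i>" | "w = - \<i>" | "- 1 < Re w" "Re w < 1" "- 1 < Im w" "Im w < 1"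
    proof -
      have lt: "- 1 < x \<and> x < 1" if "x\<^sup>2 + y\<^sup>2 = 1" "y \<noteq> 0" for x y :: real
      proof -
        have "x\<^sup>2 < 1\<^sup>2"
          unfolding power_one using that(1) zero_less_power2[THEN iffD2, OF that(2)] by linarith
        then have "\<bar>x\<bar> < 1"
          by (metis abs_1 power2_abs power2_less_imp_less zero_le_one)
        then show ?thesis
          by (simp add: abs_less_iff minus_less_iff)
      qed
      show thesis
      proof (cases "Re w = 0 \<or> Im w = 0")
        case True
        then have "(Im w)\<^sup>2 = 1 \<and> Re w = 0 \<or> (Re w)\<^sup>2 = 1 \<and> Im w = 0"
          using sq by auto
        then have "w = 1 \<or> w = - 1 \<or> w = \<i> \<or> w = - \<i>"
          by (auto simp: complex_eq_iff power2_eq_1_iff)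
        then show ?thesis
          using that by blast
      next
        case False
        then show ?thesis
          using that(5) lt[OF sq] lt[of "Im w" "Re w"] sq by (simp add: add.commute)
      qed
    qed
    then show ?thesis
    proof cases
      case 1
      moreover have "Complex 1 0 = 1"
        by (simp add: complex_eq_iff)
      ultimately show ?thesis
        by (simp add: one)
    next
      case 2
      moreover have "Complex (- 1) 0 = - 1"
        by (simp add: complex_eq_iff)
      ultimately show ?thesis
        by (simp add: one neg)
    next
      case 3
      moreover have "Complex 0 \<sigma> = \<i> * \<sigma>"
        by (simp add: complex_eq_iff)
      ultimately show ?thesis
        using J\<sigma> by (simp add: J_def I_def)
    next
      case 4
      moreover have "Complex 0 (- \<sigma>) = - (\<i> * \<sigma>)"
        by (simp add: complex_eq_iff)
      ultimately show ?thesis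
        using J\<sigma> neg[OF I] by (simp add: J_def I_def)
    next
      case 5
      define E where "E = \<psi> U"
      have E: "E \<in> bounded_ops"
        using B.unitaryD(1)[OF \<psi>[OF U]] by (simp add: E_def)
      have "re_op (adj (\<psi> id_blinfun) o\<^sub>L E) = Re w *\<^sub>R id_blinfun"
        unfolding E_def using 5 U
        by (subst scalar[symmetric]) (auto simp: U_def A.re_op_scalar)
      then have 1: "re_op E = Re w *\<^sub>R id_blinfun"
        by (simp add: one)
      have "adj I o\<^sub>L U = op_scaleC (- \<i> * w) id_blinfun"
        by (simp add: I_def U_def)
      then have "re_op (adj I o\<^sub>L U) = Im w *\<^sub>R id_blinfun"
        by (simp only: A.re_op_scalar) simp
      then have 2: "re_op (adj J o\<^sub>L E) = Im w *\<^sub>R id_blinfun"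
        unfolding E_def J_def using 5 U I by (subst scalar[symmetric]) auto
      have "adj J o\<^sub>L E = op_scaleC (- (\<i> * \<sigma>)) E"
        by (simp add: J\<sigma> del: op_scaleC_minus)
      then have "re_op (adj J o\<^sub>L E) = (1 / 2) *\<^sub>R (op_scaleC (- (\<i> * \<sigma>)) E + op_scaleC (\<i> * \<sigma>) (adj E))"
        using E by (simp add: re_op_def)
      then have "op_scaleC (\<i> * \<sigma>) (re_op (adj J o\<^sub>L E)) = (1 / 2) *\<^sub>R (E - adj E)"
        using \<sigma> by (auto simp: op_scaleC_scaleR op_scaleC_add_right op_scaleC_diff_right)
      moreover have "E = re_op E + (1 / 2) *\<^sub>R (E - adj E)"
        by (simp add: re_op_def scaleR_diff_right scaleR_add_right flip: scaleR_add_left)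
      ultimately have "E = Re w *\<^sub>R id_blinfun + op_scaleC (\<i> * \<sigma>) (Im w *\<^sub>R id_blinfun)"
        by (simp add: 1 2)
      also have "\<dots> = op_scaleC (complex_of_real (Re w) + (\<i> * \<sigma>) * complex_of_real (Im w)) id_blinfun"
        by (simp only: op_scaleC_add_left op_scaleC_of_real[symmetric] op_scaleC_scaleC)
      also have "complex_of_real (Re w) + (\<i> * \<sigma>) * complex_of_real (Im w) = Complex (Re w) (\<sigma> * Im w)"
        by (simp add: complex_eq_iff)
      finally show ?thesis
        by (simp add: E_def U_def)
    qed
  qed
  \<comment> \<open>If scalars are conjugated, passing to the adjoint of \<open>\<psi> V\<close>
    restores the direction of rotation, because \<open>re_op\<close> is invariant under adjoints.
    The real part of the trace does not notice the change.\<close>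
  define X where "X = (if \<sigma> = 1 then \<psi> V else adj (\<psi> V))"
  have X: "X \<in> unitary_group N2"
    using \<psi>[OF V] by (simp add: X_def)
  have avg: "average \<tau>1 ?F n V = average \<tau>2 ?F n X" for n
  proof -
    have "re_tr \<tau>1 ?F (op_scaleC (root_unity n (- 1) k) V)
        = re_tr \<tau>2 ?F (op_scaleC (root_unity n (- 1) k) X)" for k
    proof -
      let ?w = "root_unity n 1 k"
      have Vb: "V \<in> bounded_ops" and \<psi>Vb: "\<psi> V \<in> bounded_ops"
        using A.unitaryD[OF V] B.unitaryD[OF \<psi>[OF V]] by auto
      have "op_scaleC (root_unity n (- 1) k) V = adj (op_scaleC ?w id_blinfun) o\<^sub>L V"
        by simp
      then have "re_tr \<tau>1 ?F (op_scaleC (root_unity n (- 1) k) V)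
          = re_tr \<tau>2 ?F (adj (\<psi> (op_scaleC ?w id_blinfun)) o\<^sub>L \<psi> V)"
        using iso[of "op_scaleC ?w id_blinfun" V] V by simp
      also have "adj (\<psi> (op_scaleC ?w id_blinfun)) o\<^sub>L \<psi> V
          = op_scaleC (cnj (Complex (Re ?w) (\<sigma> * Im ?w))) (\<psi> V)"
        by (simp add: circle)
      also have "re_tr \<tau>2 ?F \<dots> = re_tr \<tau>2 ?F (op_scaleC (root_unity n (- 1) k) X)"
      proof (cases "\<sigma> = 1")
        case True
        then show ?thesis
          using cnj_root_unity[of n 1 k] by (simp add: X_def)
      next
        case False
        then have "\<sigma> = - 1"
          using \<sigma> by simp
        then have "cnj (Complex (Re ?w) (\<sigma> * Im ?w)) = ?w"
          by (simp add: complex_eq_iff)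
        moreover have "op_scaleC (root_unity n (- 1) k) X = adj (op_scaleC ?w (\<psi> V))"
          using False \<psi>Vb by (simp add: X_def)
        moreover have "re_op (adj (op_scaleC ?w (\<psi> V))) = re_op (op_scaleC ?w (\<psi> V))"
          using \<psi>Vb by (intro re_op_adj) simp
        ultimately show ?thesis
          unfolding re_tr_def by (simp only:)
      qed
      finally show ?thesis .
    qed
    then show ?thesis
      by (simp add: average_def)
  qed
  obtain \<kappa> where \<kappa>: "0 < \<kappa>" "\<And>x. x \<in> {- 1..1} \<Longrightarrow> x * ?F x \<le> x * ?F 0 - \<kappa> * x\<^sup>2"
    using dist_fun_decrease[OF p(1)] by blast
  note F = continuous_on_dist_fun[OF p(1) order_refl]
  have "cmod (\<tau>1 V - \<tau>2 X) \<le> 0 + e" if "0 < e" for e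
  proof -
    \<comment> \<open>The bound \<open>\<kappa> / 4\<close> keeps the first moment at most
      \<open>- \<kappa> / 4\<close>; the other bound makes the combined error \<open>2 * d\<close>
      of the two averages at most \<open>e\<close> after division by
      \<open>\<kappa> / 4\<close>.\<close>
    define d where "d = min (\<kappa> / 4) (e * \<kappa> / 8)"
    have d: "0 < d" "d \<le> \<kappa> / 4" "2 * d \<le> e * (\<kappa> / 4)"
      using \<kappa>(1) that by (auto simp: d_def min_def)
    obtain m where m: "inverse (real (Suc m)) < d"
      using reals_Archimedean[OF d(1)] by blast
    obtain q0 where q0: "\<forall>n. \<forall>t\<in>{- 1..1}. \<bar>poly (q0 n) t - ?F t\<bar> < inverse (real (Suc n))"
      using real_poly_approximation[OF compact_Icc F] by metis
    define q where "q = q0 m"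
    have q: "\<bar>?F t - poly q t\<bar> \<le> d" if "t \<in> {- 1..1}" for t
      using q0[rule_format, OF that, of m] m by (simp add: q_def abs_minus_commute)
    define n where "n = degree q + 3"
    have n: "degree q + 1 < n" "2 < n"
      by (simp_all add: n_def)
    let ?b = "complex_of_real (first_moment q)"
    have d0: "0 \<le> d"
      using d by simp
    note approx = A.average_approx[OF _ n(1) F d0 q] B.average_approx[OF _ n(1) F d0 q]
    have "cmod (average \<tau>1 ?F n id_blinfun - ?b) \<le> d"
      using approx(1)[OF A.unitary_id] by simp
    moreover have "Re (average \<tau>1 ?F n id_blinfun) \<le> - \<kappa> / 2"
      by (rule A.average_id_le[OF n(2) \<kappa>(2)])
    moreover have "\<bar>Re (average \<tau>1 ?F n id_blinfun - ?b)\<bar> \<le> cmod (average \<tau>1 ?F n id_blinfun - ?b)"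
      by (rule abs_Re_le_cmod)
    ultimately have "first_moment q \<le> - \<kappa> / 2 + d"
      by (simp add: abs_le_iff)
    then have b: "\<kappa> / 4 \<le> cmod ?b"
      using d(2) by simp
    have "cmod (?b * (\<tau>1 V - \<tau>2 X)) = cmod ((average \<tau>2 ?F n X - ?b * \<tau>2 X) - (average \<tau>1 ?F n V - ?b * \<tau>1 V))"
      by (simp add: avg algebra_simps)
    also have "\<dots> \<le> d + d"
      using approx(1)[OF V] approx(2)[OF X] by (intro order_trans[OF norm_triangle_ineq4]) auto
    finally have "cmod ?b * cmod (\<tau>1 V - \<tau>2 X) \<le> e * (\<kappa> / 4)"
      using d(3) by (simp add: norm_mult)
    moreover have "(\<kappa> / 4) * cmod (\<tau>1 V - \<tau>2 X) \<le> cmod ?b * cmod (\<tau>1 V - \<tau>2 X)"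
      using b by (intro mult_right_mono) auto
    ultimately have "(\<kappa> / 4) * cmod (\<tau>1 V - \<tau>2 X) \<le> (\<kappa> / 4) * e"
      by (simp add: mult.commute)
    then show ?thesis
      using \<kappa>(1) by simp
  qed
  then have "cmod (\<tau>1 V - \<tau>2 X) \<le> 0"
    by (rule field_le_epsilon)
  then have "\<tau>1 V = \<tau>2 X"
    by simp
  then show ?thesis
    using B.tr_adj[OF B.unitaryD(1)[OF \<psi>[OF V]]] by (auto simp: X_def split: if_splits)
qed

text \<open>For \<open>p = 2\<close> the distance function is \<open>2 - 2 * t\<close>, so the trace
  can be read off directly. Otherwise the left translate \<open>\<theta>\<close> fixes the identity,
  and the preceding result is applied at \<open>adj U o\<^sub>L V\<close>.\<close>

lemma isometry_preserves_Re_inner: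
  fixes N1 :: "('h::complex_hilbert \<Rightarrow>\<^sub>L 'h) set" and N2 :: "('k::complex_hilbert \<Rightarrow>\<^sub>L 'k) set"
  assumes N1: "finite_factor N1 \<tau>1" and N2: "finite_factor N2 \<tau>2" and p: "0 < p"
    and onto: "\<psi> ` unitary_group N1 = unitary_group N2"
    and iso: "Lp_isometry p N1 \<tau>1 N2 \<tau>2 \<psi>"
    and U: "U \<in> unitary_group N1" and V: "V \<in> unitary_group N1"
  shows "Re (\<tau>2 (adj (\<psi> U) o\<^sub>L \<psi> V)) = Re (\<tau>1 (adj U o\<^sub>L V))"
proof -
  interpret A: finite_factor_pair N1 \<tau>1
    by standard fact
  interpret B: finite_factor_pair N2 \<tau>2
    by standard fact
  have \<psi>: "\<psi> U \<in> unitary_group N2" if "U \<in> unitary_group N1" for U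
    using onto that by blast
  note F = continuous_on_dist_fun[OF p order_refl]
  have nn: "0 \<le> dist_fun p t" for t
    by (simp add: dist_fun_def)
  have iso': "re_tr \<tau>1 (dist_fun p) (adj U o\<^sub>L V) = re_tr \<tau>2 (dist_fun p) (adj (\<psi> U) o\<^sub>L \<psi> V)"
    if "U \<in> unitary_group N1" "V \<in> unitary_group N1" for U V
  proof -
    have "Lp_norm \<tau>1 p (U - V) = Lp_norm \<tau>2 p (\<psi> U - \<psi> V)"
      using iso that by (simp add: Lp_isometry_def)
    then have "re_tr \<tau>1 (dist_fun p) (adj U o\<^sub>L V) powr (1 / p)
        = re_tr \<tau>2 (dist_fun p) (adj (\<psi> U) o\<^sub>L \<psi> V) powr (1 / p)"
      using that \<psi> p by (simp add: A.Lp_norm_diff B.Lp_norm_diff)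
    then have "(re_tr \<tau>1 (dist_fun p) (adj U o\<^sub>L V) powr (1 / p)) powr p
        = (re_tr \<tau>2 (dist_fun p) (adj (\<psi> U) o\<^sub>L \<psi> V) powr (1 / p)) powr p"
      by simp
    moreover have "0 \<le> re_tr \<tau>1 (dist_fun p) (adj U o\<^sub>L V)"
      using that F nn by (intro A.re_tr_nonneg) auto
    moreover have "0 \<le> re_tr \<tau>2 (dist_fun p) (adj (\<psi> U) o\<^sub>L \<psi> V)"
      using that \<psi> F nn by (intro B.re_tr_nonneg) auto
    ultimately show ?thesis
      using p by (simp add: powr_powr)
  qed
  show ?thesis
  proof (cases "p = 2")
    case True
    have lin: "re_tr \<tau> (dist_fun 2) W = 2 - 2 * Re (\<tau> W)"
      if "finite_factor_pair N \<tau>" and W: "W \<in> unitary_group N"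
      for N \<tau> and W :: "'x::complex_hilbert \<Rightarrow>\<^sub>L 'x"
    proof -
      interpret C: finite_factor_pair N \<tau>
        by fact
      note H = C.sa_between_re_op_unitary[OF W] and W' = C.unitaryD(1)[OF W]
      have c: "continuous_on {- 1..1} (\<lambda>t::real. 2 * t)"
        by (intro continuous_intros)
      have "cfc (dist_fun 2) (re_op W) = cfc (\<lambda>t. 2 - 2 * t) (re_op W)"
        by (rule cfc_cong[OF H continuous_on_dist_fun]) (auto simp: dist_fun_def)
      also have "\<dots> = 2 *\<^sub>R id_blinfun - 2 *\<^sub>R re_op W"
        using cfc_diff[OF H continuous_on_const c] cfc_cmult[OF H continuous_on_id, of 2]
        by (simp add: cfc_const[OF H] cfc_ident[OF H])
      finally show ?thesis
        using W' C.tr_adj[OF W'] by (simp add: re_tr_def re_op_def)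
    qed
    show ?thesis
      using iso'[OF U V] lin[OF A.finite_factor_pair_axioms, of "adj U o\<^sub>L V"]
        lin[OF B.finite_factor_pair_axioms, of "adj (\<psi> U) o\<^sub>L \<psi> V"] U V \<psi> True by simp
  next
    case False
    define \<theta> where "\<theta> X = adj (\<psi> U) o\<^sub>L \<psi> (U o\<^sub>L X)" for X
    note U' = A.unitaryD[OF U] and \<psi>U = B.unitaryD[OF \<psi>[OF U]]
    have "Re (\<tau>2 (\<theta> (adj U o\<^sub>L V))) = Re (\<tau>1 (adj U o\<^sub>L V))"
    proof (rule isometry_preserves_Re_tr[OF N1 N2 p False])
      show "\<theta> id_blinfun = id_blinfun"
        by (simp add: \<theta>_def \<psi>U)
      show "\<theta> ` unitary_group N1 = unitary_group N2"
      proof (intro equalityI subsetI)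
        show "Y \<in> unitary_group N2" if "Y \<in> \<theta> ` unitary_group N1" for Y
          using that U \<psi> by (auto simp: \<theta>_def)
        fix Y assume Y: "Y \<in> unitary_group N2"
        then have "\<psi> U o\<^sub>L Y \<in> \<psi> ` unitary_group N1"
          using \<psi>[OF U] by (simp add: onto)
        then obtain Z where Z: "Z \<in> unitary_group N1" "\<psi> Z = \<psi> U o\<^sub>L Y"
          by auto
        have "\<theta> (adj U o\<^sub>L Z) = Y"
          by (simp add: \<theta>_def U' \<psi>U Z flip: oL_assoc)
        then show "Y \<in> \<theta> ` unitary_group N1"
          using U Z(1) by (metis A.unitary_adj A.unitary_oL imageI)
      qed
      fix X Y assume X: "X \<in> unitary_group N1" and Y: "Y \<in> unitary_group N1"
      have "adj (\<theta> X) o\<^sub>L \<theta> Y = adj (\<psi> (U o\<^sub>L X)) o\<^sub>L ((\<psi> U o\<^sub>L adj (\<psi> U)) o\<^sub>L \<psi> (U o\<^sub>L Y))"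
        using B.unitaryD(1)[OF \<psi>[OF A.unitary_oL[OF U X]]] \<psi>U(1)
        by (simp add: \<theta>_def oL_assoc)
      also have "\<dots> = adj (\<psi> (U o\<^sub>L X)) o\<^sub>L \<psi> (U o\<^sub>L Y)"
        by (simp add: \<psi>U)
      finally have "re_tr \<tau>2 (dist_fun p) (adj (\<theta> X) o\<^sub>L \<theta> Y)
          = re_tr \<tau>1 (dist_fun p) (adj (U o\<^sub>L X) o\<^sub>L (U o\<^sub>L Y))"
        using iso'[of "U o\<^sub>L X" "U o\<^sub>L Y"] U X Y by simp
      also have "adj (U o\<^sub>L X) o\<^sub>L (U o\<^sub>L Y) = adj X o\<^sub>L ((adj U o\<^sub>L U) o\<^sub>L Y)"
        using U'(1) A.unitaryD(1)[OF X] by (simp add: oL_assoc)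
      finally show "re_tr \<tau>1 (dist_fun p) (adj X o\<^sub>L Y) = re_tr \<tau>2 (dist_fun p) (adj (\<theta> X) o\<^sub>L \<theta> Y)"
        by (simp add: U')
    qed (use onto U V in auto)
    then show ?thesis
      by (simp add: \<theta>_def U' flip: oL_assoc)
  qed
qed

section \<open>Real linear extension\<close>

context finite_factor_pair
begin

text \<open>The cosine belonging to the sine \<open>A\<close>: for self-adjoint contractions it
  yields unitaries with imaginary part \<open>A\<close>, without any exponential.\<close>

definition cos_part :: "('h \<Rightarrow>\<^sub>L 'h) \<Rightarrow> ('h \<Rightarrow>\<^sub>L 'h)"
  where "cos_part A = cfc (\<lambda>s. sqrt (1 - s\<^sup>2)) A"

lemma sqrt_part_continuous: "continuous_on S (\<lambda>s::real. sqrt (1 - s\<^sup>2))"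
  by (intro continuous_intros)

text \<open>The remainder rests on
  \<open>\<bar>sqrt (1 - v) - 1 + v / 2\<bar> \<le> v\<^sup>2\<close> for \<open>v\<close> in
  \<open>[0, 1]\<close>. Being of fourth order in \<open>A\<close>, it remains negligible after
  division by the square of a scaling parameter.\<close>

lemma
  assumes A: "A \<in> N" "adj A = A" "norm A \<le> 1"
  shows cos_part_mem [simp]: "cos_part A \<in> N" and adj_cos_part: "adj (cos_part A) = cos_part A"
    and cos_part_unitary: "cos_part A + op_scaleC \<i> A \<in> unitary_group N"
      "cos_part A - op_scaleC \<i> A \<in> unitary_group N"
    and cos_part_approx: "norm (cos_part A - id_blinfun + (1 / 2) *\<^sub>R (A o\<^sub>L A)) \<le> norm A ^ 4"
proof -
  have H: "sa_between (- norm A) (norm A) A"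
    using A by (intro sa_between_norm) auto
  note c = sqrt_part_continuous[of "{- norm A..norm A}"]
  have s2: "s\<^sup>2 \<le> (norm A)\<^sup>2" "s\<^sup>2 \<le> 1" if "s \<in> {- norm A..norm A}" for s
  proof -
    have "\<bar>s\<bar> \<le> norm A"
      using that by (simp add: abs_le_iff)
    then show "s\<^sup>2 \<le> (norm A)\<^sup>2"
      by (metis abs_ge_zero power2_abs power_mono)
    also have "\<dots> \<le> 1"
      using A(3) by (simp add: power_le_one)
    finally show "s\<^sup>2 \<le> 1" .
  qed
  show C: "cos_part A \<in> N" "adj (cos_part A) = cos_part A"
    unfolding cos_part_def using A(1) H c by (auto intro: cfc_mem adj_cfc)
  have cc: "continuous_on {- norm A..norm A} (\<lambda>s::real. s * s)"
    by (intro continuous_intros)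
  have AA: "cfc (\<lambda>s. s * s) A = A o\<^sub>L A"
    using cfc_mult[OF H continuous_on_id continuous_on_id] by (simp add: cfc_ident[OF H])
  have "cos_part A o\<^sub>L cos_part A = cfc (\<lambda>s. sqrt (1 - s\<^sup>2) * sqrt (1 - s\<^sup>2)) A"
    unfolding cos_part_def by (rule cfc_mult[OF H c c, symmetric])
  also have "\<dots> = cfc (\<lambda>s. 1 - s * s) A"
    by (rule cfc_cong[OF H]) (use s2(2) in \<open>auto intro!: continuous_intros simp: power2_eq_square\<close>)
  also have "\<dots> = id_blinfun - (A o\<^sub>L A)"
    using cfc_diff[OF H continuous_on_const cc, of 1] by (simp add: cfc_const[OF H] AA)
  finally have CC: "cos_part A o\<^sub>L cos_part A = id_blinfun - (A o\<^sub>L A)" .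
  have CA: "cos_part A o\<^sub>L A = A o\<^sub>L cos_part A"
    unfolding cos_part_def by (rule cfc_commute[OF H c refl])
  show "cos_part A + op_scaleC \<i> A \<in> unitary_group N" "cos_part A - op_scaleC \<i> A \<in> unitary_group N"
    using A C by (simp_all add: unitary_group_def oL_distribs CC CA)
  have "norm (cfc (\<lambda>s. (sqrt (1 - s\<^sup>2) - 1) + (1 / 2) * (s * s)) A) \<le> norm A ^ 4"
  proof (rule norm_cfc_le[OF H])
    fix s assume s: "s \<in> {- norm A..norm A}"
    define v where "v = s\<^sup>2"
    have v: "0 \<le> v" "v \<le> 1" "v \<le> (norm A)\<^sup>2"
      using s2[OF s] by (auto simp: v_def)
    have "sqrt (1 - v) \<le> 1 - v / 2"
      using v by (intro real_le_lsqrt) (auto simp: power2_eq_square algebra_simps)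
    moreover have "1 - v / 2 - v\<^sup>2 \<le> sqrt (1 - v)"
    proof (cases "0 \<le> 1 - v / 2 - v\<^sup>2")
      case True
      \<comment> \<open>In this case \<open>v\<^sup>2 \<le> 1 - v / 2\<close>, so the bracket
        \<open>7 / 4 - v - v\<^sup>2\<close> is at least \<open>1 / 4\<close>.\<close>
      have "(1 - v / 2 - v\<^sup>2)\<^sup>2 = 1 - v - v\<^sup>2 * (7 / 4 - v - v\<^sup>2)"
        by (simp add: power2_eq_square field_simps)
      also have "\<dots> \<le> 1 - v"
        using True v by (simp add: mult_nonneg_nonneg)
      finally show ?thesis
        by (rule real_le_rsqrt)
    next
      case False
      then show ?thesis
        using v by (smt (verit) real_sqrt_ge_zero)
    qed
    moreover have "v\<^sup>2 \<le> norm A ^ 4"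
      using power_mono[OF v(3) v(1), of 2] by (simp flip: power_mult)
    ultimately show "\<bar>(sqrt (1 - s\<^sup>2) - 1) + (1 / 2) * (s * s)\<bar> \<le> norm A ^ 4"
      unfolding power2_eq_square[symmetric, of s] v_def[symmetric] using v(1) zero_le_power2[of v]
      by (simp add: abs_le_iff)
  qed (auto intro!: continuous_intros)
  moreover have "cfc (\<lambda>s. (sqrt (1 - s\<^sup>2) - 1) + (1 / 2) * (s * s)) A
      = cos_part A - id_blinfun + (1 / 2) *\<^sub>R (A o\<^sub>L A)"
  proof -
    have c1: "continuous_on {- norm A..norm A} (\<lambda>s::real. sqrt (1 - s\<^sup>2) - 1)"
      and c2: "continuous_on {- norm A..norm A} (\<lambda>s::real. (1 / 2) * (s * s))"
      by (intro continuous_intros)+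
    show ?thesis
      unfolding cfc_add[OF H c1 c2] cfc_cmult[OF H cc] AA cfc_diff[OF H c continuous_on_const]
        cfc_const[OF H] cos_part_def by simp
  qed
  ultimately show "norm (cos_part A - id_blinfun + (1 / 2) *\<^sub>R (A o\<^sub>L A)) \<le> norm A ^ 4"
    by simp
qed

text \<open>A self-adjoint contraction \<open>B\<close> is the mean of the unitaries
  \<open>B + i C\<close> and \<open>B - i C\<close> with \<open>C = cos_part B\<close>; the real and
  the imaginary part of \<open>A\<close> contribute two unitaries each. The coefficient
  \<open>norm A / 2\<close> later yields a norm bound for real linear maps.\<close>

lemma unitary_span:
  assumes A: "A \<in> N"
  obtains U1 U2 U3 U4 where "U1 \<in> unitary_group N" "U2 \<in> unitary_group N"
    "U3 \<in> unitary_group N" "U4 \<in> unitary_group N" "A = (norm A / 2) *\<^sub>R ((U1 + U2) + (U3 + U4))"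
proof (cases "A = 0")
  case True
  then show thesis
    using that[OF unitary_id unitary_id unitary_id unitary_id] by simp
next
  case False
  have sa: "\<exists>U\<in>unitary_group N. \<exists>V\<in>unitary_group N. B = (1 / 2) *\<^sub>R (U + V)"
    if B: "B \<in> N" "adj B = B" "norm B \<le> 1" for B
  proof -
    let ?U = "op_scaleC \<i> (cos_part B - op_scaleC \<i> B)" and ?V = "op_scaleC (- \<i>) (cos_part B + op_scaleC \<i> B)"
    have "?U \<in> unitary_group N" "?V \<in> unitary_group N"
      using cos_part_unitary[OF B] by (auto intro: unitary_scaleC simp del: op_scaleC_minus)
    moreover have "?U + ?V = 2 *\<^sub>R B"
      by (simp add: op_scaleC_diff_right op_scaleC_add_right scaleR_2)
    then have "B = (1 / 2) *\<^sub>R (?U + ?V)"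
      by simp
    ultimately show ?thesis
      by blast
  qed
  define R where "R = (1 / norm A) *\<^sub>R ((1 / 2) *\<^sub>R (A + adj A))"
  define I where "I = (1 / norm A) *\<^sub>R ((1 / 2) *\<^sub>R op_scaleC \<i> (adj A - A))"
  have nA: "norm (adj A) \<le> norm A"
    using A by (intro norm_adj_le) auto
  have R: "R \<in> N" "adj R = R"
    using A by (auto simp: R_def add.commute)
  have "norm (A + adj A) \<le> 2 * norm A"
    using norm_triangle_ineq[of A "adj A"] nA by simp
  then have nR: "norm R \<le> 1"
    unfolding R_def norm_scaleR using False by (simp add: divide_le_eq)
  have I: "I \<in> N" "adj I = I"
    using A by (auto simp: I_def op_scaleC_diff_right)
  have "norm (op_scaleC \<i> (adj A - A)) \<le> 2 * norm A"
    using norm_op_scaleC[of \<i> "adj A - A"] norm_triangle_ineq4[of "adj A" A] nA by simp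
  then have nI: "norm I \<le> 1"
    unfolding I_def norm_scaleR using False by (simp add: divide_le_eq)
  obtain U1 U2 where U: "U1 \<in> unitary_group N" "U2 \<in> unitary_group N" "R = (1 / 2) *\<^sub>R (U1 + U2)"
    using sa[OF R nR] by blast
  obtain V1 V2 where V: "V1 \<in> unitary_group N" "V2 \<in> unitary_group N" "I = (1 / 2) *\<^sub>R (V1 + V2)"
    using sa[OF I nI] by blast
  have "norm A *\<^sub>R R = (1 / 2) *\<^sub>R (A + adj A)"
    using False by (simp add: R_def)
  moreover have "norm A *\<^sub>R op_scaleC \<i> I = (1 / 2) *\<^sub>R (A - adj A)"
    using False by (simp add: I_def op_scaleC_scaleR)
  ultimately have "A = norm A *\<^sub>R R + norm A *\<^sub>R op_scaleC \<i> I"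
    by (simp add: scaleR_diff_right scaleR_add_right flip: scaleR_add_left)
  also have "\<dots> = (norm A / 2) *\<^sub>R ((U1 + U2) + (op_scaleC \<i> V1 + op_scaleC \<i> V2))"
    by (simp add: U V op_scaleC_scaleR op_scaleC_add_right scaleR_add_right)
  finally show thesis
    using U V by (intro that[of U1 U2 "op_scaleC \<i> V1" "op_scaleC \<i> V2"]) auto
qed

lemma norm_unitary_le:
  assumes U: "U \<in> unitary_group N"
  shows "norm U \<le> 1"
proof (rule norm_blinfun_bound)
  fix x
  have "cinner (U x) (U x) = cinner ((adj U o\<^sub>L U) x) x"
    using unitaryD(1)[OF U] by (simp add: cinner_adj_left)
  then have "(norm (U x))\<^sup>2 = (norm x)\<^sup>2"
    unfolding unitaryD(2)[OF U] cinner_self of_real_eq_iff id_blinfun.rep_eq .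
  then show "norm (U x) \<le> 1 * norm x"
    by simp
qed simp

text \<open>Expanding \<open>adj D\<close> into unitaries gives
  \<open>Re (\<tau> (adj D o\<^sub>L D)) = 0\<close>, and faithfulness applies. This nondegeneracy
  makes the linear extension well defined.\<close>

lemma Re_inner_unitaries_eq_0:
  assumes D: "D \<in> N" and 0: "\<And>U. U \<in> unitary_group N \<Longrightarrow> Re (\<tau> (adj U o\<^sub>L D)) = 0"
  shows "D = 0"
proof -
  obtain U1 U2 U3 U4 where U: "U1 \<in> unitary_group N" "U2 \<in> unitary_group N"
    "U3 \<in> unitary_group N" "U4 \<in> unitary_group N" and eq: "D = (norm D / 2) *\<^sub>R ((U1 + U2) + (U3 + U4))"
    using unitary_span[OF D] by metis
  note m = U[THEN unitaryD(1)]
  have "adj D = (norm D / 2) *\<^sub>R ((adj U1 + adj U2) + (adj U3 + adj U4))"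
    using m by (subst eq) simp
  then have "adj D o\<^sub>L D = (norm D / 2) *\<^sub>R (((adj U1 o\<^sub>L D) + (adj U2 o\<^sub>L D)) + ((adj U3 o\<^sub>L D) + (adj U4 o\<^sub>L D)))"
    by (simp only: oL.scaleR_left oL.add_left)
  then have "Re (\<tau> (adj D o\<^sub>L D)) = 0"
    using U m D 0 by simp
  then show ?thesis
    using D by (intro tr_adj_mult_eq_0)
qed

end

text \<open>The axioms are stable under inversion and under a rotation by \<open>i\<close>. The
  locale is interpreted for those maps too, and what holds for them yields further facts about
  \<open>T\<close>.\<close>

locale real_unitary_iso = A: finite_factor_pair N1 \<tau>1 + B: finite_factor_pair N2 \<tau>2
  for N1 :: "('h::complex_hilbert \<Rightarrow>\<^sub>L 'h) set" and \<tau>1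
    and N2 :: "('k::complex_hilbert \<Rightarrow>\<^sub>L 'k) set" and \<tau>2 +
  fixes T :: "('h \<Rightarrow>\<^sub>L 'h) \<Rightarrow> ('k \<Rightarrow>\<^sub>L 'k)"
  assumes bij: "bij_betw T N1 N2"
    and add: "X \<in> N1 \<Longrightarrow> Y \<in> N1 \<Longrightarrow> T (X + Y) = T X + T Y"
    and scaleR: "X \<in> N1 \<Longrightarrow> T (r *\<^sub>R X) = r *\<^sub>R T X"
    and unitary: "T ` unitary_group N1 = unitary_group N2"
    and one: "T id_blinfun = id_blinfun"

text \<open>The extension starts as the relation \<open>rel\<close>: \<open>Y\<close> has the same
  real inner products with the \<open>\<psi> U\<close> as \<open>X\<close> has with the
  \<open>U\<close>. Additivity and real homogeneity are immediate, nondegeneracy in the two factors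
  gives uniqueness in both directions, and unitaries span.\<close>

lemma real_unitary_extension:
  fixes N1 :: "('h::complex_hilbert \<Rightarrow>\<^sub>L 'h) set" and N2 :: "('k::complex_hilbert \<Rightarrow>\<^sub>L 'k) set"
  assumes "finite_factor N1 \<tau>1" and "finite_factor N2 \<tau>2"
    and onto: "\<psi> ` unitary_group N1 = unitary_group N2" and one: "\<psi> id_blinfun = id_blinfun"
    and inner: "\<And>U V. U \<in> unitary_group N1 \<Longrightarrow> V \<in> unitary_group N1 \<Longrightarrow>
      Re (\<tau>2 (adj (\<psi> U) o\<^sub>L \<psi> V)) = Re (\<tau>1 (adj U o\<^sub>L V))"
  obtains T where "real_unitary_iso N1 \<tau>1 N2 \<tau>2 T" "\<And>U. U \<in> unitary_group N1 \<Longrightarrow> T U = \<psi> U"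
proof -
  interpret A: finite_factor_pair N1 \<tau>1
    by standard fact
  interpret B: finite_factor_pair N2 \<tau>2
    by standard fact
  have \<psi>: "\<psi> U \<in> unitary_group N2" if "U \<in> unitary_group N1" for U
    using onto that by blast
  define rel where "rel X Y \<longleftrightarrow> X \<in> N1 \<and> Y \<in> N2 \<and>
    (\<forall>U\<in>unitary_group N1. Re (\<tau>2 (adj (\<psi> U) o\<^sub>L Y)) = Re (\<tau>1 (adj U o\<^sub>L X)))" for X Y
  have rel_add: "rel (X + X') (Y + Y')" if "rel X Y" "rel X' Y'" for X X' Y Y'
    using that A.unitaryD(1) B.unitaryD(1) \<psi> by (simp add: rel_def oL_distribs)
  have rel_scaleR: "rel (r *\<^sub>R X) (r *\<^sub>R Y)" if "rel X Y" for r X Y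
    using that A.unitaryD(1) B.unitaryD(1) \<psi> by (simp add: rel_def oL.scaleR_right)
  have rel_U: "rel U (\<psi> U)" if "U \<in> unitary_group N1" for U
    using that A.unitaryD(1) B.unitaryD(1) \<psi> inner by (simp add: rel_def)
  have rel_0: "X = 0 \<longleftrightarrow> Y = 0" if "rel X Y" for X Y
  proof
    assume "X = 0"
    show "Y = 0"
    proof (rule B.Re_inner_unitaries_eq_0)
      fix V assume "V \<in> unitary_group N2"
      then obtain U where "U \<in> unitary_group N1" "V = \<psi> U"
        using onto by blast
      then show "Re (\<tau>2 (adj V o\<^sub>L Y)) = 0"
        using \<open>rel X Y\<close> \<open>X = 0\<close> by (simp add: rel_def oL.zero_right)
    qed (use that in \<open>simp add: rel_def\<close>)
  next
    assume "Y = 0"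
    show "X = 0"
      by (rule A.Re_inner_unitaries_eq_0)
        (use \<open>rel X Y\<close> \<open>Y = 0\<close> in \<open>auto simp: rel_def oL.zero_right\<close>)
  qed
  have rel_uniq: "X = X' \<longleftrightarrow> Y = Y'" if "rel X Y" "rel X' Y'" for X X' Y Y'
    using rel_0[OF rel_add[OF that(1) rel_scaleR[OF that(2), of "- 1"]]] by simp
  have total: "\<exists>Y. rel X Y" if X: "X \<in> N1" for X
  proof -
    obtain U1 U2 U3 U4 where U: "U1 \<in> unitary_group N1" "U2 \<in> unitary_group N1"
      "U3 \<in> unitary_group N1" "U4 \<in> unitary_group N1"
      and eq: "X = (norm X / 2) *\<^sub>R ((U1 + U2) + (U3 + U4))"
      using A.unitary_span[OF X] by metis
    from U have "rel ((norm X / 2) *\<^sub>R ((U1 + U2) + (U3 + U4)))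
      ((norm X / 2) *\<^sub>R ((\<psi> U1 + \<psi> U2) + (\<psi> U3 + \<psi> U4)))"
      by (intro rel_scaleR rel_add rel_U)
    then show ?thesis
      using eq by metis
  qed
  have surj: "\<exists>X. rel X Y" if Y: "Y \<in> N2" for Y
  proof -
    obtain V1 V2 V3 V4 where V: "V1 \<in> unitary_group N2" "V2 \<in> unitary_group N2"
      "V3 \<in> unitary_group N2" "V4 \<in> unitary_group N2"
      and eq: "Y = (norm Y / 2) *\<^sub>R ((V1 + V2) + (V3 + V4))"
      using B.unitary_span[OF Y] by metis
    have "\<exists>U. rel U V" if "V \<in> unitary_group N2" for V
      using that onto rel_U by (metis imageE)
    then obtain U1 U2 U3 U4 where "rel U1 V1" "rel U2 V2" "rel U3 V3" "rel U4 V4"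
      using V by metis
    then have "rel ((norm Y / 2) *\<^sub>R ((U1 + U2) + (U3 + U4))) ((norm Y / 2) *\<^sub>R ((V1 + V2) + (V3 + V4)))"
      by (intro rel_scaleR rel_add)
    then show ?thesis
      using eq by metis
  qed
  define T where "T X = (SOME Y. rel X Y)" for X
  have T: "rel X (T X)" if "X \<in> N1" for X
    unfolding T_def using total[OF that] by (rule someI_ex)
  have T_eq: "T X = Y" if "rel X Y" for X Y
  proof -
    have "X \<in> N1"
      using that by (simp add: rel_def)
    from rel_uniq[OF T[OF this] that] show ?thesis
      by simp
  qed
  have TU: "T U = \<psi> U" if "U \<in> unitary_group N1" for U
    by (rule T_eq[OF rel_U[OF that]])
  have "real_unitary_iso N1 \<tau>1 N2 \<tau>2 T"
  proof unfold_locales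
    show "bij_betw T N1 N2"
    proof (rule bij_betwI')
      show "T X = T Y \<longleftrightarrow> X = Y" if "X \<in> N1" "Y \<in> N1" for X Y
        using rel_uniq[OF T[OF that(1)] T[OF that(2)]] by simp
      show "T X \<in> N2" if "X \<in> N1" for X
        using T[OF that] by (simp add: rel_def)
      show "\<exists>X\<in>N1. Y = T X" if "Y \<in> N2" for Y
        using surj[OF that] T_eq by (metis rel_def)
    qed
    show "T (X + Y) = T X + T Y" if "X \<in> N1" "Y \<in> N1" for X Y
      by (rule T_eq[OF rel_add[OF T[OF that(1)] T[OF that(2)]]])
    show "T (r *\<^sub>R X) = r *\<^sub>R T X" if "X \<in> N1" for r X
      by (rule T_eq[OF rel_scaleR[OF T[OF that]]])
    show "T ` unitary_group N1 = unitary_group N2"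
      using onto TU by (metis image_cong)
    show "T id_blinfun = id_blinfun"
      by (simp add: TU one)
  qed
  then show thesis
    using TU by (rule that)
qed

section \<open>Unitary-preserving real linear bijections are Jordan maps\<close>

context real_unitary_iso
begin

lemma mem [simp, intro]: "X \<in> N1 \<Longrightarrow> T X \<in> N2"
  using bij by (auto simp: bij_betw_def)

lemma unitary_image: "U \<in> unitary_group N1 \<Longrightarrow> T U \<in> unitary_group N2"
  using unitary by blast

lemma inj: "X \<in> N1 \<Longrightarrow> Y \<in> N1 \<Longrightarrow> T X = T Y \<Longrightarrow> X = Y"
  using bij by (auto simp: bij_betw_def inj_on_def)

lemma minus: "X \<in> N1 \<Longrightarrow> T (- X) = - T X"
  using scaleR[of X "- 1"] by simp

lemma diff: "X \<in> N1 \<Longrightarrow> Y \<in> N1 \<Longrightarrow> T (X - Y) = T X - T Y"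
  using add[of X "- Y"] by (simp add: minus)

lemma norm_le:
  assumes X: "X \<in> N1"
  shows "norm (T X) \<le> 2 * norm X"
proof -
  obtain U1 U2 U3 U4 where U: "U1 \<in> unitary_group N1" "U2 \<in> unitary_group N1"
    "U3 \<in> unitary_group N1" "U4 \<in> unitary_group N1"
    and eq: "X = (norm X / 2) *\<^sub>R ((U1 + U2) + (U3 + U4))"
    using A.unitary_span[OF X] by metis
  have "norm (T U) \<le> 1" if "U \<in> unitary_group N1" for U
    by (rule B.norm_unitary_le[OF unitary_image[OF that]])
  then have "norm ((T U1 + T U2) + (T U3 + T U4)) \<le> (1 + 1) + (1 + 1)"
    using U by (intro norm_triangle_le add_mono order_trans[OF norm_triangle_ineq]) auto
  moreover have "T X = (norm X / 2) *\<^sub>R ((T U1 + T U2) + (T U3 + T U4))"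
    using U[THEN A.unitaryD(1)] by (subst eq) (simp only: scaleR add A.add_mem)
  ultimately have "norm (T X) \<le> (norm X / 2) * ((1 + 1) + (1 + 1))"
    by (simp only: norm_scaleR) (intro mult_mono, auto)
  then show ?thesis
    by simp
qed

text \<open>The unitaries \<open>C n \<plusminus> i t A\<close> go to unitaries
  \<open>X n \<plusminus> t Y\<close>. At first order in \<open>t\<close>, unitarity of the images
  makes \<open>Y\<close> skew; at second order it determines the self-adjoint part of
  \<open>T (A o\<^sub>L A)\<close>.\<close>

lemma
  assumes A: "A \<in> N1" "adj A = A"
  shows adj_T_i: "adj (T (op_scaleC \<i> A)) = - T (op_scaleC \<i> A)"
    and T_square_Re: "T (A o\<^sub>L A) + adj (T (A o\<^sub>L A))
      = - (2 *\<^sub>R (T (op_scaleC \<i> A) o\<^sub>L T (op_scaleC \<i> A)))"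
proof -
  \<comment> \<open>Division by \<open>norm A + 1\<close> makes each \<open>t n *\<^sub>R A\<close>
    a contraction, as \<open>cos_part\<close> requires, and is harmless for
    \<open>A = 0\<close>.\<close>
  define t where "t n = inverse (real (Suc n)) / (norm A + 1)" for n
  define C where "C n = A.cos_part (t n *\<^sub>R A)" for n
  define X where "X n = T (C n)" for n
  define Y where "Y = T (op_scaleC \<i> A)"
  define M where "M = T (A o\<^sub>L A)"
  have nA: "0 < norm A + 1"
    by (simp add: add_nonneg_pos)
  have t0: "0 < t n" for n
    using nA by (simp add: t_def)
  have t1: "norm (t n *\<^sub>R A) \<le> 1" for n
  proof -
    have "inverse (real (Suc n)) * norm A \<le> 1 * (norm A + 1)"
      by (intro mult_mono) (auto simp: inverse_le_1_iff)
    then show ?thesis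
      using nA by (simp add: t_def)
  qed
  have tlim: "t \<longlonglongrightarrow> 0"
    using tendsto_divide[OF LIMSEQ_inverse_real_of_nat tendsto_const, of "norm A + 1"] nA
    unfolding t_def by simp
  have tA: "t n *\<^sub>R A \<in> N1" "adj (t n *\<^sub>R A) = t n *\<^sub>R A" for n
    using A by auto
  have C: "C n \<in> N1" for n
    unfolding C_def by (rule A.cos_part_mem[OF tA t1])
  have iA: "op_scaleC \<i> A \<in> N1"
    using A by simp
  have Xm: "X n \<in> bounded_ops" and Ym: "Y \<in> bounded_ops" and Mm: "M \<in> bounded_ops" for n
    using C iA A unfolding X_def Y_def M_def by auto
  have U: "X n + t n *\<^sub>R Y \<in> unitary_group N2" "X n - t n *\<^sub>R Y \<in> unitary_group N2" for n
  proof -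
    have "T (C n + op_scaleC \<i> (t n *\<^sub>R A)) \<in> unitary_group N2"
      "T (C n - op_scaleC \<i> (t n *\<^sub>R A)) \<in> unitary_group N2"
      unfolding C_def by (intro unitary_image A.cos_part_unitary[OF tA t1])+
    then show "X n + t n *\<^sub>R Y \<in> unitary_group N2" "X n - t n *\<^sub>R Y \<in> unitary_group N2"
      using C iA by (simp_all add: op_scaleC_scaleR add diff scaleR X_def Y_def)
  qed
  \<comment> \<open>Adding and subtracting the unitarity relations for the two signs separates even
    from odd terms in \<open>t\<close>.\<close>
  have sum: "(adj (X n) o\<^sub>L X n) + (t n)\<^sup>2 *\<^sub>R (adj Y o\<^sub>L Y) = id_blinfun"
    and cross: "(adj (X n) o\<^sub>L Y) + (adj Y o\<^sub>L X n) = 0" for n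
  proof -
    let ?P = "(adj (X n) o\<^sub>L X n) + (t n)\<^sup>2 *\<^sub>R (adj Y o\<^sub>L Y)"
    let ?Q = "t n *\<^sub>R ((adj (X n) o\<^sub>L Y) + (adj Y o\<^sub>L X n))"
    have "adj (X n + t n *\<^sub>R Y) o\<^sub>L (X n + t n *\<^sub>R Y) = ?P + ?Q"
      using Xm Ym by (simp add: oL_distribs oL.scaleR_left oL.scaleR_right power2_eq_square
          scaleR_add_right add_ac)
    then have p: "?P + ?Q = id_blinfun"
      using B.unitaryD(2)[OF U(1)] by simp
    have "adj (X n - t n *\<^sub>R Y) o\<^sub>L (X n - t n *\<^sub>R Y) = ?P - ?Q"
      using Xm Ym by (simp add: oL_distribs oL.scaleR_left oL.scaleR_right power2_eq_square
          scaleR_add_right algebra_simps)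
    then have m: "?P - ?Q = id_blinfun"
      using B.unitaryD(2)[OF U(2)] by simp
    have "?Q + ?Q = (?P + ?Q) - (?P - ?Q)"
      by simp
    also have "\<dots> = 0"
      unfolding p m by simp
    finally have Q: "?Q = 0"
      by (simp only: scaleR_2[symmetric] scaleR_eq_0_iff) simp
    then show "(adj (X n) o\<^sub>L Y) + (adj Y o\<^sub>L X n) = 0"
      using t0[of n] by simp
    show "?P = id_blinfun"
      using p unfolding Q by simp
  qed
  define D where "D n = (1 / (t n)\<^sup>2) *\<^sub>R (X n - id_blinfun)" for n
  have XD: "X n = id_blinfun + (t n)\<^sup>2 *\<^sub>R D n" for n
    using t0[of n] by (simp add: D_def)
  have Dm: "D n \<in> bounded_ops" for n
    using Xm by (simp add: D_def)
  \<comment> \<open>The fourth-order remainder \<open>E\<close> is mapped with a factor of at most 2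
    in norm, so the second-order quotient \<open>D n\<close> differs from \<open>- M / 2\<close> by
    a multiple of \<open>(t n)\<^sup>2\<close>.\<close>
  have approx: "norm (D n + (1 / 2) *\<^sub>R M) \<le> (2 * norm A ^ 4) * (t n)\<^sup>2" for n
  proof -
    define E where "E = C n - id_blinfun + (1 / 2) *\<^sub>R ((t n *\<^sub>R A) o\<^sub>L (t n *\<^sub>R A))"
    have E: "E \<in> N1"
      using C tA by (simp add: E_def)
    have "norm E \<le> norm (t n *\<^sub>R A) ^ 4"
      unfolding E_def C_def by (rule A.cos_part_approx[OF tA t1])
    then have "norm (T E) \<le> 2 * (t n ^ 4 * norm A ^ 4)"
      using norm_le[OF E] t0[of n] by (simp add: power_mult_distrib)
    moreover have "T E = X n - id_blinfun + ((t n)\<^sup>2 / 2) *\<^sub>R M"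
      using C A by (simp add: E_def X_def M_def add diff scaleR one oL.scaleR_left oL.scaleR_right
          power2_eq_square)
    then have "T E = (t n)\<^sup>2 *\<^sub>R (D n + (1 / 2) *\<^sub>R M)"
      using t0[of n] by (simp add: D_def scaleR_add_right)
    ultimately have "(t n)\<^sup>2 * norm (D n + (1 / 2) *\<^sub>R M) \<le> (t n)\<^sup>2 * ((2 * norm A ^ 4) * (t n)\<^sup>2)"
      by (simp add: power2_eq_square power4_eq_xxxx mult_ac)
    then show ?thesis
      using t0[of n] by simp
  qed
  have "(\<lambda>n. (2 * norm A ^ 4) * (t n)\<^sup>2) \<longlonglongrightarrow> (2 * norm A ^ 4) * 0\<^sup>2"
    by (intro tendsto_intros tlim)
  then have "(\<lambda>n. D n + (1 / 2) *\<^sub>R M) \<longlonglongrightarrow> 0"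
    using approx by (intro Lim_null_comparison[of "\<lambda>n. D n + (1 / 2) *\<^sub>R M"]) auto
  from tendsto_diff[OF this tendsto_const, of "(1 / 2) *\<^sub>R M"]
  have Dlim: "D \<longlonglongrightarrow> - ((1 / 2) *\<^sub>R M)"
    by simp
  note Dlim' = tendsto_adj[OF Dlim Dm]
  have "(\<lambda>n. id_blinfun + (t n)\<^sup>2 *\<^sub>R D n) \<longlonglongrightarrow> id_blinfun + 0\<^sup>2 *\<^sub>R - ((1 / 2) *\<^sub>R M)"
    by (intro tendsto_intros tlim Dlim)
  then have Xlim: "X \<longlonglongrightarrow> id_blinfun"
    by (simp flip: XD)
  from tendsto_adj[OF this Xm] have Xlim': "(\<lambda>n. adj (X n)) \<longlonglongrightarrow> id_blinfun"
    by simp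
  have "(\<lambda>n. (adj (X n) o\<^sub>L Y) + (adj Y o\<^sub>L X n)) \<longlonglongrightarrow> (id_blinfun o\<^sub>L Y) + (adj Y o\<^sub>L id_blinfun)"
    by (intro tendsto_add oL.tendsto Xlim Xlim' tendsto_const)
  then have "Y + adj Y = 0"
    unfolding cross by (simp add: LIMSEQ_const_iff)
  then show skew: "adj Y = - Y"
    by (simp add: eq_neg_iff_add_eq_0 add.commute)
  have "- adj (D n) - D n - (t n)\<^sup>2 *\<^sub>R (adj (D n) o\<^sub>L D n) = adj Y o\<^sub>L Y" for n
  proof -
    have "(t n)\<^sup>2 *\<^sub>R (adj Y o\<^sub>L Y) = id_blinfun - (adj (X n) o\<^sub>L X n)"
      using sum[of n] by (simp add: algebra_simps)
    also have "\<dots> = (t n)\<^sup>2 *\<^sub>R (- adj (D n) - D n - (t n)\<^sup>2 *\<^sub>R (adj (D n) o\<^sub>L D n))"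
      using Dm by (simp add: XD oL_distribs oL.scaleR_left oL.scaleR_right
          scaleR_diff_right scaleR_add_right)
    finally show ?thesis
      using t0[of n] by simp
  qed
  moreover have "(\<lambda>n. - adj (D n) - D n - (t n)\<^sup>2 *\<^sub>R (adj (D n) o\<^sub>L D n)) \<longlonglongrightarrow>
    - adj (- ((1 / 2) *\<^sub>R M)) - - ((1 / 2) *\<^sub>R M)
      - 0\<^sup>2 *\<^sub>R (adj (- ((1 / 2) *\<^sub>R M)) o\<^sub>L - ((1 / 2) *\<^sub>R M))"
    by (intro tendsto_intros oL.tendsto Dlim Dlim' tlim)
  ultimately have "(1 / 2) *\<^sub>R adj M + (1 / 2) *\<^sub>R M = adj Y o\<^sub>L Y"
    using Mm by (simp add: LIMSEQ_const_iff)
  then have "2 *\<^sub>R ((1 / 2) *\<^sub>R adj M + (1 / 2) *\<^sub>R M) = 2 *\<^sub>R (adj Y o\<^sub>L Y)"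
    by simp
  then show "M + adj M = - (2 *\<^sub>R (Y o\<^sub>L Y))"
    by (simp add: scaleR_add_right skew oL_distribs add.commute)
qed

lemma inverse_iso: "real_unitary_iso N2 \<tau>2 N1 \<tau>1 (the_inv_into N1 T)"
proof -
  let ?S = "the_inv_into N1 T"
  have inj: "inj_on T N1" and im: "T ` N1 = N2"
    using bij by (auto simp: bij_betw_def)
  have S: "?S (T X) = X" if "X \<in> N1" for X
    by (rule the_inv_into_f_f[OF inj that])
  have rep: "\<exists>X\<in>N1. Y = T X" if "Y \<in> N2" for Y
    using that im by blast
  show ?thesis
  proof unfold_locales
    show "bij_betw ?S N2 N1"
      by (rule bij_betw_the_inv_into[OF bij])
    show "?S (X + Y) = ?S X + ?S Y" if "X \<in> N2" "Y \<in> N2" for X Y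
    proof -
      obtain X' Y' where X': "X' \<in> N1" "X = T X'" and Y': "Y' \<in> N1" "Y = T Y'"
        using rep[OF \<open>X \<in> N2\<close>] rep[OF \<open>Y \<in> N2\<close>] by blast
      then show ?thesis
        by (simp add: S flip: add)
    qed
    show "?S (r *\<^sub>R X) = r *\<^sub>R ?S X" if "X \<in> N2" for r X
    proof -
      obtain X' where X': "X' \<in> N1" "X = T X'"
        using rep[OF \<open>X \<in> N2\<close>] by blast
      then show ?thesis
        by (simp add: S flip: scaleR)
    qed
    have "?S ` unitary_group N2 = (\<lambda>U. ?S (T U)) ` unitary_group N1"
      by (simp add: image_image flip: unitary)
    also have "\<dots> = (\<lambda>U. U) ` unitary_group N1"
      by (rule image_cong) (auto simp: S dest: A.unitaryD(1))
    finally show "?S ` unitary_group N2 = unitary_group N1"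
      by simp
    show "?S id_blinfun = id_blinfun"
      using S[OF A.id_mem] by (simp add: one)
  qed
qed

text \<open>Facts about values at \<open>\<i> A\<close> become, for this map, facts about
  \<open>T (- A)\<close>, so information about \<open>T\<close> on self-adjoint operators is gained.
  The left factor restores the unit.\<close>

lemma rotated_iso: "real_unitary_iso N1 \<tau>1 N2 \<tau>2 (\<lambda>X. adj (T (op_scaleC \<i> id_blinfun)) o\<^sub>L T (op_scaleC \<i> X))"
proof -
  define J where "J = T (op_scaleC \<i> id_blinfun)"
  have "J \<in> unitary_group N2"
    unfolding J_def by (intro unitary_image) simp
  then have J: "J \<in> N2" "adj J o\<^sub>L J = id_blinfun" "J o\<^sub>L adj J = id_blinfun" "adj J \<in> unitary_group N2"
    by (auto dest: B.unitaryD)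
  have cancel: "J o\<^sub>L (adj J o\<^sub>L X) = X" "adj J o\<^sub>L (J o\<^sub>L X) = X" for X
    by (simp_all add: J flip: oL_assoc)
  show ?thesis
    unfolding J_def[symmetric]
  proof unfold_locales
    show "bij_betw (\<lambda>X. adj J o\<^sub>L T (op_scaleC \<i> X)) N1 N2"
    proof (rule bij_betwI')
      show "adj J o\<^sub>L T (op_scaleC \<i> X) = adj J o\<^sub>L T (op_scaleC \<i> Y) \<longleftrightarrow> X = Y"
        if "X \<in> N1" "Y \<in> N1" for X Y
      proof
        assume "adj J o\<^sub>L T (op_scaleC \<i> X) = adj J o\<^sub>L T (op_scaleC \<i> Y)"
        then have "T (op_scaleC \<i> X) = T (op_scaleC \<i> Y)"
          by (metis cancel(1))
        then have "op_scaleC (- \<i>) (op_scaleC \<i> X) = op_scaleC (- \<i>) (op_scaleC \<i> Y)"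
          using that inj[of "op_scaleC \<i> X" "op_scaleC \<i> Y"] by simp
        then show "X = Y"
          by simp
      qed simp
      show "adj J o\<^sub>L T (op_scaleC \<i> X) \<in> N2" if "X \<in> N1" for X
        using that J by simp
      fix Y assume "Y \<in> N2"
      then have "J o\<^sub>L Y \<in> T ` N1"
        using J bij by (simp add: bij_betw_def)
      then obtain X where X: "X \<in> N1" "T X = J o\<^sub>L Y"
        by auto
      then have "Y = adj J o\<^sub>L T (op_scaleC \<i> (op_scaleC (- \<i>) X))"
        by (simp add: cancel)
      then show "\<exists>X\<in>N1. Y = adj J o\<^sub>L T (op_scaleC \<i> X)"
        using X(1) A.scaleC_mem by blast
    qed
    show "adj J o\<^sub>L T (op_scaleC \<i> (X + Y)) = (adj J o\<^sub>L T (op_scaleC \<i> X)) + (adj J o\<^sub>L T (op_scaleC \<i> Y))"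
      if "X \<in> N1" "Y \<in> N1" for X Y
      using that by (simp add: op_scaleC_add_right add oL_distribs)
    show "adj J o\<^sub>L T (op_scaleC \<i> (r *\<^sub>R X)) = r *\<^sub>R (adj J o\<^sub>L T (op_scaleC \<i> X))" if "X \<in> N1" for r X
      using that by (simp add: op_scaleC_scaleR scaleR oL.scaleR_right)
    show "adj J o\<^sub>L T (op_scaleC \<i> id_blinfun) = id_blinfun"
      unfolding J_def[symmetric] by (rule J(2))
    show "(\<lambda>X. adj J o\<^sub>L T (op_scaleC \<i> X)) ` unitary_group N1 = unitary_group N2"
    proof (intro equalityI subsetI)
      show "Y \<in> unitary_group N2" if "Y \<in> (\<lambda>X. adj J o\<^sub>L T (op_scaleC \<i> X)) ` unitary_group N1" for Y
        using that J(4) unitary_image by auto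
      fix Y assume "Y \<in> unitary_group N2"
      then have "J o\<^sub>L Y \<in> T ` unitary_group N1"
        using \<open>J \<in> unitary_group N2\<close> by (simp add: unitary)
      then obtain X where X: "X \<in> unitary_group N1" "T X = J o\<^sub>L Y"
        by auto
      then have "Y = adj J o\<^sub>L T (op_scaleC \<i> (op_scaleC (- \<i>) X))"
        by (simp add: cancel)
      moreover have "op_scaleC (- \<i>) X \<in> unitary_group N1"
        using X(1) by (intro A.unitary_scaleC) auto
      ultimately show "Y \<in> (\<lambda>X. adj J o\<^sub>L T (op_scaleC \<i> X)) ` unitary_group N1"
        by blast
    qed
  qed
qed

definition J where "J = T (op_scaleC \<i> id_blinfun)"

lemma J_skew: "adj J = - J"
  unfolding J_def by (rule adj_T_i) auto

lemma J_props: "J \<in> N2" "J o\<^sub>L J = - id_blinfun"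
proof -
  have "J \<in> unitary_group N2"
    unfolding J_def by (intro unitary_image) simp
  from B.unitaryD[OF this] show "J \<in> N2" "J o\<^sub>L J = - id_blinfun"
    by (simp_all add: J_skew oL_distribs minus_equation_iff)
qed

lemma JJ: "J o\<^sub>L (J o\<^sub>L X) = - X"
  by (simp add: J_props oL_distribs flip: oL_assoc)

text \<open>Skewness for the rotated map, solved for \<open>adj (T A)\<close>. Since the inverse of
  \<open>J\<close> is \<open>- J\<close>, the right-hand side is \<open>T A\<close> conjugated by
  \<open>J\<close>.\<close>

lemma adj_T_sa:
  assumes A: "A \<in> N1" "adj A = A"
  shows "adj (T A) = - (J o\<^sub>L (T A o\<^sub>L J))"
proof -
  interpret R: real_unitary_iso N1 \<tau>1 N2 \<tau>2 "\<lambda>X. adj J o\<^sub>L T (op_scaleC \<i> X)"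
    unfolding J_def by (rule rotated_iso)
  have "adj (adj J o\<^sub>L T (- A)) = - (adj J o\<^sub>L T (- A))"
    using R.adj_T_i[OF A] by simp
  then have "adj (J o\<^sub>L T A) = - (J o\<^sub>L T A)"
    using A J_props(1) by (simp add: J_skew minus oL_distribs)
  then have "adj (T A) o\<^sub>L J = J o\<^sub>L T A"
    using A J_props(1) by (simp add: J_skew oL_distribs)
  then have "(adj (T A) o\<^sub>L J) o\<^sub>L J = (J o\<^sub>L T A) o\<^sub>L J"
    by simp
  then have "- adj (T A) = J o\<^sub>L (T A o\<^sub>L J)"
    by (simp add: oL_assoc J_props oL_distribs)
  then show ?thesis
    by (metis minus_minus)
qed

text \<open>The self-adjoint part of \<open>M\<close> is half of \<open>M\<close> plus its conjugate
  under \<open>J\<close>. As \<open>J\<^sup>2 = - 1\<close>, that sum is invariant under conjugation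
  by \<open>J\<close>.\<close>

lemma J_commutes_T_i_square:
  assumes A: "A \<in> N1" "adj A = A"
  shows "J o\<^sub>L (T (op_scaleC \<i> A) o\<^sub>L T (op_scaleC \<i> A)) = (T (op_scaleC \<i> A) o\<^sub>L T (op_scaleC \<i> A)) o\<^sub>L J"
proof -
  define M where "M = T (A o\<^sub>L A)"
  define K where "K = T (op_scaleC \<i> A) o\<^sub>L T (op_scaleC \<i> A)"
  have "adj M = - (J o\<^sub>L (M o\<^sub>L J))"
    unfolding M_def using A by (intro adj_T_sa) auto
  then have "M - (J o\<^sub>L (M o\<^sub>L J)) = - (2 *\<^sub>R K)"
    using T_square_Re[OF A] by (simp add: M_def K_def)
  then have K: "(- 2) *\<^sub>R K = M - (J o\<^sub>L (M o\<^sub>L J))"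
    by simp
  have "(- 2) *\<^sub>R (J o\<^sub>L K) = J o\<^sub>L (M - (J o\<^sub>L (M o\<^sub>L J)))"
    by (simp add: oL.scaleR_right oL_distribs flip: K)
  also have "\<dots> = (M - (J o\<^sub>L (M o\<^sub>L J))) o\<^sub>L J"
    by (simp add: oL_distribs JJ oL_assoc J_props)
  also have "\<dots> = (- 2) *\<^sub>R (K o\<^sub>L J)"
    by (simp add: oL.scaleR_left oL_distribs flip: K)
  finally show ?thesis
    by (simp add: K_def)
qed

lemma J_scalar: "\<exists>j. (j = \<i> \<or> j = - \<i>) \<and> J = op_scaleC j id_blinfun"
proof -
  interpret S: real_unitary_iso N2 \<tau>2 N1 \<tau>1 "the_inv_into N1 T"
    by (rule inverse_iso)
  have sq: "J o\<^sub>L (B o\<^sub>L B) = (B o\<^sub>L B) o\<^sub>L J" if B: "B \<in> N2" "adj B = B" for B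
  proof -
    \<comment> \<open>Skewness for the inverse map shows that \<open>\<i> B\<close> is the image of
      \<open>\<i> A\<close> with \<open>A\<close> self-adjoint. So \<open>- (B o\<^sub>L B)\<close>
      is one of the squares with which \<open>J\<close> is known to commute.\<close>
    define K where "K = the_inv_into N1 T (op_scaleC \<i> B)"
    have K: "K \<in> N1" "adj K = - K"
      using B S.adj_T_i[OF B] by (auto simp: K_def)
    have TK: "T K = op_scaleC \<i> B"
      unfolding K_def using bij B by (intro f_the_inv_into_f) (auto simp: bij_betw_def)
    define A where "A = op_scaleC (- \<i>) K"
    have A: "A \<in> N1" "adj A = A" "op_scaleC \<i> A = K"
      using K by (simp_all add: A_def)
    from J_commutes_T_i_square[OF A(1,2)] show ?thesis
      unfolding A(3) TK using B J_props(1) by (simp add: oL_distribs)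
  qed
  have sa: "J o\<^sub>L B = B o\<^sub>L J" if B: "B \<in> N2" "adj B = B" for B
  proof -
    \<comment> \<open>Polarization against the identity passes from squares to \<open>B\<close>
      itself.\<close>
    have "J o\<^sub>L ((B + id_blinfun) o\<^sub>L (B + id_blinfun)) = ((B + id_blinfun) o\<^sub>L (B + id_blinfun)) o\<^sub>L J"
      using B by (intro sq) auto
    then have "(J o\<^sub>L B) + (J o\<^sub>L B) = (B o\<^sub>L J) + (B o\<^sub>L J)"
      using sq[OF B] by (simp add: oL_distribs)
    then show ?thesis
      by (simp flip: scaleR_2)
  qed
  have "J o\<^sub>L X = X o\<^sub>L J" if X: "X \<in> N2" for X
  proof -
    have "J o\<^sub>L (X + adj X) = (X + adj X) o\<^sub>L J"
      using X by (intro sa) (auto simp: add.commute)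
    moreover have "J o\<^sub>L op_scaleC \<i> (X - adj X) = op_scaleC \<i> (X - adj X) o\<^sub>L J"
      using X by (intro sa) (auto simp: op_scaleC_diff_right)
    then have "op_scaleC (- \<i>) (op_scaleC \<i> (J o\<^sub>L (X - adj X)))
        = op_scaleC (- \<i>) (op_scaleC \<i> ((X - adj X) o\<^sub>L J))"
      using J_props(1) by simp
    then have "J o\<^sub>L (X - adj X) = (X - adj X) o\<^sub>L J"
      by simp
    ultimately have "(J o\<^sub>L (X + adj X)) + (J o\<^sub>L (X - adj X)) = ((X + adj X) o\<^sub>L J) + ((X - adj X) o\<^sub>L J)"
      by simp
    then have "2 *\<^sub>R (J o\<^sub>L X) = 2 *\<^sub>R (X o\<^sub>L J)"
      by (simp add: oL_distribs scaleR_2)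
    then show ?thesis
      by simp
  qed
  then obtain j where j: "J = op_scaleC j id_blinfun"
    using B.center_scalar J_props(1) by blast
  have "op_scaleC (j * j) id_blinfun = op_scaleC (- 1) (id_blinfun :: 'k \<Rightarrow>\<^sub>L 'k)"
    using J_props(2) by (simp add: j)
  then have "j * j = - 1"
    by (simp only: B.scalar_eq_iff)
  then have "(j - \<i>) * (j + \<i>) = 0"
    by (simp add: algebra_simps)
  then have "j = \<i> \<or> j = - \<i>"
    by (simp add: eq_neg_iff_add_eq_0)
  with j show ?thesis
    by blast
qed

lemma jordan:
  obtains j where "j = \<i> \<or> j = - \<i>" "\<And>X. X \<in> N1 \<Longrightarrow> T (op_scaleC \<i> X) = op_scaleC j (T X)"
    "\<And>X. X \<in> N1 \<Longrightarrow> T (adj X) = adj (T X)" "\<And>X. X \<in> N1 \<Longrightarrow> T (X o\<^sub>L X) = T X o\<^sub>L T X"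
proof -
  obtain j where j: "j = \<i> \<or> j = - \<i>" and J: "J = op_scaleC j id_blinfun"
    using J_scalar by blast
  have jj: "j * j = - 1" and cj: "cnj j = - j"
    using j by auto
  interpret R: real_unitary_iso N1 \<tau>1 N2 \<tau>2 "\<lambda>X. adj J o\<^sub>L T (op_scaleC \<i> X)"
    unfolding J_def by (rule rotated_iso)
  have sa: "adj (T A) = T A" if A: "A \<in> N1" "adj A = A" for A
    using adj_T_sa[OF A] A by (simp add: J jj)
  have sq1: "T (A o\<^sub>L A) = - (T (op_scaleC \<i> A) o\<^sub>L T (op_scaleC \<i> A))" if A: "A \<in> N1" "adj A = A" for A
  proof -
    have "2 *\<^sub>R T (A o\<^sub>L A) = 2 *\<^sub>R - (T (op_scaleC \<i> A) o\<^sub>L T (op_scaleC \<i> A))"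
      using T_square_Re[OF A] sa[of "A o\<^sub>L A"] A by (simp add: scaleR_2)
    then show ?thesis
      unfolding scaleR_cancel_left by simp
  qed
  \<comment> \<open>\<open>T_square_Re\<close> for the rotated map: with \<open>J\<close> scalar,
    its left side involves \<open>T (\<i> A\<^sup>2)\<close> and its right side
    \<open>T A o\<^sub>L T A\<close>.\<close>
  have sq2: "T (op_scaleC \<i> (A o\<^sub>L A)) = op_scaleC j (T A o\<^sub>L T A)" if A: "A \<in> N1" "adj A = A" for A
  proof -
    define Z where "Z = T (op_scaleC \<i> (A o\<^sub>L A))"
    have Z: "adj Z = - Z" "Z \<in> N2"
      unfolding Z_def using A by (auto intro: adj_T_i)
    have "op_scaleC (- j) Z + adj (op_scaleC (- j) Z)
        = - (2 *\<^sub>R (op_scaleC (- j) (T (- A)) o\<^sub>L op_scaleC (- j) (T (- A))))"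
      using R.T_square_Re[OF A] by (simp add: J cj Z_def oL_distribs)
    then have "2 *\<^sub>R op_scaleC (- j) Z = 2 *\<^sub>R (T A o\<^sub>L T A)"
      using Z A by (simp add: cj minus oL_distribs jj scaleR_2)
    then have "op_scaleC (- j) Z = T A o\<^sub>L T A"
      unfolding scaleR_cancel_left by simp
    then have "op_scaleC j (op_scaleC (- j) Z) = op_scaleC j (T A o\<^sub>L T A)"
      by simp
    then show ?thesis
      by (simp add: jj Z_def)
  qed
  \<comment> \<open>Replacing \<open>A\<close> by \<open>A + 1\<close> in the quadratic identity
    isolates its linear term; homogeneity under \<open>\<i>\<close> comes out of this
    comparison.\<close>
  have ci: "T (op_scaleC \<i> A) = op_scaleC j (T A)" if A: "A \<in> N1" "adj A = A" for A
  proof -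
    have "T (op_scaleC \<i> ((A + id_blinfun) o\<^sub>L (A + id_blinfun)))
        = op_scaleC j (T (A + id_blinfun) o\<^sub>L T (A + id_blinfun))"
      using A by (intro sq2) auto
    then have "T (op_scaleC \<i> (A o\<^sub>L A)) + (T (op_scaleC \<i> A) + (T (op_scaleC \<i> A) + J))
        = op_scaleC j (T A o\<^sub>L T A) + (op_scaleC j (T A) + (op_scaleC j (T A) + op_scaleC j id_blinfun))"
      using A by (simp add: oL_distribs op_scaleC_add_right add one J_def add.assoc)
    then have "2 *\<^sub>R T (op_scaleC \<i> A) = 2 *\<^sub>R op_scaleC j (T A)"
      using sq2[OF A] by (simp add: J scaleR_2)
    then show ?thesis
      by simp
  qed
  have sq: "T (A o\<^sub>L A) = T A o\<^sub>L T A" if A: "A \<in> N1" "adj A = A" for A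
    using sq1[OF A] A by (simp add: ci[OF A] jj)
  have dec: "\<exists>A B. A \<in> N1 \<and> adj A = A \<and> B \<in> N1 \<and> adj B = B \<and> X = A + op_scaleC \<i> B" if X: "X \<in> N1" for X
  proof (intro exI conjI)
    let ?A = "(1 / 2) *\<^sub>R (X + adj X)" and ?B = "(1 / 2) *\<^sub>R op_scaleC (- \<i>) (X - adj X)"
    show "?A \<in> N1" "adj ?A = ?A" "?B \<in> N1" "adj ?B = ?B"
      using X by (auto simp: add.commute op_scaleC_diff_right)
    show "X = ?A + op_scaleC \<i> ?B"
      by (simp add: op_scaleC_scaleR scaleR_add_right scaleR_diff_right flip: scaleR_add_left)
  qed
  show thesis
  proof (rule that[OF j])
    fix X assume "X \<in> N1"
    then obtain A B where A: "A \<in> N1" "adj A = A" and B: "B \<in> N1" "adj B = B"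
      and X: "X = A + op_scaleC \<i> B"
      using dec by metis
    have TX: "T X = T A + op_scaleC j (T B)"
      using A B by (simp add: X add ci)
    have "T (op_scaleC \<i> X) = T (op_scaleC \<i> A) + T (- B)"
      using A B by (simp add: X op_scaleC_add_right flip: add)
    then show "T (op_scaleC \<i> X) = op_scaleC j (T X)"
      using A B by (simp add: TX ci minus op_scaleC_add_right jj)
    have "T (adj X) = T A + T (- op_scaleC \<i> B)"
      using A B by (simp add: X diff minus)
    then show "T (adj X) = adj (T X)"
      using A B by (simp add: TX minus ci sa cj)
    \<comment> \<open>The Jordan product of the real and imaginary parts is self-adjoint, and it is
      the imaginary part of \<open>X o\<^sub>L X\<close>; its image follows from the squares of
      \<open>A\<close>, \<open>B\<close> and \<open>A + B\<close>.\<close>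
    define Q where "Q = (A o\<^sub>L B) + (B o\<^sub>L A)"
    have Q: "Q \<in> N1" "adj Q = Q"
      using A B by (auto simp: Q_def add.commute)
    have "(A + B) o\<^sub>L (A + B) = ((A o\<^sub>L A) + (B o\<^sub>L B)) + Q"
      by (simp add: Q_def oL_distribs add_ac)
    then have "T ((A + B) o\<^sub>L (A + B)) = (T (A o\<^sub>L A) + T (B o\<^sub>L B)) + T Q"
      using A B Q by (simp add: add)
    moreover have "T ((A + B) o\<^sub>L (A + B)) = (T A + T B) o\<^sub>L (T A + T B)"
      using A B sq[of "A + B"] by (simp add: add)
    ultimately have TQ: "T Q = (T A o\<^sub>L T B) + (T B o\<^sub>L T A)"
      using A B by (simp add: sq oL_distribs algebra_simps)
    have "X o\<^sub>L X = ((A o\<^sub>L A) - (B o\<^sub>L B)) + op_scaleC \<i> Q"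
      using A B by (simp add: X Q_def oL_distribs op_scaleC_add_right)
    then have "T (X o\<^sub>L X) = ((T A o\<^sub>L T A) - (T B o\<^sub>L T B)) + op_scaleC j (T Q)"
      using A B Q by (simp add: add diff sq ci)
    also have "\<dots> = T X o\<^sub>L T X"
      using A B by (simp add: TX TQ oL_distribs op_scaleC_add_right jj)
    finally show "T (X o\<^sub>L X) = T X o\<^sub>L T X" .
  qed
qed

end

section \<open>Jordan maps onto factors\<close>

context finite_factor_pair
begin

text \<open>Three swaps carry \<open>a r a s b\<close> to its negative, so
  \<open>(a r a) s b = 0\<close> for all \<open>s\<close>. Primeness removes \<open>b\<close>, and a
  second use of primeness on \<open>a r a = 0\<close> removes \<open>a\<close>.\<close>

lemma symmetric_product_eq_0:
  assumes a: "a \<in> N" and b: "b \<in> N" and r: "\<And>r. r \<in> N \<Longrightarrow> (a o\<^sub>L (r o\<^sub>L b)) + (b o\<^sub>L (r o\<^sub>L a)) = 0"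
  shows "a = 0 \<or> b = 0"
proof (rule disjCI)
  assume "b \<noteq> 0"
  have swap: "b o\<^sub>L (r o\<^sub>L a) = - (a o\<^sub>L (r o\<^sub>L b))" if "r \<in> N" for r
    using assms(3)[OF that] by (simp add: eq_neg_iff_add_eq_0 add.commute)
  have ara: "a o\<^sub>L (r o\<^sub>L a) = 0" if r: "r \<in> N" for r
  proof -
    have "(a o\<^sub>L (r o\<^sub>L a)) o\<^sub>L (s o\<^sub>L b) = 0" if s: "s \<in> N" for s
    proof -
      have "a o\<^sub>L (r o\<^sub>L (a o\<^sub>L (s o\<^sub>L b))) = - (b o\<^sub>L ((r o\<^sub>L (a o\<^sub>L s)) o\<^sub>L a))"
        using swap[of "r o\<^sub>L (a o\<^sub>L s)"] a r s by (simp add: oL_assoc)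
      also have "\<dots> = - ((b o\<^sub>L (r o\<^sub>L a)) o\<^sub>L (s o\<^sub>L a))"
        by (simp add: oL_assoc)
      also have "\<dots> = (a o\<^sub>L (r o\<^sub>L b)) o\<^sub>L (s o\<^sub>L a)"
        by (simp only: swap[OF r] oL.minus_left minus_minus)
      also have "\<dots> = a o\<^sub>L (r o\<^sub>L (b o\<^sub>L (s o\<^sub>L a)))"
        by (simp add: oL_assoc)
      also have "\<dots> = - (a o\<^sub>L (r o\<^sub>L (a o\<^sub>L (s o\<^sub>L b))))"
        by (simp add: swap[OF s] oL_distribs)
      finally have "2 *\<^sub>R (a o\<^sub>L (r o\<^sub>L (a o\<^sub>L (s o\<^sub>L b)))) = 0"
        unfolding scaleR_2 eq_neg_iff_add_eq_0 .
      then show ?thesis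
        by (simp add: oL_assoc)
    qed
    then have "a o\<^sub>L (r o\<^sub>L a) = 0 \<or> b = 0"
      using a b r by (intro factor_prime) (auto simp: oL_assoc)
    with \<open>b \<noteq> 0\<close> show ?thesis
      by simp
  qed
  then have "a = 0 \<or> a = 0"
    using a by (intro factor_prime) (auto simp: oL_assoc)
  then show "a = 0"
    by simp
qed

end

text \<open>A group is not the union of two proper subgroups; the subgroup property enters as
  cancellation. It makes a choice between two alternatives uniform.\<close>

lemma union_of_two_additive_subgroups:
  assumes "\<And>x. x \<in> G \<Longrightarrow> P x \<or> Q x"
    and G: "\<And>x y. x \<in> G \<Longrightarrow> y \<in> G \<Longrightarrow> x + y \<in> (G :: 'a::ab_group_add set)"
    and P: "\<And>x y. x \<in> G \<Longrightarrow> y \<in> G \<Longrightarrow> P (x + y) \<Longrightarrow> P x \<Longrightarrow> P y"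
    and Q: "\<And>x y. x \<in> G \<Longrightarrow> y \<in> G \<Longrightarrow> Q (x + y) \<Longrightarrow> Q x \<Longrightarrow> Q y"
  shows "(\<forall>x\<in>G. P x) \<or> (\<forall>x\<in>G. Q x)"
proof (rule ccontr)
  assume "\<not> ?thesis"
  then obtain x y where x: "x \<in> G" "\<not> P x" and y: "y \<in> G" "\<not> Q y"
    by blast
  then have "Q x" "P y"
    using assms(1) by blast+
  moreover have "P (y + x) \<or> Q (x + y)"
    using assms(1)[OF G[OF x(1) y(1)]] by (simp add: add.commute)
  ultimately show False
    using P[of y x] Q[of x y] x y by blast
qed

text \<open>
  Herstein's theorem: with \<open>d = \<phi>(ab) - \<phi>(a)\<phi>(b)\<close> and \<open>d' = \<phi>(ab) - \<phi>(b)\<phi>(a)\<close>, applying \<open>\<phi>\<close>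
  to \<open>(ab) r (ba) + (ba) r (ab) = a (b r b) a + b (a r a) b\<close> yields \<open>d r d' + d' r d = 0\<close>.
\<close>

lemma jordan_iso_or_anti_iso:
  fixes N1 :: "('h::complex_hilbert \<Rightarrow>\<^sub>L 'h) set" and N2 :: "('k::complex_hilbert \<Rightarrow>\<^sub>L 'k) set"
  assumes "finite_factor N1 \<tau>1" and "finite_factor N2 \<tau>2"
    and \<phi>: "star_linear_bij N1 N2 \<phi>" and sq: "\<And>X. X \<in> N1 \<Longrightarrow> \<phi> (X o\<^sub>L X) = \<phi> X o\<^sub>L \<phi> X"
  shows "star_isomorphism N1 N2 \<phi> \<or> star_anti_isomorphism N1 N2 \<phi>"
proof -
  interpret A: finite_factor_pair N1 \<tau>1
    by standard fact
  interpret B: finite_factor_pair N2 \<tau>2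
    by standard fact
  have add: "\<phi> (X + Y) = \<phi> X + \<phi> Y" if "X \<in> N1" "Y \<in> N1" for X Y
    using \<phi> that by (simp add: star_linear_bij_def)
  have mem [simp]: "\<phi> X \<in> N2" if "X \<in> N1" for X
    using \<phi> that by (auto simp: star_linear_bij_def bij_betw_def)
  have onto: "\<exists>X\<in>N1. Y = \<phi> X" if "Y \<in> N2" for Y
    using \<phi> that by (auto simp: star_linear_bij_def bij_betw_def)
  have jord: "\<phi> ((X o\<^sub>L Y) + (Y o\<^sub>L X)) = (\<phi> X o\<^sub>L \<phi> Y) + (\<phi> Y o\<^sub>L \<phi> X)" if X: "X \<in> N1" and Y: "Y \<in> N1" for X Y
  proof -
    have "(X + Y) o\<^sub>L (X + Y) = ((X o\<^sub>L X) + (Y o\<^sub>L Y)) + ((X o\<^sub>L Y) + (Y o\<^sub>L X))"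
      by (simp add: oL_distribs add_ac)
    then have "\<phi> ((X + Y) o\<^sub>L (X + Y)) = (\<phi> (X o\<^sub>L X) + \<phi> (Y o\<^sub>L Y)) + \<phi> ((X o\<^sub>L Y) + (Y o\<^sub>L X))"
      using X Y by (simp only: add A.add_mem A.oL_mem)
    moreover have "\<phi> ((X + Y) o\<^sub>L (X + Y)) = (\<phi> X + \<phi> Y) o\<^sub>L (\<phi> X + \<phi> Y)"
      using X Y sq[of "X + Y"] add by simp
    ultimately have "\<phi> ((X o\<^sub>L Y) + (Y o\<^sub>L X)) = ((\<phi> X + \<phi> Y) o\<^sub>L (\<phi> X + \<phi> Y)) - ((\<phi> X o\<^sub>L \<phi> X) + (\<phi> Y o\<^sub>L \<phi> Y))"
      using X Y by (simp add: sq)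
    also have "\<dots> = (\<phi> X o\<^sub>L \<phi> Y) + (\<phi> Y o\<^sub>L \<phi> X)"
      by (simp add: oL_distribs)
    finally show ?thesis .
  qed
  have aba: "\<phi> (X o\<^sub>L (Y o\<^sub>L X)) = \<phi> X o\<^sub>L (\<phi> Y o\<^sub>L \<phi> X)" if X: "X \<in> N1" and Y: "Y \<in> N1" for X Y
  proof -
    define Z where "Z = (X o\<^sub>L Y) + (Y o\<^sub>L X)"
    define W where "W = X o\<^sub>L X"
    define V where "V = X o\<^sub>L (Y o\<^sub>L X)"
    have m: "Z \<in> N1" "W \<in> N1" "V \<in> N1"
      using X Y by (auto simp: Z_def W_def V_def)
    \<comment> \<open>Taking the Jordan product with \<open>X\<close> twice and removing the one
      with \<open>X\<^sup>2\<close> leaves \<open>2 X Y X\<close>, so this triple product is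
      expressible by Jordan products.\<close>
    have "(X o\<^sub>L Z) + (Z o\<^sub>L X) = ((W o\<^sub>L Y) + (Y o\<^sub>L W)) + (V + V)"
      by (simp add: Z_def W_def V_def oL_distribs oL_assoc add_ac)
    then have "\<phi> ((X o\<^sub>L Z) + (Z o\<^sub>L X)) = \<phi> ((W o\<^sub>L Y) + (Y o\<^sub>L W)) + (\<phi> V + \<phi> V)"
      using m Y by (simp only: add A.add_mem A.oL_mem)
    then have "(\<phi> X o\<^sub>L \<phi> Z) + (\<phi> Z o\<^sub>L \<phi> X) = ((\<phi> W o\<^sub>L \<phi> Y) + (\<phi> Y o\<^sub>L \<phi> W)) + (\<phi> V + \<phi> V)"
      using X Y m by (simp only: jord)
    moreover have "\<phi> Z = (\<phi> X o\<^sub>L \<phi> Y) + (\<phi> Y o\<^sub>L \<phi> X)" "\<phi> W = \<phi> X o\<^sub>L \<phi> X"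
      using X Y by (simp_all add: Z_def W_def jord sq)
    ultimately have "2 *\<^sub>R \<phi> V = 2 *\<^sub>R (\<phi> X o\<^sub>L (\<phi> Y o\<^sub>L \<phi> X))"
      by (simp add: oL_distribs oL_assoc scaleR_2 add_ac)
    then show ?thesis
      by (simp add: V_def)
  qed
  have abc: "\<phi> ((X o\<^sub>L (R o\<^sub>L Y)) + (Y o\<^sub>L (R o\<^sub>L X)))
      = (\<phi> X o\<^sub>L (\<phi> R o\<^sub>L \<phi> Y)) + (\<phi> Y o\<^sub>L (\<phi> R o\<^sub>L \<phi> X))"
    if X: "X \<in> N1" and Y: "Y \<in> N1" and R: "R \<in> N1" for X Y R
  proof -
    let ?Q = "(X o\<^sub>L (R o\<^sub>L Y)) + (Y o\<^sub>L (R o\<^sub>L X))"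
    have "(X + Y) o\<^sub>L (R o\<^sub>L (X + Y)) = ((X o\<^sub>L (R o\<^sub>L X)) + (Y o\<^sub>L (R o\<^sub>L Y))) + ?Q"
      by (simp add: oL_distribs add_ac)
    then have "\<phi> ((X + Y) o\<^sub>L (R o\<^sub>L (X + Y))) = (\<phi> (X o\<^sub>L (R o\<^sub>L X)) + \<phi> (Y o\<^sub>L (R o\<^sub>L Y))) + \<phi> ?Q"
      using X Y R by (simp only: add A.add_mem A.oL_mem)
    moreover have "\<phi> ((X + Y) o\<^sub>L (R o\<^sub>L (X + Y))) = (\<phi> X + \<phi> Y) o\<^sub>L (\<phi> R o\<^sub>L (\<phi> X + \<phi> Y))"
      using X Y R aba[of "X + Y" R] add by simp
    ultimately have "\<phi> ?Q = ((\<phi> X + \<phi> Y) o\<^sub>L (\<phi> R o\<^sub>L (\<phi> X + \<phi> Y)))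
        - ((\<phi> X o\<^sub>L (\<phi> R o\<^sub>L \<phi> X)) + (\<phi> Y o\<^sub>L (\<phi> R o\<^sub>L \<phi> Y)))"
      using X Y R by (simp add: aba)
    also have "\<dots> = (\<phi> X o\<^sub>L (\<phi> R o\<^sub>L \<phi> Y)) + (\<phi> Y o\<^sub>L (\<phi> R o\<^sub>L \<phi> X))"
      by (simp add: oL_distribs)
    finally show ?thesis .
  qed
  have local: "\<phi> (a o\<^sub>L b) - (\<phi> a o\<^sub>L \<phi> b) = 0 \<or> \<phi> (a o\<^sub>L b) - (\<phi> b o\<^sub>L \<phi> a) = 0"
    if a: "a \<in> N1" and b: "b \<in> N1" for a b
  proof (rule B.symmetric_product_eq_0)
    define x where "x = \<phi> (a o\<^sub>L b)"
    define u where "u = \<phi> a o\<^sub>L \<phi> b"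
    define v where "v = \<phi> b o\<^sub>L \<phi> a"
    fix R assume "R \<in> N2"
    then obtain r where r: "r \<in> N1" "R = \<phi> r"
      using onto by blast
    \<comment> \<open>The Jordan product fixes \<open>\<phi>(ab) + \<phi>(ba)\<close>, so
      \<open>\<phi>(ba)\<close> can be eliminated in favour of \<open>x\<close>.\<close>
    have y: "\<phi> (b o\<^sub>L a) = u + v - x"
      using jord[OF a b] a b by (simp add: add u_def v_def x_def eq_diff_eq add.commute)
    have "((a o\<^sub>L b) o\<^sub>L (r o\<^sub>L (b o\<^sub>L a))) + ((b o\<^sub>L a) o\<^sub>L (r o\<^sub>L (a o\<^sub>L b)))
        = (a o\<^sub>L ((b o\<^sub>L (r o\<^sub>L b)) o\<^sub>L a)) + (b o\<^sub>L ((a o\<^sub>L (r o\<^sub>L a)) o\<^sub>L b))"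
      by (simp add: oL_assoc)
    then have "\<phi> (((a o\<^sub>L b) o\<^sub>L (r o\<^sub>L (b o\<^sub>L a))) + ((b o\<^sub>L a) o\<^sub>L (r o\<^sub>L (a o\<^sub>L b))))
        = \<phi> (a o\<^sub>L ((b o\<^sub>L (r o\<^sub>L b)) o\<^sub>L a)) + \<phi> (b o\<^sub>L ((a o\<^sub>L (r o\<^sub>L a)) o\<^sub>L b))"
      using a b r by (simp only: add A.oL_mem)
    then have "(x o\<^sub>L (R o\<^sub>L (u + v - x))) + ((u + v - x) o\<^sub>L (R o\<^sub>L x))
        = (\<phi> a o\<^sub>L ((\<phi> b o\<^sub>L (R o\<^sub>L \<phi> b)) o\<^sub>L \<phi> a)) + (\<phi> b o\<^sub>L ((\<phi> a o\<^sub>L (R o\<^sub>L \<phi> a)) o\<^sub>L \<phi> b))"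
      using a b r by (simp only: abc aba A.oL_mem y x_def[symmetric])
    also have "\<dots> = (u o\<^sub>L (R o\<^sub>L v)) + (v o\<^sub>L (R o\<^sub>L u))"
      by (simp add: u_def v_def oL_assoc)
    finally have "((x o\<^sub>L (R o\<^sub>L (u + v - x))) + ((u + v - x) o\<^sub>L (R o\<^sub>L x)))
        - ((u o\<^sub>L (R o\<^sub>L v)) + (v o\<^sub>L (R o\<^sub>L u))) = 0"
      by simp
    then have "- (((x - u) o\<^sub>L (R o\<^sub>L (x - v))) + ((x - v) o\<^sub>L (R o\<^sub>L (x - u)))) = 0"
      by (simp add: oL_distribs algebra_simps)
    then show "((\<phi> (a o\<^sub>L b) - (\<phi> a o\<^sub>L \<phi> b)) o\<^sub>L (R o\<^sub>L (\<phi> (a o\<^sub>L b) - (\<phi> b o\<^sub>L \<phi> a))))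
        + ((\<phi> (a o\<^sub>L b) - (\<phi> b o\<^sub>L \<phi> a)) o\<^sub>L (R o\<^sub>L (\<phi> (a o\<^sub>L b) - (\<phi> a o\<^sub>L \<phi> b)))) = 0"
      unfolding neg_equal_0_iff_equal x_def u_def v_def .
  qed (use a b in auto)
  \<comment> \<open>The alternative is made uniform in \<open>b\<close> for each fixed
    \<open>a\<close>, and after that in \<open>a\<close>.\<close>
  have "(\<forall>b\<in>N1. \<phi> (a o\<^sub>L b) = \<phi> a o\<^sub>L \<phi> b) \<or> (\<forall>b\<in>N1. \<phi> (a o\<^sub>L b) = \<phi> b o\<^sub>L \<phi> a)" if a: "a \<in> N1" for a
    using local[OF a] a by (intro union_of_two_additive_subgroups) (auto simp: oL_distribs add)
  then have "(\<forall>a\<in>N1. \<forall>b\<in>N1. \<phi> (a o\<^sub>L b) = \<phi> a o\<^sub>L \<phi> b) \<or> (\<forall>a\<in>N1. \<forall>b\<in>N1. \<phi> (a o\<^sub>L b) = \<phi> b o\<^sub>L \<phi> a)"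
    by (intro union_of_two_additive_subgroups) (auto simp: oL_distribs add)
  then show ?thesis
    using \<phi> by (auto simp: star_isomorphism_def star_anti_isomorphism_def)
qed

theorem theorem1p1:
  fixes N1 :: "('h::complex_hilbert \<Rightarrow>\<^sub>L 'h) set" and \<tau>1 :: "('h \<Rightarrow>\<^sub>L 'h) \<Rightarrow> complex"
    and N2 :: "('k::complex_hilbert \<Rightarrow>\<^sub>L 'k) set" and \<tau>2 :: "('k \<Rightarrow>\<^sub>L 'k) \<Rightarrow> complex"
    and \<psi> :: "('h \<Rightarrow>\<^sub>L 'h) \<Rightarrow> ('k \<Rightarrow>\<^sub>L 'k)" and p :: real
  assumes "0 < p"
    and "finite_factor N1 \<tau>1" and "finite_factor N2 \<tau>2"
    and "Lp_isometry p N1 \<tau>1 N2 \<tau>2 \<psi>"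
    and "\<psi> ` unitary_group N1 = unitary_group N2"
  shows "\<exists>W\<in>unitary_group N2. \<exists>\<phi>.
    (star_isomorphism N1 N2 \<phi> \<or> star_anti_isomorphism N1 N2 \<phi>) \<and>
    ((\<forall>U\<in>unitary_group N1. \<psi> U = W o\<^sub>L \<phi> U) \<or>
     (\<forall>U\<in>unitary_group N1. \<psi> U = W o\<^sub>L \<phi> (adj U)))"
proof -
  interpret A: finite_factor_pair N1 \<tau>1
    by standard fact
  interpret B: finite_factor_pair N2 \<tau>2
    by standard fact
  have \<psi>: "\<psi> U \<in> unitary_group N2" if "U \<in> unitary_group N1" for U
    using assms(5) that by blast
  define W where "W = \<psi> id_blinfun"
  have W: "W \<in> unitary_group N2"
    unfolding W_def by (intro \<psi>) simp
  note W' = B.unitaryD[OF W]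
  have cancel: "W o\<^sub>L (adj W o\<^sub>L X) = X" "adj W o\<^sub>L (W o\<^sub>L X) = X" for X
    by (simp_all add: W' flip: oL_assoc)
  \<comment> \<open>Left translation by \<open>adj W\<close> fixes the identity and leaves
    \<open>adj (\<psi> U) o\<^sub>L \<psi> V\<close> unchanged.\<close>
  define \<theta> where "\<theta> U = adj W o\<^sub>L \<psi> U" for U
  have "\<theta> ` unitary_group N1 = unitary_group N2"
  proof (intro equalityI subsetI)
    show "Y \<in> unitary_group N2" if "Y \<in> \<theta> ` unitary_group N1" for Y
      using that W \<psi> by (auto simp: \<theta>_def)
    fix Y assume "Y \<in> unitary_group N2"
    then have "W o\<^sub>L Y \<in> \<psi> ` unitary_group N1"
      using W by (simp add: assms(5))
    then obtain U where U: "U \<in> unitary_group N1" "W o\<^sub>L Y = \<psi> U"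
      by blast
    then have "\<theta> U = Y"
      by (simp add: \<theta>_def cancel flip: U(2))
    then show "Y \<in> \<theta> ` unitary_group N1"
      using U(1) by blast
  qed
  moreover have "\<theta> id_blinfun = id_blinfun"
    unfolding \<theta>_def W_def[symmetric] by (rule W'(2))
  moreover have "Re (\<tau>2 (adj (\<theta> U) o\<^sub>L \<theta> V)) = Re (\<tau>1 (adj U o\<^sub>L V))"
    if "U \<in> unitary_group N1" "V \<in> unitary_group N1" for U V
  proof -
    have "adj (\<theta> U) o\<^sub>L \<theta> V = adj (\<psi> U) o\<^sub>L \<psi> V"
      using W'(1) B.unitaryD(1)[OF \<psi>[OF that(1)]] by (simp add: \<theta>_def oL_assoc cancel)
    then show ?thesis
      using isometry_preserves_Re_inner[OF assms(2,3,1,5,4) that] by simp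
  qed
  ultimately obtain T where T: "real_unitary_iso N1 \<tau>1 N2 \<tau>2 T"
    and T\<theta>: "\<And>U. U \<in> unitary_group N1 \<Longrightarrow> T U = \<theta> U"
    using real_unitary_extension[OF assms(2,3), of \<theta>] by metis
  interpret T: real_unitary_iso N1 \<tau>1 N2 \<tau>2 T
    by (rule T)
  have \<psi>T: "\<psi> U = W o\<^sub>L T U" if "U \<in> unitary_group N1" for U
    using T\<theta>[OF that] by (simp add: \<theta>_def cancel)
  obtain j where j: "j = \<i> \<or> j = - \<i>"
    and Ti: "\<And>X. X \<in> N1 \<Longrightarrow> T (op_scaleC \<i> X) = op_scaleC j (T X)"
    and Tadj: "\<And>X. X \<in> N1 \<Longrightarrow> T (adj X) = adj (T X)"
    and Tsq: "\<And>X. X \<in> N1 \<Longrightarrow> T (X o\<^sub>L X) = T X o\<^sub>L T X"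
    using T.jordan by metis
  have scale: "op_scaleC c X = Re c *\<^sub>R X + Im c *\<^sub>R op_scaleC \<i> X" for c and X :: "'x::complex_hilbert \<Rightarrow>\<^sub>L 'x"
  proof -
    have "op_scaleC c X = op_scaleC (complex_of_real (Re c) + complex_of_real (Im c) * \<i>) X"
      by (rule arg_cong[where f = "\<lambda>d. op_scaleC d X"]) (simp add: complex_eq_iff)
    then show ?thesis
      by (simp only: op_scaleC_add_left op_scaleC_scaleC[symmetric] op_scaleC_of_real)
  qed
  show ?thesis
  proof (cases "j = \<i>")
    case True
    have "T (op_scaleC c X) = op_scaleC c (T X)" if "X \<in> N1" for c X
      using that by (simp add: scale[of c] T.add T.scaleR Ti True)
    then have "star_linear_bij N1 N2 T"
      by (simp add: star_linear_bij_def T.bij T.add Tadj)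
    then have "star_isomorphism N1 N2 T \<or> star_anti_isomorphism N1 N2 T"
      using Tsq by (rule jordan_iso_or_anti_iso[OF assms(2,3)])
    then show ?thesis
      using W \<psi>T by blast
  next
    case False
    then have j: "j = - \<i>"
      using j by simp
    \<comment> \<open>Here \<open>T\<close> is conjugate linear, so composing it with the adjoint
      gives a complex linear map that still preserves squares. Undoing the adjoint on
      \<open>U\<close> produces the second form.\<close>
    define \<phi> where "\<phi> X = T (adj X)" for X
    have "bij_betw adj N1 N1"
      by (rule bij_betw_byWitness[where f' = adj]) auto
    then have "bij_betw (T \<circ> adj) N1 N2"
      using T.bij by (rule bij_betw_trans)
    then have bij: "bij_betw \<phi> N1 N2"
      by (simp add: \<phi>_def[abs_def] comp_def)
    have "\<phi> (op_scaleC c X) = op_scaleC c (\<phi> X)" if "X \<in> N1" for c X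
      using that by (simp add: \<phi>_def scale[of c] scale[of "cnj c"] T.add T.diff T.scaleR Ti j)
    then have "star_linear_bij N1 N2 \<phi>"
      using bij by (auto simp: star_linear_bij_def \<phi>_def T.add Tadj)
    moreover have "\<phi> (X o\<^sub>L X) = \<phi> X o\<^sub>L \<phi> X" if "X \<in> N1" for X
      using that Tsq[of "adj X"] by (simp add: \<phi>_def)
    ultimately have "star_isomorphism N1 N2 \<phi> \<or> star_anti_isomorphism N1 N2 \<phi>"
      by (rule jordan_iso_or_anti_iso[OF assms(2,3)])
    moreover have "\<psi> U = W o\<^sub>L \<phi> (adj U)" if "U \<in> unitary_group N1" for U
      using \<psi>T[OF that] A.unitaryD(1)[OF that] by (simp add: \<phi>_def)
    ultimately show ?thesis
      using W by blast
  qed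
qed

end
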